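(* Let $Z$ be a real-valued semimartingale on $(\Omega,\mathcal F,(\mathcal F_t)_{t\ge 0},P)$, let $(T_n)_{n\ge1}$ be stopping times with disjoint graphs exhausting the jumps of $Z$, let $(W,H,\mu)$ be an abstract Wiener space, and let $(e_n)_{n\ge1}$ be a complete orthonormal basis of $H$ consisting of elements of $W^\star$. Fix $t\ge0$, let $$u_t(w,z)=\sum_{n:\,T_n(z)\le t}\Delta Z_{T_n}(z)\,\delta e_n(w)\,e_n,\qquad U_t(w,z)=w+u_t(w,z),$$ let $\Lambda_t$ be the associated Gaussian Jacobian $$\Lambda_t(w,z)=\prod_{n:\,T_n(z)\le t}(1+\Delta Z_{T_n}(z))e^{-\Delta Z_{T_n}(z)}\ \exp\Big(-\sum_{n:\,T_n(z)\le t}\Delta Z_{T_n}(z)\big((\delta e_n(w))^2-1\big)-\tfrac12\sum_{n:\,T_n(z)\le t}(\Delta Z_{T_n}(z))^2(\delta e_n(w))^2\Big),$$ let $D_t(z)=\prod_{s\le t}(1+\Delta Z_s(z))e^{-\Delta Z_s(z)}$, and let $$M_t=\{z\in\Omega:\ \Delta Z_{T_n}(z)\ne-1\ \text{ for all } n \text{ with } T_n(z)\le t\}$$ be the set of nondegeneracy of $\Lambda_t$. Then: 1. $\mu(U_t(M_t^c))=0$, i.e. for $P$-almost every $z\in M_t^c$ the image $\{U_t(w,z): w\in W_z\}$ is a $\mu$-null set, where $W_z$ is the domain of $U_t(\cdot,z)$. 2. For all positive measurable functions $f,g$ on $W\times\Omega$, $$\int_{W\times\Omega} f(U_t(w,z),z)\,|\Lambda_t(w,z)|\,g(w,z)\,d\mu\,dP=\int_{W\times\Omega}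 f(w,z)\Big(\sum_{y\in U_t(\cdot,z)^{-1}\{w\}}g(y,z)\Big)d\mu\,dP .$$ 3. Consequently, $P$-almost surely, for every positive measurable function $f$ on $W$, $$\int_W f(U_t(w,z))\,\Lambda_t(w,z)\,d\mu(w)=\int_W f\,d\mu\ \int_W\Lambda_t(w,z)\,d\mu(w),$$ and hence, $P\times\mu$-almost surely in $(z,w)$, $$\int_W\Lambda_t(w',z)\,d\mu(w')=\sum_{y\in U_t(\cdot,z)^{-1}\{w\}}\mathrm{sign}\,\Lambda_t(y,z)=\big|U_t(\cdot,z)^{-1}\{w\}\big|\ \mathrm{sign}(D_t(z)),$$ where $|\cdot|$ denotes cardinality. 4. Moreover, if $(W,H,\mu)$ is the classical Wiener space, then for $P$-almost all $z$ in the set $\{z\in\Omega: E_\mu[|\Lambda_t(\cdot,z)|]=1\}$ the map $w\mapsto U_t(w,z)$ is $\mu$-almost surely invertible, and its (measurable) inverse, denoted $(\tau,w)\mapsto V_t(w,z)(\tau)$, is the strong solution of the functional stochastic differential equation $$V_t(w,z)(\tau)=W_\tau(w)-\int_0^\tau\dot u_t(V_t(w,z),z)(s)\,ds .$$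
   Context: $(\Omega,\mathcal F,(\mathcal F_t)_{t\ge0},P)$ is a filtered probability space satisfying the usual conditions. $Z=(Z_t)_{t\ge0}$ is a real-valued semimartingale with jumps $\Delta Z_s=Z_s-Z_{s-}$; recall that $P$-almost surely $\sum_{s\le t}(\Delta Z_s)^2<\infty$ for all $t\ge0$, so the product $D_t$ converges. $(T_n)_{n\ge1}$ is a sequence of stopping times with pairwise disjoint graphs absorbing the jumps of $Z$, i.e. $\{(s,z):\Delta Z_s(z)\ne0\}$ is contained in the union of the graphs of the $T_n$. $(W,H,\mu)$ is an abstract Wiener space: $W$ is a separable Fréchet space, $\mu$ a Gaussian measure on $W$, and $H$ (infinite-dimensional) its Cameron–Martin space. $W^\star$ is the continuous dual of $W$, identified with a dense subset of $H$. $\delta$ is the Gaussian divergence (adjoint of the Sobolev derivative $\nabla$ under $\mu$); since $e_n\in W^\star$, $\delta e_n(w)=\langle e_n,w\rangle$ for every $w\in W$, and the $\delta e_n$ are i.i.d. standard Gaussian under $\mu$. For $P$-almost every $z$ the series defining $u_t(\cdot,z)$ converges in $H$ on the set $W_z=\{w\in W:\sum_{n:T_n(z)\le t}(\Delta Z_{T_n}(z))^2(\delta e_n(w))^2<\infty\}$, which is $H$-invariant ($W_z+H\subset W_z$) and has full $\mu$-measure; $U_t(\cdot,z)$ is regarded as defined on $W_z$, and $U_t(\cdot,z)^{-1}\{w\}=\{y\in W_z:U_t(y,z)=w\}$. The Sobolev derivative $\nabla u_t=\sum_{T_n\le t}\Delta Z_{T_n}e_n\otimes e_n$ is a Hilbert–Schmidt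 operator on $H$ not depending on $w$, and $\Lambda_t=\det_2(I_H+\nabla u_t)\exp(-\delta u_t-\frac12|u_t|_H^2)$, where $\det_2$ is the modified Carleman–Fredholm determinant and $\delta u_t=\sum_{T_n\le t}\Delta Z_{T_n}((\delta e_n)^2-1)$, the series converging in $L^2(\mu)$ for $P$-almost every $z$; a real-valued measurable version of $\delta u_t$ is fixed. $\mathrm{sign}(x)\in\{-1,0,1\}$ with $\mathrm{sign}(0)=0$; the convention $0\cdot\infty=0$ is used; $E_\mu$ is expectation under $\mu$. In part 4, the classical Wiener space is $W=C_0([0,1],\mathbb R)$ with Wiener measure $\mu$ and $H=\{h=\int_0^\cdot\dot h_s\,ds:\dot h\in L^2([0,1])\}$; $W_\tau(w)=w(\tau)$ is the coordinate process, and $\dot u_t(w,z)(s)$ is the density of $u_t(w,z)\in H$, i.e. $u_t(w,z)(\tau)=\int_0^\tau\dot u_t(w,z)(s)\,ds$. "$\mu$-almost surely invertible with inverse $V_t(\cdot,z)$" means that $V_t(\cdot,z):W\to W$ is measurable and $U_t(V_t(w,z),z)=w$ and $V_t(U_t(w,z),z)=w$ for $\mu$-almost all $w$. "Strong solution" means that $V_t(\cdot,z)$ is a measurable functional of the driving path $w$ satisfying the equation for all $\tau\in[0,1]$, $\mu$-almost surely (no adaptedness is required: the equation is anticipating). *)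

theory Defs
  imports "HOL-Probability.Probability"
begin

section \<open>Stochastic processes in continuous time\<close>

text \<open>
  Filtrations are indexed by reals, but only indices \<open>s \<ge> 0\<close> are constrained.  Random times take
  values in \<^typ>\<open>ennreal\<close>, because the value \<open>\<infinity>\<close> is allowed; this is why \<^const>\<open>stopping_time\<close>,
  which gives the time the type of the index of the filtration, is not used.
\<close>

definition usual_filtered_prob_space :: "'o measure \<Rightarrow> (real \<Rightarrow> 'o measure) \<Rightarrow> bool" where
  "usual_filtered_prob_space P F \<longleftrightarrow>
     prob_space P \<and> complete_measure P \<and>
     (\<forall>s\<ge>0. subalgebra P (F s)) \<and>
     (\<forall>s r. 0 \<le> s \<and> s \<le> r \<longrightarrow> sets (F s) \<subseteq> sets (F r)) \<and>
     (\<forall>s\<ge>0. sets (F s) = (\<Inter>r\<in>{s<..}. sets (F r))) \<and>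
     null_sets P \<subseteq> sets (F 0)"

definition stop_time :: "(real \<Rightarrow> 'o measure) \<Rightarrow> ('o \<Rightarrow> ennreal) \<Rightarrow> bool" where
  "stop_time F \<tau> \<longleftrightarrow> (\<forall>s\<ge>0. Measurable.pred (F s) (\<lambda>z. \<tau> z \<le> ennreal s))"

definition adapted :: "(real \<Rightarrow> 'o measure) \<Rightarrow> (real \<Rightarrow> 'o \<Rightarrow> real) \<Rightarrow> bool" where
  "adapted F X \<longleftrightarrow> (\<forall>s\<ge>0. X s \<in> borel_measurable (F s))"

definition cadlag :: "(real \<Rightarrow> real) \<Rightarrow> bool" where
  "cadlag x \<longleftrightarrow> (\<forall>s\<ge>0. (x \<longlongrightarrow> x s) (at_right s)) \<and> (\<forall>s>0. \<exists>l. (x \<longlongrightarrow> l) (at_left s))"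

text \<open>The convention \<open>x\<^bsub>0-\<^esub> = x\<^bsub>0\<^esub>\<close> is used, so there is no jump at time \<open>0\<close>.\<close>

definition jump :: "(real \<Rightarrow> real) \<Rightarrow> real \<Rightarrow> real" where
  "jump x s = (if s \<le> 0 then 0 else x s - Lim (at_left s) x)"

definition finite_variation :: "(real \<Rightarrow> real) \<Rightarrow> bool" where
  "finite_variation x \<longleftrightarrow>
     (\<forall>r\<ge>0. \<exists>C. \<forall>k p. p 0 = 0 \<and> p k = r \<and> (\<forall>i<k. p i \<le> p (Suc i)) \<longrightarrow>
        (\<Sum>i<k. \<bar>x (p (Suc i)) - x (p i)\<bar>) \<le> C)"

definition martingale :: "'o measure \<Rightarrow> (real \<Rightarrow> 'o measure) \<Rightarrow> (real \<Rightarrow> 'o \<Rightarrow> real) \<Rightarrow> bool" where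
  "martingale P F X \<longleftrightarrow>
     adapted F X \<and> (\<forall>s\<ge>0. integrable P (X s)) \<and>
     (\<forall>s r. 0 \<le> s \<and> s \<le> r \<longrightarrow> (AE z in P. real_cond_exp P (F s) (X r) z = X s z))"

definition stopped :: "(real \<Rightarrow> 'o \<Rightarrow> real) \<Rightarrow> ('o \<Rightarrow> ennreal) \<Rightarrow> real \<Rightarrow> 'o \<Rightarrow> real" where
  "stopped X \<tau> s z = X (enn2real (min (ennreal s) (\<tau> z))) z"

definition local_martingale ::
  "'o measure \<Rightarrow> (real \<Rightarrow> 'o measure) \<Rightarrow> (real \<Rightarrow> 'o \<Rightarrow> real) \<Rightarrow> bool" where
  "local_martingale P F M \<longleftrightarrow>
     adapted F M \<and> (\<forall>z\<in>space P. cadlag (\<lambda>s. M s z)) \<and>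
     (\<exists>\<tau>::nat \<Rightarrow> 'o \<Rightarrow> ennreal.
        (\<forall>n. stop_time F (\<tau> n)) \<and>
        (AE z in P. incseq (\<lambda>n. \<tau> n z) \<and> (\<lambda>n. \<tau> n z) \<longlonglongrightarrow> \<infinity>) \<and>
        (\<forall>n. martingale P F (\<lambda>s z. stopped M (\<tau> n) s z - M 0 z)))"

definition semimartingale ::
  "'o measure \<Rightarrow> (real \<Rightarrow> 'o measure) \<Rightarrow> (real \<Rightarrow> 'o \<Rightarrow> real) \<Rightarrow> bool" where
  "semimartingale P F Z \<longleftrightarrow>
     adapted F Z \<and> (\<forall>z\<in>space P. cadlag (\<lambda>s. Z s z)) \<and>
     (\<exists>M A. local_martingale P F M \<and>
        adapted F A \<and> (\<forall>z\<in>space P. cadlag (\<lambda>s. A s z) \<and> finite_variation (\<lambda>s. A s z)) \<and>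
        (\<forall>z\<in>space P. M 0 z = 0 \<and> A 0 z = 0) \<and>
        (AE z in P. \<forall>s\<ge>0. Z s z = Z 0 z + M s z + A s z))"

text \<open>The graph of \<open>T n\<close> is the set of all \<open>(s, z)\<close> with \<open>s < \<infinity>\<close> and \<open>T n z = s\<close>.\<close>

definition exhausts_jumps ::
  "'o measure \<Rightarrow> (real \<Rightarrow> 'o measure) \<Rightarrow> (real \<Rightarrow> 'o \<Rightarrow> real) \<Rightarrow> (nat \<Rightarrow> 'o \<Rightarrow> ennreal) \<Rightarrow> bool" where
  "exhausts_jumps P F Z T \<longleftrightarrow>
     (\<forall>n. stop_time F (T n)) \<and>
     (\<forall>m n. m \<noteq> n \<longrightarrow> (\<forall>z\<in>space P. \<forall>s\<ge>0. \<not> (T m z = ennreal s \<and> T n z = ennreal s))) \<and>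
     (\<forall>z\<in>space P. \<forall>s\<ge>0. jump (\<lambda>r. Z r z) s \<noteq> 0 \<longrightarrow> (\<exists>n. T n z = ennreal s))"


section \<open>Abstract Wiener spaces\<close>

class separable_frechet_space = real_vector + polish_space +
  assumes dist_translate: "dist (x + z) (y + z) = dist x y"
    and tendsto_scaleR_Pair: "LIM p (nhds (a::real) \<times>\<^sub>F nhds x). fst p *\<^sub>R snd p :> nhds (a *\<^sub>R x)"
    and locally_convex: "open U \<Longrightarrow> 0 \<in> U \<Longrightarrow> \<exists>V. open V \<and> 0 \<in> V \<and> V \<subseteq> U \<and>
      (\<forall>x\<in>V. \<forall>y\<in>V. \<forall>a b :: real. 0 \<le> a \<and> 0 \<le> b \<and> a + b = 1 \<longrightarrow> a *\<^sub>R x + b *\<^sub>R y \<in> V)"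

definition continuous_dual :: "('w::separable_frechet_space \<Rightarrow> real) set" where
  "continuous_dual = {\<phi>. linear \<phi> \<and> continuous_on UNIV \<phi>}"

definition gaussian_measure :: "'w::separable_frechet_space measure \<Rightarrow> bool" where
  "gaussian_measure \<mu> \<longleftrightarrow>
     prob_space \<mu> \<and> sets \<mu> = sets borel \<and>
     (\<forall>\<phi>\<in>continuous_dual. (AE w in \<mu>. \<phi> w = 0) \<or>
        (\<exists>\<sigma>>0. distributed \<mu> lborel \<phi> (normal_density 0 \<sigma>)))"

text \<open>
  The Cameron-Martin space is a Hilbert space \<^typ>\<open>'h\<close> with a continuous dense injection
  \<open>\<iota> : H \<rightarrow> W\<close>.  By transposition each \<open>\<phi>\<close> in the dual of \<open>W\<close> becomes an element \<open>k\<close> of \<open>H\<close>,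
  and the last clause says that the variance of \<open>\<phi>\<close> under \<open>\<mu>\<close> is the squared norm of \<open>k\<close> in \<open>H\<close>;
  this makes \<open>H\<close> the Cameron-Martin space of \<open>\<mu>\<close>.
\<close>

definition abstract_wiener_space ::
  "'w::separable_frechet_space measure \<Rightarrow> ('h::{real_inner, complete_space} \<Rightarrow> 'w) \<Rightarrow> bool" where
  "abstract_wiener_space \<mu> \<iota> \<longleftrightarrow>
     gaussian_measure \<mu> \<and>
     linear \<iota> \<and> continuous_on UNIV \<iota> \<and> inj \<iota> \<and> closure (range \<iota>) = UNIV \<and>
     (\<forall>\<phi>\<in>continuous_dual. \<exists>k.
        (\<forall>h. \<phi> (\<iota> h) = inner k h) \<and> (\<integral>w. (\<phi> w)\<^sup>2 \<partial>\<mu>) = (norm k)\<^sup>2)"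

definition dual_in_H :: "('h::{real_inner, complete_space} \<Rightarrow> 'w::separable_frechet_space) \<Rightarrow> 'h set" where
  "dual_in_H \<iota> = {k. \<exists>\<phi>\<in>continuous_dual. \<forall>h. \<phi> (\<iota> h) = inner k h}"

text \<open>
  For \<open>k\<close> in the dual of \<open>W\<close>, the divergence of the constant field \<open>k\<close> is the functional
  \<open>w \<mapsto> \<langle>k, w\<rangle>\<close>, unique by density of \<open>H\<close> in \<open>W\<close>.
\<close>

definition div_const ::
  "('h::{real_inner, complete_space} \<Rightarrow> 'w::separable_frechet_space) \<Rightarrow> 'h \<Rightarrow> 'w \<Rightarrow> real" where
  "div_const \<iota> k = (THE \<phi>. \<phi> \<in> continuous_dual \<and> (\<forall>h. \<phi> (\<iota> h) = inner k h))"

definition complete_orthonormal_basis :: "(nat \<Rightarrow> 'h::{real_inner, complete_space}) \<Rightarrow> bool" where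
  "complete_orthonormal_basis e \<longleftrightarrow>
     (\<forall>m n. inner (e m) (e n) = (if m = n then 1 else 0)) \<and> closure (span (range e)) = UNIV"


section \<open>The transformation induced by the jumps\<close>

text \<open>Unordered product, the multiplicative analogue of \<^const>\<open>infsum\<close>.\<close>

definition infprod :: "('i \<Rightarrow> real) \<Rightarrow> 'i set \<Rightarrow> real" where
  "infprod f A = Lim (finite_subsets_at_top A) (prod f)"

definition jump_idx :: "(nat \<Rightarrow> 'o \<Rightarrow> ennreal) \<Rightarrow> real \<Rightarrow> 'o \<Rightarrow> nat set" where
  "jump_idx T t z = {n. T n z \<le> ennreal t}"

text \<open>Only meaningful when \<open>T n z < \<infinity>\<close>.\<close>

definition jump_at :: "(real \<Rightarrow> 'o \<Rightarrow> real) \<Rightarrow> (nat \<Rightarrow> 'o \<Rightarrow> ennreal) \<Rightarrow> 'o \<Rightarrow> nat \<Rightarrow> real" where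
  "jump_at Z T z n = jump (\<lambda>s. Z s z) (enn2real (T n z))"

context
  fixes \<iota> :: "'h::{real_inner, complete_space} \<Rightarrow> 'w::separable_frechet_space"
    and e :: "nat \<Rightarrow> 'h"
    and Z :: "real \<Rightarrow> 'o \<Rightarrow> real"
    and T :: "nat \<Rightarrow> 'o \<Rightarrow> ennreal"
    and t :: real
begin

definition W_dom :: "'o \<Rightarrow> 'w set" where
  "W_dom z = {w. (\<lambda>n. (jump_at Z T z n)\<^sup>2 * (div_const \<iota> (e n) w)\<^sup>2) summable_on jump_idx T t z}"

definition u_field :: "'o \<Rightarrow> 'w \<Rightarrow> 'h" where
  "u_field z w = (\<Sum>\<^sub>\<infinity>n\<in>jump_idx T t z. (jump_at Z T z n * div_const \<iota> (e n) w) *\<^sub>R e n)"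

text \<open>\<open>u_field\<close> and \<open>U_map\<close> are total functions, used only on \<open>W_dom z\<close> as far as images and fibres
  are concerned.\<close>

definition U_map :: "'o \<Rightarrow> 'w \<Rightarrow> 'w" where
  "U_map z w = w + \<iota> (u_field z w)"

definition U_fibre :: "'o \<Rightarrow> 'w \<Rightarrow> 'w set" where
  "U_fibre z w = {y \<in> W_dom z. U_map z y = w}"

text \<open>
  The series \<open>\<Sum> \<Delta>Z\<^bsub>T n\<^esub> ((\<delta>e\<^sub>n)\<^sup>2 - 1)\<close> need not converge absolutely, hence not unconditionally
  pointwise in \<open>w\<close>; its sum \<open>\<delta>u\<close> is an \<open>L\<^sup>2(\<mu>)\<close> limit, of which a real-valued jointly
  measurable version is chosen.
\<close>

definition divergence_version ::
  "'w measure \<Rightarrow> 'o measure \<Rightarrow> ('o \<Rightarrow> 'w \<Rightarrow> real) \<Rightarrow> bool" where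
  "divergence_version \<mu> P \<delta>u \<longleftrightarrow>
     (\<lambda>(w, z). \<delta>u z w) \<in> borel_measurable (\<mu> \<Otimes>\<^sub>M P) \<and>
     (AE z in P. (\<lambda>N. \<integral>\<^sup>+w. ennreal (((\<Sum>n\<in>jump_idx T t z \<inter> {..<N}.
          jump_at Z T z n * ((div_const \<iota> (e n) w)\<^sup>2 - 1)) - \<delta>u z w)\<^sup>2) \<partial>\<mu>) \<longlonglongrightarrow> 0)"

definition Lambda :: "('o \<Rightarrow> 'w \<Rightarrow> real) \<Rightarrow> 'o \<Rightarrow> 'w \<Rightarrow> real" where
  "Lambda \<delta>u z w =
     infprod (\<lambda>n. (1 + jump_at Z T z n) * exp (- jump_at Z T z n)) (jump_idx T t z) *
     exp (- \<delta>u z w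
          - (1/2) * (\<Sum>\<^sub>\<infinity>n\<in>jump_idx T t z. (jump_at Z T z n)\<^sup>2 * (div_const \<iota> (e n) w)\<^sup>2))"

end

definition D_prod :: "(real \<Rightarrow> 'o \<Rightarrow> real) \<Rightarrow> real \<Rightarrow> 'o \<Rightarrow> real" where
  "D_prod Z t z = infprod (\<lambda>s. (1 + jump (\<lambda>r. Z r z) s) * exp (- jump (\<lambda>r. Z r z) s)) {0..t}"

definition nondegeneracy_set ::
  "'o measure \<Rightarrow> (real \<Rightarrow> 'o \<Rightarrow> real) \<Rightarrow> (nat \<Rightarrow> 'o \<Rightarrow> ennreal) \<Rightarrow> real \<Rightarrow> 'o set" where
  "nondegeneracy_set P Z T t = {z \<in> space P. \<forall>n\<in>jump_idx T t z. jump_at Z T z n \<noteq> -1}"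

text \<open>
  The integral of \<open>f \<cdot> \<rho>\<close> for \<open>f\<close> with values in \<open>[0, \<infinity>]\<close> and a signed real weight \<open>\<rho>\<close>; it exists
  when the positive and the negative part do not both have infinite integral.
\<close>

definition weighted_integral_exists :: "'a measure \<Rightarrow> ('a \<Rightarrow> ennreal) \<Rightarrow> ('a \<Rightarrow> real) \<Rightarrow> bool" where
  "weighted_integral_exists M f \<rho> \<longleftrightarrow>
     (\<integral>\<^sup>+x. f x * ennreal (\<rho> x) \<partial>M) < \<infinity> \<or> (\<integral>\<^sup>+x. f x * ennreal (- \<rho> x) \<partial>M) < \<infinity>"

definition weighted_integral :: "'a measure \<Rightarrow> ('a \<Rightarrow> ennreal) \<Rightarrow> ('a \<Rightarrow> real) \<Rightarrow> ereal" where
  "weighted_integral M f \<rho> =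
     enn2ereal (\<integral>\<^sup>+x. f x * ennreal (\<rho> x) \<partial>M) - enn2ereal (\<integral>\<^sup>+x. f x * ennreal (- \<rho> x) \<partial>M)"

text \<open>Cardinality with value \<open>\<infinity>\<close> for infinite sets.\<close>

definition ext_card :: "'a set \<Rightarrow> ereal" where
  "ext_card A = enn2ereal (emeasure (count_space UNIV) A)"


section \<open>The classical Wiener space\<close>

definition L2_unit_interval :: "(real \<Rightarrow> real) set" where
  "L2_unit_interval =
     {g. g \<in> borel_measurable borel \<and> set_integrable lborel {0..1} (\<lambda>s. (g s)\<^sup>2)}"

text \<open>
  \<open>c w \<tau>\<close> is the value at \<open>\<tau> \<in> [0, 1]\<close> of the path \<open>w\<close>, i.e. \<open>c\<close> identifies \<open>W\<close>, as a topological
  vector space, with the continuous functions on \<open>[0, 1]\<close> vanishing at \<open>0\<close> under uniform convergence.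
\<close>

definition is_path_density :: "('w \<Rightarrow> real \<Rightarrow> real) \<Rightarrow> 'w \<Rightarrow> (real \<Rightarrow> real) \<Rightarrow> bool" where
  "is_path_density c v g \<longleftrightarrow>
     g \<in> L2_unit_interval \<and> (\<forall>\<tau>\<in>{0..1}. c v \<tau> = (LINT s:{0..\<tau>}|lborel. g s))"

definition path_density :: "('w \<Rightarrow> real \<Rightarrow> real) \<Rightarrow> 'w \<Rightarrow> real \<Rightarrow> real" where
  "path_density c v = (SOME g. is_path_density c v g)"

definition is_C0_unit_interval :: "('w::separable_frechet_space \<Rightarrow> real \<Rightarrow> real) \<Rightarrow> bool" where
  "is_C0_unit_interval c \<longleftrightarrow>
     (\<forall>\<tau>\<in>{0..1}. linear (\<lambda>w. c w \<tau>)) \<and>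
     (\<forall>w. continuous_on {0..1} (c w) \<and> c w 0 = 0) \<and>
     (\<forall>x. continuous_on {0..1} x \<and> x 0 = 0 \<longrightarrow> (\<exists>!w. \<forall>\<tau>\<in>{0..1}. c w \<tau> = x \<tau>)) \<and>
     (\<forall>S. open S \<longleftrightarrow> (\<forall>w\<in>S. \<exists>\<epsilon>>0. \<forall>v. (\<forall>\<tau>\<in>{0..1}. \<bar>c v \<tau> - c w \<tau>\<bar> < \<epsilon>) \<longrightarrow> v \<in> S))"

definition wiener_measure :: "('w::separable_frechet_space \<Rightarrow> real \<Rightarrow> real) \<Rightarrow> 'w measure \<Rightarrow> bool" where
  "wiener_measure c \<mu> \<longleftrightarrow>
     prob_space \<mu> \<and> sets \<mu> = sets borel \<and>
     (\<forall>a b. 0 \<le> a \<and> a < b \<and> b \<le> 1 \<longrightarrow>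
        distributed \<mu> lborel (\<lambda>w. c w b - c w a) (normal_density 0 (sqrt (b - a)))) \<and>
     (\<forall>k p. p 0 = 0 \<and> (\<forall>i<k. p i < p (Suc i)) \<and> p k \<le> 1 \<longrightarrow>
        prob_space.indep_vars \<mu> (\<lambda>_. borel) (\<lambda>i w. c w (p (Suc i)) - c w (p i)) {..<k})"

definition classical_wiener_space ::
  "('w::separable_frechet_space \<Rightarrow> real \<Rightarrow> real) \<Rightarrow> 'w measure \<Rightarrow>
     ('h::{real_inner, complete_space} \<Rightarrow> 'w) \<Rightarrow> bool" where
  "classical_wiener_space c \<mu> \<iota> \<longleftrightarrow>
     is_C0_unit_interval c \<and> wiener_measure c \<mu> \<and>
     (\<forall>h. \<exists>g. is_path_density c (\<iota> h) g \<and> (norm h)\<^sup>2 = (LINT s:{0..1}|lborel. (g s)\<^sup>2)) \<and>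
     (\<forall>g\<in>L2_unit_interval. \<exists>h. is_path_density c (\<iota> h) g)"

definition ae_inverse :: "'w measure \<Rightarrow> 'w set \<Rightarrow> ('w \<Rightarrow> 'w) \<Rightarrow> ('w \<Rightarrow> 'w) \<Rightarrow> bool" where
  "ae_inverse \<mu> D U V \<longleftrightarrow>
     V \<in> measurable \<mu> \<mu> \<and>
     (AE w in \<mu>. V w \<in> D \<and> U (V w) = w) \<and>
     (AE w in \<mu>. w \<in> D \<and> V (U w) = w)"

definition strong_solution ::
  "'w measure \<Rightarrow> ('w \<Rightarrow> real \<Rightarrow> real) \<Rightarrow> 'w set \<Rightarrow> ('w \<Rightarrow> real \<Rightarrow> real) \<Rightarrow> ('w \<Rightarrow> 'w) \<Rightarrow> bool" where
  "strong_solution \<mu> c D udot V \<longleftrightarrow>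
     V \<in> measurable \<mu> \<mu> \<and>
     (AE w in \<mu>. V w \<in> D \<and>
        (\<forall>\<tau>\<in>{0..1}. c (V w) \<tau> = c w \<tau> - (LINT s:{0..\<tau>}|lborel. udot (V w) s)))"

end

theory Submission
  imports Defs
begin

text \<open>
  For fixed \<open>z\<close> put \<open>a n = \<Delta>Z\<^bsub>T n\<^esub>\<close> if \<open>T n \<le> t\<close> and \<open>a n = 0\<close> otherwise.  The map \<open>U\<close> is linear and
  diagonal: it multiplies the coordinate \<open>\<delta>e\<^sub>n\<close> by \<open>1 + a n\<close>.  The variance of
  \<open>\<Sum> a n ((\<delta>e\<^sub>n)\<^sup>2 - 1)\<close> being \<open>2 \<Sum> (a n)\<^sup>2\<close>, the convergence of the series for \<open>\<delta>u\<close> in \<open>L\<^sup>2(\<mu>)\<close> forces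
  \<open>a\<close> to be square summable.  If some
  \<open>a n = -1\<close>, then \<open>\<delta>e\<^sub>n\<close> vanishes on the range of \<open>U\<close> and \<open>\<Lambda> = 0\<close>.  Otherwise \<open>U\<close> is a bijection of
  its domain, with inverse \<open>V\<close> the diagonal map with coefficients \<open>- a n / (1 + a n)\<close>, and everything
  follows from \<open>\<integral> h(U) |\<Lambda>| d\<mu> = \<integral> h d\<mu>\<close>.

  When only finitely many \<open>a n\<close> are nonzero, this is a change of variables in one real variable at a
  time, because \<open>\<mu>\<close> is the law of \<open>w + (x - \<delta>e\<^sub>n(w)) e\<^sub>n\<close> under \<open>\<mu> \<otimes> N(0, 1)\<close>; this in turn holds
  because both measures have the same characteristic functional, which determines a measure by the
  Hahn-Banach and Stone-Weierstrass theorems.  In the limit, Fatou's lemma gives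
  \<open>\<integral> h(U) |\<Lambda>| d\<mu> \<le> \<integral> h d\<mu>\<close>.  The same inequality holds for \<open>V\<close> and its Jacobian \<open>\<Lambda>'\<close>, and since
  \<open>\<Lambda>(V) \<Lambda>' = 1\<close>, applying it to \<open>h(U) |\<Lambda>|\<close> yields the reverse inequality.
\<close>

section \<open>Separable Frechet spaces\<close>

text \<open>The chaos series for \<delta>u converges in L^2 only, so the Jacobians converge
  pointwise only along a subsequence and off a null set. The same subsequence serves the inverse
  map: -a/(1+a) = -a + a^2/(1+a), so its chaos series is that of U with the sign changed plus an
  absolutely convergent correction. And the inverse map almost surely avoids the exceptional null
  set, by the Fatou inequality for the inverse and positivity of its limit density; only then do the
  relations between the finite Jacobians pass to the limit densities. Fatou's lemma asks for no
  domination of the Jacobians, but it may lose mass, hence the second inequality; it is applied to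
  indicators of open sets because the finite maps converge only in the topology of W.

  A Gaussian measure is given only through the laws of single functionals. Joint facts are therefore
  drawn from linear combinations: the law after resampling a coordinate from characteristic
  functionals, the covariances of the (\<delta>e_n)^2 from fourth moments by polarization.\<close>

lemma frechet_dist_add_le:
  fixes x y a b :: "'w::separable_frechet_space"
  shows "dist (x + y) (a + b) \<le> dist x a + dist y b"
proof -
  have "dist (x + y) (a + b) \<le> dist (x + y) (a + y) + dist (a + y) (a + b)"
    by (rule dist_triangle)
  also have "dist (a + y) (a + b) = dist y b"
    using dist_translate[of y a b] by (simp add: add.commute)
  finally show ?thesis by (simp add: dist_translate)
qed

lemma frechet_tendsto_scaleR:
  fixes g :: "'b \<Rightarrow> 'w::separable_frechet_space"
  assumes "(f \<longlongrightarrow> a) F" "(g \<longlongrightarrow> x) F"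
  shows "((\<lambda>i. f i *\<^sub>R g i) \<longlongrightarrow> a *\<^sub>R x) F"
  using filterlim_compose[OF tendsto_scaleR_Pair filterlim_Pair[OF assms]] by simp

text \<open>Translation invariance makes addition Lipschitz in each argument, and negation is
  scaling by -1. The instance opens the usual limit rules for sums and differences to such
  spaces.\<close>

instance separable_frechet_space \<subseteq> topological_ab_group_add
proof
  fix a b :: 'a
  show "((\<lambda>x. fst x + snd x) \<longlongrightarrow> a + b) (nhds a \<times>\<^sub>F nhds b)"
  proof (rule tendstoI)
    fix \<epsilon> :: real assume "\<epsilon> > 0"
    have "\<forall>\<^sub>F x in nhds c. dist x c < \<epsilon>/2" for c :: 'a
      unfolding eventually_nhds_metric using \<open>\<epsilon> > 0\<close> by (intro exI[of _ "\<epsilon>/2"]) simp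
    then have "\<forall>\<^sub>F x in nhds a \<times>\<^sub>F nhds b. dist (fst x) a < \<epsilon>/2 \<and> dist (snd x) b < \<epsilon>/2"
      unfolding eventually_prod_filter by fastforce
    then show "\<forall>\<^sub>F x in nhds a \<times>\<^sub>F nhds b. dist (fst x + snd x) (a + b) < \<epsilon>"
    proof eventually_elim
      case (elim x)
      then show ?case using frechet_dist_add_le[of "fst x" "snd x" a b] by linarith
    qed
  qed
  show "(uminus \<longlongrightarrow> - a) (nhds a)"
    using frechet_tendsto_scaleR[of "\<lambda>_. -1" "-1" "nhds a" "\<lambda>x. x" a]
    by (simp add: filterlim_ident)
qed

lemma frechet_continuous_scaleR:
  "continuous_on UNIV (\<lambda>p::real \<times> 'w::separable_frechet_space. fst p *\<^sub>R snd p)"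
  unfolding continuous_on_def
  by (intro ballI frechet_tendsto_scaleR tendsto_fst tendsto_snd tendsto_ident_at)

lemma frechet_measurable_scaleR [measurable (raw)]:
  fixes g :: "'a \<Rightarrow> 'w::separable_frechet_space"
  assumes "f \<in> borel_measurable M" "g \<in> borel_measurable M"
  shows "(\<lambda>x. f x *\<^sub>R g x) \<in> borel_measurable M"
  by (rule borel_measurable_continuous_Pair[OF assms frechet_continuous_scaleR])

lemma continuous_dual_continuous: "\<phi> \<in> continuous_dual \<Longrightarrow> continuous_on A \<phi>"
  by (auto simp: continuous_dual_def intro: continuous_on_subset)

lemma continuous_dual_linear: "\<phi> \<in> continuous_dual \<Longrightarrow> linear \<phi>"
  by (simp add: continuous_dual_def)

lemma continuous_dual_measurable: "\<phi> \<in> continuous_dual \<Longrightarrow> \<phi> \<in> borel_measurable borel"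
  by (simp add: continuous_dual_def borel_measurable_continuous_onI)

lemma continuous_dual_add:
  "\<phi> \<in> continuous_dual \<Longrightarrow> \<psi> \<in> continuous_dual \<Longrightarrow> (\<lambda>w. \<phi> w + \<psi> w) \<in> continuous_dual"
  by (auto simp: continuous_dual_def intro!: continuous_intros linear_compose_add)

lemma continuous_dual_scale:
  "\<phi> \<in> continuous_dual \<Longrightarrow> (\<lambda>w. c * \<phi> w) \<in> continuous_dual"
  by (auto simp: continuous_dual_def linear_iff algebra_simps intro!: continuous_intros)

lemma continuous_dual_diff:
  "\<phi> \<in> continuous_dual \<Longrightarrow> \<psi> \<in> continuous_dual \<Longrightarrow> (\<lambda>w. \<phi> w - \<psi> w) \<in> continuous_dual"
  using continuous_dual_add[OF _ continuous_dual_scale[of \<psi> "-1"], of \<phi>] by simp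

lemma continuous_dual_zero: "(\<lambda>_. 0) \<in> continuous_dual"
  by (auto simp: continuous_dual_def linear_iff)

subsection \<open>Sublinear functionals and the Hahn-Banach theorem\<close>

definition sublinear :: "('v::real_vector \<Rightarrow> real) \<Rightarrow> bool" where
  "sublinear p \<longleftrightarrow> (\<forall>x y. p (x + y) \<le> p x + p y) \<and> (\<forall>x. \<forall>s\<ge>0. p (s *\<^sub>R x) = s * p x)"

lemma sublinear_add: "sublinear p \<Longrightarrow> p (x + y) \<le> p x + p y"
  by (simp add: sublinear_def)

lemma sublinear_scaleR: "sublinear p \<Longrightarrow> 0 \<le> s \<Longrightarrow> p (s *\<^sub>R x) = s * p x"
  by (simp add: sublinear_def)

lemma sublinear_zero: "sublinear p \<Longrightarrow> p 0 = 0"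
  using sublinear_scaleR[of p 0 0] by simp

lemma sublinear_minus: "sublinear p \<Longrightarrow> - p (- x) \<le> p x"
  using sublinear_add[of p x "-x"] sublinear_zero[of p] by simp

text \<open>A sublinear functional below \<open>p\<close> whose value at \<open>- x\<close> is as small as possible.\<close>

definition sublinear_tilt :: "('v::real_vector \<Rightarrow> real) \<Rightarrow> 'v \<Rightarrow> 'v \<Rightarrow> real" where
  "sublinear_tilt p x y = (INF s\<in>{0..}. p (y + s *\<^sub>R x) - s * p x)"

text \<open>Uniformly in \<open>s\<close> the quantity is at least \<open>- p (- y)\<close>, because
  \<open>s * p x\<close> is at most \<open>p (y + s *\<^sub>R x) + p (- y)\<close>. A real infimum
  needs such a bound to be meaningful.\<close>

lemma sublinear_tilt_bdd:
  assumes "sublinear p"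
  shows "bdd_below ((\<lambda>s. p (y + s *\<^sub>R x) - s * p x) ` {0..})"
proof (rule bdd_belowI2)
  fix s :: real assume "s \<in> {0..}"
  then have "s * p x \<le> p (y + s *\<^sub>R x) + p (- y)"
    using sublinear_add[OF assms, of "y + s *\<^sub>R x" "-y"] sublinear_scaleR[OF assms, of s x]
    by (simp add: algebra_simps)
  then show "- p (- y) \<le> p (y + s *\<^sub>R x) - s * p x" by simp
qed

lemma sublinear_tilt_le:
  assumes "sublinear p" "0 \<le> s"
  shows "sublinear_tilt p x y \<le> p (y + s *\<^sub>R x) - s * p x"
  unfolding sublinear_tilt_def
  by (rule cINF_lower[OF sublinear_tilt_bdd[OF assms(1)]]) (use assms in auto)

lemma sublinear_tilt_sublinear:
  assumes p: "sublinear p"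
  shows "sublinear (sublinear_tilt p x)"
  unfolding sublinear_def
proof (intro conjI allI impI)
  fix y z
  show "sublinear_tilt p x (y + z) \<le> sublinear_tilt p x y + sublinear_tilt p x z"
  proof -
    \<comment> \<open>Parameters \<open>s\<close> for \<open>y\<close> and \<open>r\<close> for
      \<open>z\<close> combine into \<open>s + r\<close> for \<open>y + z\<close>; the two infima
      are then taken one after the other.\<close>
    have 1: "sublinear_tilt p x (y + z) - (p (z + r *\<^sub>R x) - r * p x) \<le> p (y + s *\<^sub>R x) - s * p x"
      if "0 \<le> s" "0 \<le> r" for s r
    proof -
      have "sublinear_tilt p x (y + z) \<le> p (y + z + (s + r) *\<^sub>R x) - (s + r) * p x"
        using sublinear_tilt_le[OF p, of "s + r"] that by simp
      moreover have "p (y + z + (s + r) *\<^sub>R x) \<le> p (y + s *\<^sub>R x) + p (z + r *\<^sub>R x)"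
        using sublinear_add[OF p, of "y + s *\<^sub>R x" "z + r *\<^sub>R x"] by (simp add: algebra_simps)
      ultimately show ?thesis by (simp add: algebra_simps)
    qed
    have 2: "sublinear_tilt p x (y + z) - (p (z + r *\<^sub>R x) - r * p x) \<le> sublinear_tilt p x y"
      if "0 \<le> r" for r
      unfolding sublinear_tilt_def[of p x y] using 1 that by (intro cINF_greatest) auto
    have "sublinear_tilt p x (y + z) - sublinear_tilt p x y \<le> sublinear_tilt p x z"
      unfolding sublinear_tilt_def[of p x z] using 2 by (intro cINF_greatest) (auto simp: algebra_simps)
    then show ?thesis by simp
  qed
next
  fix y and s :: real assume "0 \<le> s"
  \<comment> \<open>One inequality for every positive factor suffices: applied to
    \<open>inverse s\<close> and \<open>s *\<^sub>R y\<close> it yields the other one.\<close>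
  have le: "sublinear_tilt p x (s *\<^sub>R y) \<le> s * sublinear_tilt p x y" if "0 < s" for s y
  proof -
    have "sublinear_tilt p x (s *\<^sub>R y) / s \<le> p (y + r *\<^sub>R x) - r * p x" if "0 \<le> r" for r
    proof -
      have "sublinear_tilt p x (s *\<^sub>R y) \<le> p (s *\<^sub>R y + (s * r) *\<^sub>R x) - (s * r) * p x"
        using sublinear_tilt_le[OF p, of "s * r"] that \<open>0 < s\<close> by simp
      also have "s *\<^sub>R y + (s * r) *\<^sub>R x = s *\<^sub>R (y + r *\<^sub>R x)" by (simp add: algebra_simps)
      also have "p (s *\<^sub>R (y + r *\<^sub>R x)) = s * p (y + r *\<^sub>R x)"
        using sublinear_scaleR[OF p] \<open>0 < s\<close> by simp
      finally show ?thesis using \<open>0 < s\<close> by (simp add: field_simps)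
    qed
    then have "sublinear_tilt p x (s *\<^sub>R y) / s \<le> sublinear_tilt p x y"
      unfolding sublinear_tilt_def[of p x y] by (intro cINF_greatest) auto
    then show ?thesis using \<open>0 < s\<close> by (simp add: field_simps)
  qed
  show "sublinear_tilt p x (s *\<^sub>R y) = s * sublinear_tilt p x y"
  proof (cases "s = 0")
    case True
    have "sublinear_tilt p x 0 \<le> 0"
      using sublinear_tilt_le[OF p, of 0 x 0] sublinear_zero[OF p] by simp
    moreover have "0 \<le> sublinear_tilt p x 0"
      unfolding sublinear_tilt_def
      by (intro cINF_greatest) (auto simp: sublinear_scaleR[OF p])
    ultimately show ?thesis using True by simp
  next
    case False
    then have s: "0 < s" using \<open>0 \<le> s\<close> by simp
    have "s * sublinear_tilt p x y = s * sublinear_tilt p x (inverse s *\<^sub>R s *\<^sub>R y)" using s by simp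
    also have "\<dots> \<le> s * (inverse s * sublinear_tilt p x (s *\<^sub>R y))"
      using le[of "inverse s" "s *\<^sub>R y"] s by (intro mult_left_mono) auto
    also have "\<dots> = sublinear_tilt p x (s *\<^sub>R y)" using s by simp
    finally show ?thesis using le[OF s, of y] by simp
  qed
qed

lemma sublinear_tilt_minus_le:
  assumes "sublinear p"
  shows "sublinear_tilt p x (- x) \<le> - p x"
  using sublinear_tilt_le[OF assms, of 1 x "-x"] sublinear_zero[OF assms] by simp

lemma sublinear_tilt_le_self:
  assumes "sublinear p"
  shows "sublinear_tilt p x y \<le> p y"
  using sublinear_tilt_le[OF assms, of 0 x y] by simp

text \<open>Infima of sublinear functionals are not subadditive in general. In a chain, two members
  used at \<open>x\<close> and at \<open>y\<close> can both be replaced by the smaller one. The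
  common bound \<open>p\<close> keeps the infimum finite, with \<open>- p (- y)\<close> as a lower
  bound.\<close>

lemma sublinear_chain_Inf:
  assumes ne: "C \<noteq> {}" and sub: "\<And>q. q \<in> C \<Longrightarrow> sublinear q \<and> q \<le> p"
    and chain: "\<And>q r. q \<in> C \<Longrightarrow> r \<in> C \<Longrightarrow> q \<le> r \<or> r \<le> q"
  shows "sublinear (\<lambda>y. INF q\<in>C. q y)" "\<And>q y. q \<in> C \<Longrightarrow> (INF q\<in>C. q y) \<le> q y"
proof -
  have bdd: "bdd_below ((\<lambda>q. q y) ` C)" for y
  proof (rule bdd_belowI2)
    fix q assume "q \<in> C"
    then have "sublinear q" "q (- y) \<le> p (- y)" using sub by (auto simp: le_fun_def)
    then show "- p (- y) \<le> q y" using sublinear_minus[of q y] by simp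
  qed
  show lower: "\<And>q y. q \<in> C \<Longrightarrow> (INF q\<in>C. q y) \<le> q y"
    by (rule cINF_lower[OF bdd])
  show "sublinear (\<lambda>y. INF q\<in>C. q y)"
    unfolding sublinear_def
  proof (intro conjI allI impI)
    fix x y
    have 1: "(INF q\<in>C. q (x + y)) - r y \<le> q x" if "q \<in> C" "r \<in> C" for q r
    proof -
      have "\<exists>m. m \<in> C \<and> m \<le> q \<and> m \<le> r" using chain[OF \<open>q \<in> C\<close> \<open>r \<in> C\<close>] \<open>q \<in> C\<close> \<open>r \<in> C\<close> by blast
      then obtain m where m: "m \<in> C" "m \<le> q" "m \<le> r" by blast
      have "(INF q\<in>C. q (x + y)) \<le> m (x + y)" using lower m by blast
      also have "\<dots> \<le> m x + m y" using sub m sublinear_add by blast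
      also have "\<dots> \<le> q x + r y" using m by (intro add_mono) (auto simp: le_fun_def)
      finally show ?thesis by simp
    qed
    have 2: "(INF q\<in>C. q (x + y)) - (INF q\<in>C. q x) \<le> r y" if "r \<in> C" for r
    proof -
      have "(INF q\<in>C. q (x + y)) - r y \<le> (INF q\<in>C. q x)"
        using 1 that ne by (intro cINF_greatest) auto
      then show ?thesis by simp
    qed
    have "(INF q\<in>C. q (x + y)) - (INF q\<in>C. q x) \<le> (INF q\<in>C. q y)"
      using 2 ne by (intro cINF_greatest) auto
    then show "(INF q\<in>C. q (x + y)) \<le> (INF q\<in>C. q x) + (INF q\<in>C. q y)" by simp
  next
    fix x and s :: real assume s: "0 \<le> s"
    have eq: "q (s *\<^sub>R x) = s * q x" if "q \<in> C" for q using sub[OF that] sublinear_scaleR s by blast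
    have "(INF q\<in>C. q (s *\<^sub>R x)) = (INF q\<in>C. s * q x)" using eq by (intro INF_cong) auto
    also have "\<dots> = s * (INF q\<in>C. q x)"
    proof (cases "s = 0")
      case False
      have "(INF q\<in>C. s * q x) = s * Inf ((\<lambda>q. q x) ` C)"
      proof (rule antisym)
        have "(INF q\<in>C. s * q x) / s \<le> (INF q\<in>C. q x)"
        proof (rule cINF_greatest[OF ne])
          fix q assume q: "q \<in> C"
          have "(INF q\<in>C. s * q x) \<le> s * q x"
          proof (rule cINF_lower[OF _ q])
            show "bdd_below ((\<lambda>q. s * q x) ` C)"
              using bdd[of "s *\<^sub>R x"] eq by (simp cong: image_cong)
          qed
          then show "(INF q\<in>C. s * q x) / s \<le> q x" using s False by (simp add: field_simps)
        qed
        then show "(INF q\<in>C. s * q x) \<le> s * (INF q\<in>C. q x)" using s False by (simp add: field_simps)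
        show "s * (INF q\<in>C. q x) \<le> (INF q\<in>C. s * q x)"
          using ne s lower by (intro cINF_greatest mult_left_mono) auto
      qed
      then show ?thesis .
    qed (use ne in simp)
    finally show "(INF q\<in>C. q (s *\<^sub>R x)) = s * (INF q\<in>C. q x)" .
  qed
qed

lemma minimal_sublinear_exists:
  assumes p: "sublinear p"
  obtains q where "sublinear q" "q \<le> p" "\<And>r. sublinear r \<Longrightarrow> r \<le> q \<Longrightarrow> r = q"
proof -
  define A where "A = {q. sublinear q \<and> q \<le> p}"
  \<comment> \<open>Zorn's lemma speaks of maximal elements, so the order is reversed. The empty
    chain is bounded by \<open>p\<close> itself, since a real infimum over no functionals says
    nothing.\<close>
  have "\<exists>m\<in>A. \<forall>a\<in>A. a \<le> m \<longrightarrow> a = m"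
  proof (rule predicate_Zorn[of A "\<lambda>x y. y \<le> x"])
    show "partial_order_on A (relation_of (\<lambda>x y. y \<le> x) A)"
      by (rule partial_order_on_relation_ofI) auto
    fix C assume C: "C \<in> Chains (relation_of (\<lambda>x y. y \<le> x) A)"
    show "\<exists>u\<in>A. \<forall>a\<in>C. u \<le> a"
    proof (cases "C = {}")
      case True
      then show ?thesis using p by (auto simp: A_def)
    next
      case False
      have CA: "C \<subseteq> A" and ch: "\<And>q r. q \<in> C \<Longrightarrow> r \<in> C \<Longrightarrow> q \<le> r \<or> r \<le> q"
        using C by (auto simp: Chains_def relation_of_def)
      note inf = sublinear_chain_Inf[OF False, of p]
      have sub: "\<And>q. q \<in> C \<Longrightarrow> sublinear q \<and> q \<le> p" using CA by (auto simp: A_def)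
      have "(\<lambda>y. INF q\<in>C. q y) \<in> A"
      proof -
        obtain q where q: "q \<in> C" using False by auto
        have "(INF q\<in>C. q y) \<le> p y" for y
          using inf(2)[OF sub ch q, of y] sub[OF q] by (auto simp: le_fun_def intro: order_trans)
        then show ?thesis using inf(1)[OF sub ch] by (auto simp: A_def le_fun_def)
      qed
      moreover have "\<forall>a\<in>C. (\<lambda>y. INF q\<in>C. q y) \<le> a" using inf(2)[OF sub ch] by (simp add: le_fun_def)
      ultimately show ?thesis by blast
    qed
  qed
  then obtain m where m: "m \<in> A" "\<And>a. a \<in> A \<Longrightarrow> a \<le> m \<Longrightarrow> a = m" by auto
  show thesis
  proof (rule that[of m])
    show "r = m" if "sublinear r" "r \<le> m" for r
      using m that by (auto simp: A_def)
  qed (use m in \<open>auto simp: A_def\<close>)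
qed

text \<open>A minimal \<open>q\<close> equals all of its tilts, which forces \<open>q (- x) \<le> - q x\<close>.\<close>

lemma minimal_sublinear_linear:
  assumes q: "sublinear q" and min: "\<And>r. sublinear r \<Longrightarrow> r \<le> q \<Longrightarrow> r = q"
  shows "linear q"
proof -
  have neg: "q (- x) = - q x" for x
  proof (rule antisym)
    have "sublinear_tilt q x = q"
      by (intro min sublinear_tilt_sublinear q) (simp add: le_fun_def sublinear_tilt_le_self q)
    then show "q (- x) \<le> - q x" using sublinear_tilt_minus_le[OF q, of x] by simp
    show "- q x \<le> q (- x)" using sublinear_minus[OF q, of "-x"] by simp
  qed
  show ?thesis
  proof (rule linearI)
    fix x y
    show "q (x + y) = q x + q y"
    proof (rule antisym[OF sublinear_add[OF q]])
      have "q (- (x + y)) \<le> q (- x) + q (- y)"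
        using sublinear_add[OF q, of "-x" "-y"] by (simp only: minus_add_distrib)
      then have "- q (x + y) \<le> - q x + - q y" by (simp only: neg)
      then show "q x + q y \<le> q (x + y)" by simp
    qed
  next
    fix c :: real and x
    show "q (c *\<^sub>R x) = c *\<^sub>R q x"
    proof (cases "c \<ge> 0")
      case False
      have "q (c *\<^sub>R x) = q ((-c) *\<^sub>R (- x))" by simp
      also have "\<dots> = - c * q (- x)" by (rule sublinear_scaleR[OF q]) (use False in simp)
      finally show ?thesis by (simp add: neg)
    qed (simp add: sublinear_scaleR[OF q])
  qed
qed

text \<open>A minimal functional is sought below the tilt of \<open>p\<close> at \<open>x\<close>,
  not below \<open>p\<close>: minimality gives linearity, and the tilt bounds \<open>q (- x)\<close>
  by \<open>- p x\<close>, so that \<open>q\<close> touches \<open>p\<close> at \<open>x\<close>.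
  This takes the place of an extension from a subspace.\<close>

lemma hahn_banach_sublinear:
  assumes p: "sublinear p"
  obtains q where "linear q" "\<And>y. q y \<le> p y" "q x = p x"
proof -
  obtain q where q: "sublinear q" "q \<le> sublinear_tilt p x" "\<And>r. sublinear r \<Longrightarrow> r \<le> q \<Longrightarrow> r = q"
    using minimal_sublinear_exists[OF sublinear_tilt_sublinear[OF p, of x]] by metis
  have lin: "linear q" by (rule minimal_sublinear_linear[OF q(1,3)])
  have le: "q y \<le> p y" for y
    using q(2) sublinear_tilt_le_self[OF p, of x y] by (auto simp: le_fun_def intro: order_trans)
  have "q (- x) \<le> - p x"
    using q(2) sublinear_tilt_minus_le[OF p, of x] by (auto simp: le_fun_def intro: order_trans)
  then have "p x \<le> q x" using linear_neg[OF lin, of x] by simp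
  then show thesis using that[of q] lin le le[of x] by (simp add: antisym)
qed

section \<open>Minkowski functionals of convex absorbing sets\<close>

definition gauge_fun :: "'v::real_vector set \<Rightarrow> 'v \<Rightarrow> real" where
  "gauge_fun V x = Inf {r. 0 < r \<and> inverse r *\<^sub>R x \<in> V}"

context
  fixes V :: "'v::real_vector set"
  assumes convex_V: "convex V"
    and zero_V: "0 \<in> V"
    and absorbing_V: "\<forall>x. \<exists>r>0. inverse r *\<^sub>R x \<in> V"
begin

lemma gauge_fun_bdd: "bdd_below {r. 0 < r \<and> inverse r *\<^sub>R x \<in> V}"
  by (rule bdd_belowI[of _ 0]) auto

lemma gauge_fun_le: "0 < r \<Longrightarrow> inverse r *\<^sub>R x \<in> V \<Longrightarrow> gauge_fun V x \<le> r"
  unfolding gauge_fun_def by (rule cInf_lower[OF _ gauge_fun_bdd]) auto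

lemma gauge_fun_ge: "(\<And>r. 0 < r \<Longrightarrow> inverse r *\<^sub>R x \<in> V \<Longrightarrow> c \<le> r) \<Longrightarrow> c \<le> gauge_fun V x"
  unfolding gauge_fun_def by (rule cInf_greatest) (use absorbing_V in auto)

lemma gauge_fun_sublinear: "sublinear (gauge_fun V)"
  unfolding sublinear_def
proof (intro conjI allI impI)
  fix x y
  have "gauge_fun V (x + y) \<le> r + s"
    if r: "0 < r" "inverse r *\<^sub>R x \<in> V" and s: "0 < s" "inverse s *\<^sub>R y \<in> V" for r s
  proof (rule gauge_fun_le)
    have "(r / (r + s)) *\<^sub>R (inverse r *\<^sub>R x) + (s / (r + s)) *\<^sub>R (inverse s *\<^sub>R y) \<in> V"
      by (rule convexD[OF convex_V]) (use r s in \<open>auto simp: add_divide_distrib[symmetric]\<close>)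
    also have "(r / (r + s)) *\<^sub>R (inverse r *\<^sub>R x) + (s / (r + s)) *\<^sub>R (inverse s *\<^sub>R y) =
        inverse (r + s) *\<^sub>R (x + y)"
      using r s by (simp add: scaleR_add_right field_simps)
    finally show "inverse (r + s) *\<^sub>R (x + y) \<in> V" .
  qed (use r s in simp)
  then have "gauge_fun V (x + y) - s \<le> r"
    if "0 < s" "inverse s *\<^sub>R y \<in> V" "0 < r" "inverse r *\<^sub>R x \<in> V" for r s
    using that by (simp add: diff_le_eq)
  then have "gauge_fun V (x + y) - s \<le> gauge_fun V x" if "0 < s" "inverse s *\<^sub>R y \<in> V" for s
    using that by (intro gauge_fun_ge) blast
  then have "gauge_fun V (x + y) - gauge_fun V x \<le> s" if "0 < s" "inverse s *\<^sub>R y \<in> V" for s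
    using that by (simp add: diff_le_eq add.commute)
  then have "gauge_fun V (x + y) - gauge_fun V x \<le> gauge_fun V y"
    by (intro gauge_fun_ge) blast
  then show "gauge_fun V (x + y) \<le> gauge_fun V x + gauge_fun V y" by simp
next
  fix x and s :: real assume "0 \<le> s"
  have le: "gauge_fun V (s *\<^sub>R x) \<le> s * gauge_fun V x" if "0 < s" for s x
  proof -
    have "gauge_fun V (s *\<^sub>R x) / s \<le> gauge_fun V x"
    proof (rule gauge_fun_ge)
      fix r assume "0 < r" "inverse r *\<^sub>R x \<in> V"
      then have "gauge_fun V (s *\<^sub>R x) \<le> s * r"
        using \<open>0 < s\<close> by (intro gauge_fun_le) (auto simp: field_simps)
      then show "gauge_fun V (s *\<^sub>R x) / s \<le> r" using \<open>0 < s\<close> by (simp add: field_simps)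
    qed
    then show ?thesis using \<open>0 < s\<close> by (simp add: field_simps)
  qed
  show "gauge_fun V (s *\<^sub>R x) = s * gauge_fun V x"
  proof (cases "s = 0")
    case True
    have "gauge_fun V 0 \<le> 0 + d" if "0 < d" for d using gauge_fun_le[of d 0] that zero_V by simp
    then have "gauge_fun V 0 \<le> 0" using field_le_epsilon by blast
    moreover have "0 \<le> gauge_fun V 0" by (rule gauge_fun_ge) simp
    ultimately show ?thesis using True by simp
  next
    case False
    then have s: "0 < s" using \<open>0 \<le> s\<close> by simp
    have "s * gauge_fun V x = s * gauge_fun V (inverse s *\<^sub>R s *\<^sub>R x)" using s by simp
    also have "\<dots> \<le> s * (inverse s * gauge_fun V (s *\<^sub>R x))"
      using le[of "inverse s" "s *\<^sub>R x"] s by (intro mult_left_mono) auto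
    also have "\<dots> = gauge_fun V (s *\<^sub>R x)" using s by simp
    finally show ?thesis using le[OF s, of x] by simp
  qed
qed

lemma gauge_fun_le_1: "x \<in> V \<Longrightarrow> gauge_fun V x \<le> 1"
  by (rule gauge_fun_le) auto

lemma gauge_fun_ge_1:
  assumes "x \<notin> V"
  shows "1 \<le> gauge_fun V x"
proof (rule gauge_fun_ge, rule ccontr)
  fix r assume r: "0 < r" "inverse r *\<^sub>R x \<in> V" "\<not> 1 \<le> r"
  have "r *\<^sub>R (inverse r *\<^sub>R x) + (1 - r) *\<^sub>R 0 \<in> V"
    by (rule convexD[OF convex_V]) (use r zero_V in auto)
  then show False using r assms by simp
qed

end

text \<open>A convex neighbourhood \<open>V\<close> of 0 missing \<open>x\<close> has a gauge that
  is at least 1 at \<open>x\<close> and at most 1 on \<open>V\<close>. A linear functional below the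
  gauge that equals it at \<open>x\<close> is nonzero there, and being bounded above on a
  neighbourhood of 0 it is continuous.\<close>

lemma continuous_dual_separates_zero:
  fixes x :: "'w::separable_frechet_space"
  assumes "x \<noteq> 0"
  obtains \<phi> where "\<phi> \<in> continuous_dual" "\<phi> x \<noteq> 0"
proof -
  have "open (- {x})" "0 \<in> - {x}" using assms by auto
  from locally_convex[OF this] obtain V where V': "open V \<and> 0 \<in> V \<and> V \<subseteq> - {x} \<and>
      (\<forall>x\<in>V. \<forall>y\<in>V. \<forall>a b :: real. 0 \<le> a \<and> 0 \<le> b \<and> a + b = 1 \<longrightarrow> a *\<^sub>R x + b *\<^sub>R y \<in> V)"
    by (rule exE)
  have V: "open V" "0 \<in> V" "V \<subseteq> - {x}" and conv: "convex V"
    using V' unfolding convex_def by blast+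
  have absorb: "\<forall>y. \<exists>r>0. inverse r *\<^sub>R y \<in> V"
  proof
    fix y :: 'w
    have "((\<lambda>r. inverse r *\<^sub>R y) \<longlongrightarrow> 0 *\<^sub>R y) at_top"
      by (rule frechet_tendsto_scaleR[OF tendsto_inverse_0_at_top[OF filterlim_ident] tendsto_const])
    then have "\<forall>\<^sub>F r in at_top. inverse r *\<^sub>R y \<in> V"
      using V by (intro topological_tendstoD) auto
    then have "\<forall>\<^sub>F r in at_top. (0::real) < r \<and> inverse r *\<^sub>R y \<in> V"
      using eventually_gt_at_top[of 0] by eventually_elim auto
    then show "\<exists>r>0. inverse r *\<^sub>R y \<in> V"
      using eventually_happens[of _ "at_top :: real filter"] by auto
  qed
  note g = conv V(2) absorb
  obtain q where q: "linear q" "\<And>y. q y \<le> gauge_fun V y" "q x = gauge_fun V x"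
    using hahn_banach_sublinear[OF gauge_fun_sublinear[OF g], of x] by blast
  have bound: "q y \<le> 1" if "y \<in> V" for y
    using q(2)[of y] gauge_fun_le_1[OF g that] by simp
  have "continuous_on UNIV q"
    unfolding continuous_on_def
  proof (intro ballI tendstoI)
    fix y :: 'w and \<epsilon> :: real assume e: "0 < \<epsilon>"
    \<comment> \<open>\<open>V\<close> need not be symmetric, so both signs are scaled into it. The
      factor \<open>2 / \<epsilon>\<close> leaves the bound \<open>\<epsilon> / 2\<close>, which
      gives the strict inequality.\<close>
    have t: "((\<lambda>z. (2 / \<epsilon>) *\<^sub>R (z - y)) \<longlongrightarrow> (2 / \<epsilon>) *\<^sub>R (y - y)) (at y)"
            "((\<lambda>z. (2 / \<epsilon>) *\<^sub>R (y - z)) \<longlongrightarrow> (2 / \<epsilon>) *\<^sub>R (y - y)) (at y)"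
      by (intro frechet_tendsto_scaleR tendsto_const tendsto_diff tendsto_ident_at)+
    have "\<forall>\<^sub>F z in at y. (2 / \<epsilon>) *\<^sub>R (z - y) \<in> V" "\<forall>\<^sub>F z in at y. (2 / \<epsilon>) *\<^sub>R (y - z) \<in> V"
      using t V by (auto intro: topological_tendstoD)
    then show "\<forall>\<^sub>F z in at y. dist (q z) (q y) < \<epsilon>"
    proof eventually_elim
      case (elim z)
      from elim[THEN bound] have "(2 / \<epsilon>) * (q z - q y) \<le> 1" "(2 / \<epsilon>) * (q y - q z) \<le> 1"
        by (simp_all add: linear_scale[OF q(1)] linear_diff[OF q(1)])
      then show ?case using e by (auto simp: dist_real_def abs_real_def field_simps)
    qed
  qed
  then have "q \<in> continuous_dual" using q(1) by (simp add: continuous_dual_def)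
  moreover have "q x \<noteq> 0" using gauge_fun_ge_1[OF g, of x] V(3) q(3) by auto
  ultimately show thesis by (rule that)
qed

section \<open>Measures determined by their characteristic functional\<close>

text \<open>Closed sets form an intersection-stable generator, and the indicator of a nonempty
  closed set is the bounded limit of continuous functions of the distance to it. The empty set is
  treated apart because its \<open>infdist\<close> is 0.\<close>

lemma prob_measure_eqI_integral_continuous:
  fixes M N :: "'a::metric_space measure"
  assumes "prob_space M" "prob_space N" and sets: "sets M = sets borel" "sets N = sets borel"
    and eq: "\<And>f :: 'a \<Rightarrow> real. continuous_on UNIV f \<Longrightarrow> (\<And>x. 0 \<le> f x \<and> f x \<le> 1) \<Longrightarrow>
      (\<integral>x. f x \<partial>M) = (\<integral>x. f x \<partial>N)"
  shows "M = N"
proof -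
  interpret M: prob_space M by fact
  interpret N: prob_space N by fact
  have [measurable_cong]: "sets M = sets borel" "sets N = sets borel" by fact+
  have space: "space M = UNIV" "space N = UNIV" using sets[THEN sets_eq_imp_space_eq] by simp_all
  have closed: "emeasure M C = emeasure N C" if C: "closed C" for C
  proof (cases "C = {}")
    case False
    define f where "f n x = max 0 (1 - real n * infdist x C)" for n x
    have cont: "continuous_on UNIV (f n)" for n
      unfolding f_def by (intro continuous_intros)
    have f01: "0 \<le> f n x \<and> f n x \<le> 1" for n x
      by (auto simp: f_def infdist_nonneg)
    have [measurable]: "f n \<in> borel_measurable borel" for n
      using cont by (rule borel_measurable_continuous_onI)
    have [measurable]: "C \<in> sets borel" using C by simp
    have lim: "(\<lambda>n. f n x) \<longlonglongrightarrow> indicator C x" for x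
    proof (cases "x \<in> C")
      case True
      then show ?thesis by (simp add: f_def)
    next
      case notin: False
      then have d: "0 < infdist x C"
        using in_closed_iff_infdist_zero[OF C False, of x] infdist_nonneg[of x C] by linarith
      obtain m where "1 / infdist x C < real m" using reals_Archimedean2 by blast
      then have m: "1 < real m * infdist x C" using d by (simp add: field_simps)
      have "f n x = 0" if "m \<le> n" for n
      proof -
        have "real m * infdist x C \<le> real n * infdist x C" using that d by (intro mult_right_mono) auto
        then show ?thesis using m by (simp add: f_def)
      qed
      then have "\<forall>\<^sub>F n in sequentially. f n x = 0" by (auto simp: eventually_sequentially)
      then show ?thesis using notin by (simp add: tendsto_eventually)
    qed
    have "(\<lambda>n. \<integral>x. f n x \<partial>M) \<longlonglongrightarrow> (\<integral>x. indicator C x \<partial>M)"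
      by (rule integral_dominated_convergence[where w="\<lambda>_. 1"]) (use lim f01 in simp_all)
    moreover have "(\<lambda>n. \<integral>x. f n x \<partial>N) \<longlonglongrightarrow> (\<integral>x. indicator C x \<partial>N)"
      by (rule integral_dominated_convergence[where w="\<lambda>_. 1"]) (use lim f01 in simp_all)
    moreover have "(\<integral>x. f n x \<partial>M) = (\<integral>x. f n x \<partial>N)" for n
      by (rule eq) (use cont f01 in auto)
    ultimately have "(\<integral>x. indicator C x \<partial>M) = (\<integral>x. indicator C x \<partial>N :: real)"
      by (auto intro: LIMSEQ_unique)
    then show ?thesis by (simp add: M.emeasure_eq_measure N.emeasure_eq_measure space)
  qed simp
  show ?thesis
  proof (rule measure_eqI_generator_eq[of "Collect closed" UNIV M N "\<lambda>_. UNIV"])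
    show "Int_stable (Collect closed)" by (auto simp: Int_stable_def)
    show "sets M = sigma_sets UNIV (Collect closed)" "sets N = sigma_sets UNIV (Collect closed)"
      unfolding sets by (simp_all add: borel_eq_closed)
  qed (use closed in auto)
qed

lemma real_polynomial_function_compose_closed:
  fixes A :: "('a \<Rightarrow> real) set" and p :: "real \<Rightarrow> real"
  assumes "real_polynomial_function p" "g \<in> A" and const: "\<And>c. (\<lambda>_. c) \<in> A"
    and add: "\<And>f g. f \<in> A \<Longrightarrow> g \<in> A \<Longrightarrow> (\<lambda>x. f x + g x) \<in> A"
    and mult: "\<And>f g. f \<in> A \<Longrightarrow> g \<in> A \<Longrightarrow> (\<lambda>x. f x * g x) \<in> A"
  shows "(\<lambda>x. p (g x)) \<in> A"
  using assms(1)
proof induction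
  case (linear f)
  then have "f (g x) = f 1 * g x" for x
    using linear_scale[OF bounded_linear.linear[OF linear], of "g x" 1] by (simp add: mult.commute)
  then show ?case using mult[OF const[of "f 1"] \<open>g \<in> A\<close>] by simp
qed (use const add mult in auto)

text \<open>Stone-Weierstrass on a compact set carrying almost all the mass; a polynomial approximation
  of the truncation to \<open>[0, 1]\<close> keeps the approximant bounded off that compact set.\<close>

lemma prob_measure_eqI_algebra:
  fixes M N :: "'a::polish_space measure" and A :: "('a \<Rightarrow> real) set"
  assumes M: "prob_space M" and N: "prob_space N" and sets: "sets M = sets borel" "sets N = sets borel"
    and cont: "\<And>f. f \<in> A \<Longrightarrow> continuous_on UNIV f"
    and bdd: "\<And>f. f \<in> A \<Longrightarrow> \<exists>B. \<forall>x. \<bar>f x\<bar> \<le> B"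
    and const: "\<And>c. (\<lambda>_. c) \<in> A"
    and add: "\<And>f g. f \<in> A \<Longrightarrow> g \<in> A \<Longrightarrow> (\<lambda>x. f x + g x) \<in> A"
    and mult: "\<And>f g. f \<in> A \<Longrightarrow> g \<in> A \<Longrightarrow> (\<lambda>x. f x * g x) \<in> A"
    and sep: "\<And>x y. x \<noteq> y \<Longrightarrow> \<exists>f\<in>A. f x \<noteq> f y"
    and eq: "\<And>f. f \<in> A \<Longrightarrow> (\<integral>x. f x \<partial>M) = (\<integral>x. f x \<partial>N)"
  shows "M = N"
proof (rule prob_measure_eqI_integral_continuous[OF M N sets])
  fix f :: "'a \<Rightarrow> real" assume f: "continuous_on UNIV f" and f01: "\<And>x. 0 \<le> f x \<and> f x \<le> 1"
  have approx: "\<exists>q\<in>A. \<exists>K. compact K \<and> measure M (- K) \<le> \<epsilon> \<and> measure N (- K) \<le> \<epsilon> \<and>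
      (\<forall>x\<in>K. \<bar>f x - q x\<bar> \<le> 2 * \<epsilon>) \<and> (\<forall>x. \<bar>f x - q x\<bar> \<le> 2)"
    if e: "0 < \<epsilon>" "\<epsilon> < 1" for \<epsilon>
  proof -
    have tight: "\<exists>K. compact K \<and> measure L (- K) \<le> \<epsilon>" if L: "prob_space L" "sets L = sets borel" for L :: "'a measure"
    proof -
      interpret L: prob_space L by fact
      have sp: "space L = UNIV" using sets_eq_imp_space_eq[OF L(2)] by simp
      have "1 = (SUP K\<in>{K. K \<subseteq> UNIV \<and> compact K}. emeasure L K)"
        using inner_regular[OF L(2), of UNIV] L.emeasure_space_1 sp by simp
      moreover have "ennreal (1 - \<epsilon>) < 1" using e by (simp add: ennreal_less_one_iff)
      ultimately have "ennreal (1 - \<epsilon>) < (SUP K\<in>{K. K \<subseteq> UNIV \<and> compact K}. emeasure L K)"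
        by simp
      then obtain K where K: "compact K" "ennreal (1 - \<epsilon>) < emeasure L K"
        unfolding less_SUP_iff by auto
      have Ks: "K \<in> sets L" using K(1) L(2) by (simp add: borel_compact)
      have "1 - \<epsilon> < measure L K" using K(2) e by (simp add: L.emeasure_eq_measure ennreal_less_iff)
      moreover have "measure L (- K) = 1 - measure L K"
        using L.prob_compl[OF Ks] sp by (simp add: Compl_eq_Diff_UNIV)
      ultimately show ?thesis using K(1) by (intro exI[of _ K]) simp
    qed
    obtain K1 where K1: "compact K1" "measure M (- K1) \<le> \<epsilon>" using tight[OF M sets(1)] by blast
    obtain K2 where K2: "compact K2" "measure N (- K2) \<le> \<epsilon>" using tight[OF N sets(2)] by blast
    note K = K1 K2
    define K where "K = K1 \<union> K2"
    have cK: "compact K" using K by (auto simp: K_def)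
    have mono: "measure L (- K) \<le> measure L (- K')"
      if L: "prob_space L" "sets L = sets borel" and K': "compact K'" "K' \<subseteq> K" for L :: "'a measure" and K'
    proof -
      interpret L: prob_space L by fact
      have "- K' \<in> sets L" using borel_compact[OF K'(1)] L(2) by auto
      then show ?thesis using K'(2) by (intro L.finite_measure_mono) auto
    qed
    have mM: "measure M (- K) \<le> \<epsilon>"
      using mono[OF M sets(1) K1(1)] K1(2) by (simp add: K_def)
    have mN: "measure N (- K) \<le> \<epsilon>"
      using mono[OF N sets(2) K2(1)] K2(2) by (simp add: K_def)
    obtain g where g: "g \<in> A" "\<And>x. x \<in> K \<Longrightarrow> \<bar>f x - g x\<bar> < \<epsilon>"
    proof -
      interpret function_ring_on A K
      proof
        show "continuous_on K f" if "f \<in> A" for f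
          using continuous_on_subset[OF cont[OF that]] by simp
        show "\<exists>f\<in>A. f x \<noteq> f y" if "x \<noteq> y" for x y
          by (rule sep[OF that])
      qed (fact cK add mult const)+
      have "continuous_on K f" using continuous_on_subset[OF f] by simp
      from Stone_Weierstrass_basic[OF this e(1)] that show thesis by blast
    qed
    obtain B where B: "\<And>x. \<bar>g x\<bar> \<le> B" using bdd[OF g(1)] by auto
    define clamp :: "real \<Rightarrow> real" where "clamp s = max 0 (min 1 s)" for s
    have "continuous_on {- B..B} clamp" unfolding clamp_def by (intro continuous_intros)
    then obtain p where p: "real_polynomial_function p" "\<And>s. s \<in> {- B..B} \<Longrightarrow> \<bar>clamp s - p s\<bar> < \<epsilon>"
      using Stone_Weierstrass_real_polynomial_function[of "{-B..B}" clamp \<epsilon>] e by blast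
    have q: "(\<lambda>x. p (g x)) \<in> A"
      by (intro real_polynomial_function_compose_closed[OF p(1) g(1)] const add mult)
    have pg: "\<bar>clamp (g x) - p (g x)\<bar> < \<epsilon>" for x
      using B[of x] by (intro p(2)) auto
    have cl: "0 \<le> clamp s" "clamp s \<le> 1" for s by (simp_all add: clamp_def)
    \<comment> \<open>Values of \<open>f\<close> lie in [0, 1], so clamping does not increase the
      distance to them and closeness on \<open>K\<close> survives.\<close>
    have contr: "\<bar>r - clamp s\<bar> \<le> \<bar>r - s\<bar>" if "0 \<le> r" "r \<le> 1" for r s
      using that by (simp add: clamp_def max_def min_def abs_if)
    have on_K: "\<bar>f x - p (g x)\<bar> \<le> 2 * \<epsilon>" if "x \<in> K" for x
    proof -
      have "\<bar>f x - clamp (g x)\<bar> < \<epsilon>"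
        using g(2)[OF that] contr[of "f x" "g x"] f01[of x] by linarith
      then show ?thesis using pg[of x] by linarith
    qed
    have off_K: "\<bar>f x - p (g x)\<bar> \<le> 2" for x
      using pg[of x] f01[of x] cl[of "g x"] e by linarith
    show ?thesis
      by (rule bexI[OF exI[of _ K] q]) (use cK mM mN on_K off_K in simp)
  qed
  have close: "\<bar>(\<integral>x. f x \<partial>L) - (\<integral>x. q x \<partial>L)\<bar> \<le> 4 * \<epsilon>"
    if L: "prob_space L" "sets L = sets borel" and q: "q \<in> A" and K: "compact K" "measure L (- K) \<le> \<epsilon>"
      and le: "\<forall>x\<in>K. \<bar>f x - q x\<bar> \<le> 2 * \<epsilon>" "\<forall>x. \<bar>f x - q x\<bar> \<le> 2" and "0 < \<epsilon>"
    for L q K \<epsilon>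
  proof -
    interpret L: prob_space L by fact
    have [measurable_cong]: "sets L = sets borel" by fact
    have [measurable]: "f \<in> borel_measurable borel" "q \<in> borel_measurable borel"
      using f cont[OF q] by (auto intro: borel_measurable_continuous_onI)
    have [measurable]: "K \<in> sets borel" using K(1) by (simp add: borel_compact)
    obtain B where "\<And>x. \<bar>q x\<bar> \<le> B" using bdd[OF q] by auto
    then have iq: "integrable L q" by (intro L.integrable_const_bound[of _ B]) auto
    have if': "integrable L f" by (intro L.integrable_const_bound[of _ 1]) (use f01 in auto)
    have "\<bar>(\<integral>x. f x \<partial>L) - (\<integral>x. q x \<partial>L)\<bar> = \<bar>\<integral>x. f x - q x \<partial>L\<bar>"
      using if' iq by simp
    also have "\<dots> \<le> (\<integral>x. \<bar>f x - q x\<bar> \<partial>L)" by (rule integral_abs_bound)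
    also have "\<dots> \<le> (\<integral>x. 2 * \<epsilon> + 2 * indicator (- K) x \<partial>L)"
    proof (rule integral_mono)
      show "\<bar>f x - q x\<bar> \<le> 2 * \<epsilon> + 2 * indicator (- K) x" for x
        using le \<open>0 < \<epsilon>\<close> by (cases "x \<in> K") (auto intro: order_trans[of _ 2])
      show "integrable L (\<lambda>x. 2 * \<epsilon> + 2 * indicator (- K) x)"
        by (intro Bochner_Integration.integrable_add integrable_mult_right L.integrable_const
             L.integrable_const_bound[of _ 1]) (auto simp: indicator_def)
    qed (use if' iq in auto)
    also have "\<dots> = 2 * \<epsilon> + 2 * measure L (- K)"
    proof -
      have "integrable L (indicator (- K) :: _ \<Rightarrow> real)"
        by (intro L.integrable_const_bound[of _ 1]) (auto simp: indicator_def)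
      moreover have "space L = UNIV" using sets_eq_imp_space_eq[OF L(2)] by simp
      ultimately show ?thesis using L.prob_space by simp
    qed
    also have "\<dots> \<le> 4 * \<epsilon>" using K(2) by simp
    finally show ?thesis .
  qed
  have "\<bar>(\<integral>x. f x \<partial>M) - (\<integral>x. f x \<partial>N)\<bar> \<le> 8 * \<epsilon>" if e: "0 < \<epsilon>" "\<epsilon> < 1" for \<epsilon>
  proof -
    obtain q K where q: "q \<in> A" "compact K" "measure M (- K) \<le> \<epsilon>" "measure N (- K) \<le> \<epsilon>"
      "\<forall>x\<in>K. \<bar>f x - q x\<bar> \<le> 2 * \<epsilon>" "\<forall>x. \<bar>f x - q x\<bar> \<le> 2"
      using approx[OF e] by blast
    show ?thesis
      using close[OF M sets(1) q(1,2,3,5,6) e(1)] close[OF N sets(2) q(1,2,4,5,6) e(1)] eq[OF q(1)]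
      by linarith
  qed
  then have small: "\<bar>(\<integral>x. f x \<partial>M) - (\<integral>x. f x \<partial>N)\<bar> \<le> 0 + d" if "0 < d" for d
  proof -
    \<comment> \<open>Each of the two comparisons costs \<open>4 * \<epsilon>\<close>. The minimum
      with 1/2 keeps \<open>\<epsilon>\<close> below 1, as \<open>approx\<close> demands.\<close>
    have "\<bar>(\<integral>x. f x \<partial>M) - (\<integral>x. f x \<partial>N)\<bar> \<le> 8 * min (d / 8) (1 / 2)"
      by (rule \<open>\<And>\<epsilon>. 0 < \<epsilon> \<Longrightarrow> \<epsilon> < 1 \<Longrightarrow> \<bar>(\<integral>x. f x \<partial>M) - (\<integral>x. f x \<partial>N)\<bar> \<le> 8 * \<epsilon>\<close>)
         (use that in auto)
    then show ?thesis by auto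
  qed
  show "(\<integral>x. f x \<partial>M) = (\<integral>x. f x \<partial>N)"
    using field_le_epsilon[OF small] by simp
qed

section \<open>Trigonometric polynomials of continuous functionals\<close>

text \<open>Only linear combinations are generated, so that an induction reduces equality of
  integrals to \<open>cos\<close> and \<open>sin\<close> alone. Stability under products, which
  Stone-Weierstrass needs, is a consequence of the product formulas.\<close>

inductive_set trig_functionals :: "('w::separable_frechet_space \<Rightarrow> real) set" where
  cos: "\<phi> \<in> continuous_dual \<Longrightarrow> (\<lambda>w. cos (\<phi> w)) \<in> trig_functionals"
| sin: "\<phi> \<in> continuous_dual \<Longrightarrow> (\<lambda>w. sin (\<phi> w)) \<in> trig_functionals"
| add: "f \<in> trig_functionals \<Longrightarrow> g \<in> trig_functionals \<Longrightarrow> (\<lambda>w. f w + g w) \<in> trig_functionals"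
| scale: "f \<in> trig_functionals \<Longrightarrow> (\<lambda>w. c * f w) \<in> trig_functionals"

lemma trig_functionals_mult_aux:
  assumes "g \<in> trig_functionals" "\<phi> \<in> continuous_dual"
  shows "(\<lambda>w. cos (\<phi> w) * g w) \<in> trig_functionals \<and> (\<lambda>w. sin (\<phi> w) * g w) \<in> trig_functionals"
  using assms
proof induction
  case (cos \<psi>)
  note s = continuous_dual_diff[OF cos(2,1)] continuous_dual_add[OF cos(2,1)]
  note c = trig_functionals.cos[OF s(1)] trig_functionals.cos[OF s(2)]
    and d = trig_functionals.sin[OF s(1)] trig_functionals.sin[OF s(2)]
  show ?case
    using trig_functionals.scale[OF trig_functionals.add[OF c], of "1/2"]
      trig_functionals.scale[OF trig_functionals.add[OF d(2,1)], of "1/2"]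
    by (simp add: cos_times_cos sin_times_cos)
next
  case (sin \<psi>)
  note s = continuous_dual_diff[OF sin(2,1)] continuous_dual_add[OF sin(2,1)]
  note c = trig_functionals.cos[OF s(1)] trig_functionals.cos[OF s(2)]
    and d = trig_functionals.sin[OF s(1)] trig_functionals.sin[OF s(2)]
  show ?case
    using trig_functionals.scale[OF trig_functionals.add[OF c(1) trig_functionals.scale[OF c(2), of "-1"]], of "1/2"]
      trig_functionals.scale[OF trig_functionals.add[OF d(2) trig_functionals.scale[OF d(1), of "-1"]], of "1/2"]
    by (simp add: cos_times_sin sin_times_sin)
next
  case (add f g)
  then show ?case by (auto simp: distrib_left intro: trig_functionals.add)
next
  case (scale f c)
  then have "(\<lambda>w. c * (cos (\<phi> w) * f w)) \<in> trig_functionals"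
            "(\<lambda>w. c * (sin (\<phi> w) * f w)) \<in> trig_functionals"
    by (auto intro: trig_functionals.scale)
  then show ?case by (simp add: mult.left_commute)
qed

lemma trig_functionals_mult:
  assumes "f \<in> trig_functionals" "g \<in> trig_functionals"
  shows "(\<lambda>w. f w * g w) \<in> trig_functionals"
  using assms
proof induction
  case (scale f c)
  then have "(\<lambda>w. c * (f w * g w)) \<in> trig_functionals" by (auto intro: trig_functionals.scale)
  then show ?case by (simp add: mult.assoc)
qed (auto simp: distrib_right trig_functionals_mult_aux intro: trig_functionals.add)

lemma trig_functionals_const: "(\<lambda>_. c) \<in> trig_functionals"
  using trig_functionals.scale[OF trig_functionals.cos[OF continuous_dual_zero], of c] by simp

lemma trig_functionals_continuous: "f \<in> trig_functionals \<Longrightarrow> continuous_on UNIV f"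
  by (induction rule: trig_functionals.induct)
     (auto intro!: continuous_on_cos continuous_on_sin continuous_on_add continuous_on_mult_left
       intro: continuous_dual_continuous)

lemma trig_functionals_bounded: "f \<in> trig_functionals \<Longrightarrow> \<exists>B. \<forall>w. \<bar>f w\<bar> \<le> B"
proof (induction rule: trig_functionals.induct)
  case (add f g)
  then obtain B C where "\<forall>w. \<bar>f w\<bar> \<le> B" "\<forall>w. \<bar>g w\<bar> \<le> C" by auto
  then have "\<bar>f w + g w\<bar> \<le> B + C" for w by (meson abs_triangle_ineq add_mono order_trans)
  then show ?case by blast
next
  case (scale f c)
  then obtain B where "\<forall>w. \<bar>f w\<bar> \<le> B" by auto
  then have "\<bar>c * f w\<bar> \<le> \<bar>c\<bar> * B" for w by (simp add: abs_mult mult_left_mono)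
  then show ?case by blast
qed (auto intro!: exI[of _ 1])

text \<open>If \<open>\<phi> (x - y) \<noteq> 0\<close>, the functional \<open>\<phi>\<close> scaled to take the value \<open>\<pi>\<close> at \<open>x - y\<close> has
  \<open>cos\<close> or \<open>sin\<close> values of opposite signs at \<open>x\<close> and \<open>y\<close>.\<close>

lemma trig_functionals_separate:
  assumes "x \<noteq> y"
  shows "\<exists>f\<in>trig_functionals. f x \<noteq> f y"
proof -
  obtain \<phi> where \<phi>: "\<phi> \<in> continuous_dual" "\<phi> (x - y) \<noteq> 0"
    using continuous_dual_separates_zero[of "x - y"] assms by auto
  define \<psi> where "\<psi> = (\<lambda>w. pi / \<phi> (x - y) * \<phi> w)"
  have d: "\<psi> \<in> continuous_dual" unfolding \<psi>_def by (rule continuous_dual_scale[OF \<phi>(1)])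
  have "\<psi> x = \<psi> y + pi"
    using \<phi>(2) linear_diff[OF continuous_dual_linear[OF \<phi>(1)], of x y]
    unfolding \<psi>_def by (simp add: field_simps flip: distrib_left)
  then have *: "cos (\<psi> x) = - cos (\<psi> y)" "sin (\<psi> x) = - sin (\<psi> y)" by simp_all
  have "cos (\<psi> y) \<noteq> 0 \<or> sin (\<psi> y) \<noteq> 0"
    using sin_cos_squared_add[of "\<psi> y"] by (metis power_zero_numeral add_0 zero_neq_one)
  then show "\<exists>f\<in>trig_functionals. f x \<noteq> f y"
  proof
    assume "cos (\<psi> y) \<noteq> 0"
    then show ?thesis using * by (intro bexI[OF _ trig_functionals.cos[OF d]]) simp
  next
    assume "sin (\<psi> y) \<noteq> 0"
    then show ?thesis using * by (intro bexI[OF _ trig_functionals.sin[OF d]]) simp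
  qed
qed

text \<open>The integrals of \<open>cos\<close> and \<open>sin\<close> are the real and imaginary
  parts of the characteristic functional; their equality passes to the whole algebra by
  linearity.\<close>

proposition prob_measure_eqI_charfun:
  fixes M N :: "'w::separable_frechet_space measure"
  assumes M: "prob_space M" "sets M = sets borel" and N: "prob_space N" "sets N = sets borel"
    and cos: "\<And>\<phi>. \<phi> \<in> continuous_dual \<Longrightarrow> (\<integral>w. cos (\<phi> w) \<partial>M) = (\<integral>w. cos (\<phi> w) \<partial>N)"
    and sin: "\<And>\<phi>. \<phi> \<in> continuous_dual \<Longrightarrow> (\<integral>w. sin (\<phi> w) \<partial>M) = (\<integral>w. sin (\<phi> w) \<partial>N)"
  shows "M = N"
proof (rule prob_measure_eqI_algebra[of M N trig_functionals])
  interpret M: prob_space M by fact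
  interpret N: prob_space N by fact
  fix f :: "'w \<Rightarrow> real" assume "f \<in> trig_functionals"
  moreover have int: "integrable M f" "integrable N f" if "f \<in> trig_functionals" for f
  proof -
    have f: "f \<in> borel_measurable borel"
      using trig_functionals_continuous[OF that] by (rule borel_measurable_continuous_onI)
    obtain B where "\<And>w. \<bar>f w\<bar> \<le> B" using trig_functionals_bounded[OF \<open>f \<in> trig_functionals\<close>] by auto
    then show "integrable M f" "integrable N f"
      using f by (auto intro!: M.integrable_const_bound[of _ B] N.integrable_const_bound[of _ B]
        simp: measurable_cong_sets[OF M(2) refl] measurable_cong_sets[OF N(2) refl])
  qed
  ultimately show "(\<integral>x. f x \<partial>M) = (\<integral>x. f x \<partial>N)"
    by induction (use cos sin int in auto)
qed (use assms trig_functionals_continuous trig_functionals_bounded trig_functionals_const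
      trig_functionals.add trig_functionals_mult trig_functionals_separate in auto)

section \<open>Gaussian measures\<close>

abbreviation std_normal :: "real measure" where
  "std_normal \<equiv> density lborel (\<lambda>x. ennreal (std_normal_density x))"

lemma prob_space_std_normal: "prob_space std_normal"
  by (rule prob_space_normal_density) simp

lemma std_normal_cos: "(\<integral>x. cos (t * x) \<partial>std_normal) = exp (- t\<^sup>2 / 2)"
  and std_normal_sin: "(\<integral>x. sin (t * x) \<partial>std_normal) = 0"
proof -
  interpret prob_space std_normal by (rule prob_space_std_normal)
  have int: "integrable std_normal (\<lambda>x. iexp (t * x))"
    by (rule integrable_const_bound[of _ 1]) auto
  have eq: "(CLINT x|std_normal. iexp (t * x)) = complex_of_real (exp (- t\<^sup>2 / 2))"
    using fun_cong[OF char_std_normal_distribution, of t] by (simp add: char_def)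
  note cis = int[folded cis_conv_exp] eq[folded cis_conv_exp]
  show "(\<integral>x. cos (t * x) \<partial>std_normal) = exp (- t\<^sup>2 / 2)"
    using integral_Re[OF cis(1)] cis(2) by simp
  show "(\<integral>x. sin (t * x) \<partial>std_normal) = 0"
    using integral_Im[OF cis(1)] cis(2) by simp
qed

text \<open>The weight is the ratio of \<open>\<bar>b\<bar> * std_normal_density (b * x)\<close> to
  \<open>std_normal_density x\<close>, so this is the substitution of \<open>b * x\<close> in a
  Lebesgue integral.\<close>

lemma nn_integral_std_normal_scale:
  assumes G: "G \<in> borel_measurable borel" and b: "b \<noteq> 0"
  shows "(\<integral>\<^sup>+x. G (b * x) * ennreal (\<bar>b\<bar> * exp (- (b\<^sup>2 - 1) * x\<^sup>2 / 2)) \<partial>std_normal) = (\<integral>\<^sup>+x. G x \<partial>std_normal)"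
proof -
  note [measurable] = G
  have eq: "std_normal_density x * (\<bar>b\<bar> * exp (- (b\<^sup>2 - 1) * x\<^sup>2 / 2)) = \<bar>b\<bar> * std_normal_density (b * x)" for x
    by (simp add: std_normal_density_def power_mult_distrib left_diff_distrib diff_divide_distrib
        flip: exp_add)
  have "(\<integral>\<^sup>+x. G (b * x) * ennreal (\<bar>b\<bar> * exp (- (b\<^sup>2 - 1) * x\<^sup>2 / 2)) \<partial>std_normal) =
      (\<integral>\<^sup>+x. ennreal (std_normal_density x) * (G (b * x) * ennreal (\<bar>b\<bar> * exp (- (b\<^sup>2 - 1) * x\<^sup>2 / 2))) \<partial>lborel)"
    by (rule nn_integral_density) auto
  also have "\<dots> = (\<integral>\<^sup>+x. ennreal \<bar>b\<bar> * (ennreal (std_normal_density (b * x)) * G (b * x)) \<partial>lborel)"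
  proof (rule nn_integral_cong)
    fix x
    have "ennreal (std_normal_density x) * (G (b * x) * ennreal (\<bar>b\<bar> * exp (- (b\<^sup>2 - 1) * x\<^sup>2 / 2))) =
        ennreal (std_normal_density x * (\<bar>b\<bar> * exp (- (b\<^sup>2 - 1) * x\<^sup>2 / 2))) * G (b * x)"
      by (simp add: ennreal_mult mult_ac del: ennreal_mult')
    also have "\<dots> = ennreal \<bar>b\<bar> * (ennreal (std_normal_density (b * x)) * G (b * x))"
      unfolding eq by (simp add: ennreal_mult mult_ac)
    finally show "ennreal (std_normal_density x) * (G (b * x) * ennreal (\<bar>b\<bar> * exp (- (b\<^sup>2 - 1) * x\<^sup>2 / 2))) =
        ennreal \<bar>b\<bar> * (ennreal (std_normal_density (b * x)) * G (b * x))" .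
  qed
  also have "\<dots> = ennreal \<bar>b\<bar> * (\<integral>\<^sup>+x. ennreal (std_normal_density (0 + b * x)) * G (0 + b * x) \<partial>lborel)"
    by (simp add: nn_integral_cmult)
  also have "\<dots> = (\<integral>\<^sup>+x. ennreal (std_normal_density x) * G x \<partial>lborel)"
    by (rule nn_integral_real_affine[symmetric]) (use b in auto)
  also have "\<dots> = (\<integral>\<^sup>+x. G x \<partial>std_normal)"
    by (rule nn_integral_density[symmetric]) auto
  finally show ?thesis .
qed

section \<open>Continuous functionals as centred Gaussian variables\<close>

locale wiener =
  fixes \<mu> :: "'w::separable_frechet_space measure"
    and \<iota> :: "'h::{real_inner, complete_space} \<Rightarrow> 'w"
  assumes aws: "abstract_wiener_space \<mu> \<iota>"
begin

lemma gaussian: "gaussian_measure \<mu>"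
  using aws by (simp add: abstract_wiener_space_def)

lemma prob_space_\<mu>: "prob_space \<mu>"
  using gaussian by (simp add: gaussian_measure_def)

sublocale prob_space \<mu> by (rule prob_space_\<mu>)

lemma sets_\<mu> [measurable_cong]: "sets \<mu> = sets borel"
  using gaussian by (simp add: gaussian_measure_def)

lemma space_\<mu> [simp]: "space \<mu> = UNIV"
  using sets_eq_imp_space_eq[OF sets_\<mu>] by simp

lemma measurable_\<mu>: "f \<in> borel_measurable \<mu> \<longleftrightarrow> f \<in> borel_measurable borel"
  by (simp add: measurable_cong_sets[OF sets_\<mu> refl])

lemma measurable_dual: "\<phi> \<in> continuous_dual \<Longrightarrow> \<phi> \<in> borel_measurable \<mu>"
  by (simp add: measurable_\<mu> continuous_dual_measurable)

lemma linear_\<iota>: "linear \<iota>" and continuous_\<iota>: "continuous_on UNIV \<iota>"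
  and dense_\<iota>: "closure (range \<iota>) = UNIV"
  using aws by (simp_all add: abstract_wiener_space_def)

lemma dual_unique:
  assumes "\<phi> \<in> continuous_dual" "\<psi> \<in> continuous_dual" "\<And>h. \<phi> (\<iota> h) = \<psi> (\<iota> h)"
  shows "\<phi> = \<psi>"
proof -
  have "closed {w. \<phi> w = \<psi> w}"
    using assms(1,2) by (intro closed_Collect_eq continuous_dual_continuous)
  then have "closure (range \<iota>) \<subseteq> {w. \<phi> w = \<psi> w}"
    by (intro closure_minimal) (use assms(3) in auto)
  then show ?thesis using dense_\<iota> by auto
qed

text \<open>The definition of an abstract Wiener space supplies some vector with both properties.
  Testing the two representations at \<open>k' - k\<close> shows that it is the given one.\<close>

lemma dual_second_moment:
  assumes "\<phi> \<in> continuous_dual" "\<And>h. \<phi> (\<iota> h) = inner k h"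
  shows "(\<integral>w. (\<phi> w)\<^sup>2 \<partial>\<mu>) = (norm k)\<^sup>2"
proof -
  obtain k' where k': "\<And>h. \<phi> (\<iota> h) = inner k' h" "(\<integral>w. (\<phi> w)\<^sup>2 \<partial>\<mu>) = (norm k')\<^sup>2"
    using aws assms(1) unfolding abstract_wiener_space_def by blast
  have "inner (k' - k) (k' - k) = 0"
    using k'(1)[of "k' - k"] assms(2)[of "k' - k"] by (simp add: inner_diff_left)
  then show ?thesis using k'(2) by simp
qed

lemma dual_vector:
  assumes "\<phi> \<in> continuous_dual"
  obtains k where "\<And>h. \<phi> (\<iota> h) = inner k h"
  using aws assms unfolding abstract_wiener_space_def by blast

text \<open>The second moment identifies the unknown standard deviation with \<open>norm k\<close>.
  Writing the law as an image of the standard normal law covers the degenerate case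
  \<open>norm k = 0\<close> as well.\<close>

lemma dual_distributed:
  assumes \<phi>: "\<phi> \<in> continuous_dual" and k: "\<And>h. \<phi> (\<iota> h) = inner k h"
  shows "distr \<mu> borel \<phi> = distr std_normal borel (\<lambda>x. norm k * x)"
proof -
  note [measurable] = measurable_dual[OF \<phi>]
  note m2 = dual_second_moment[OF \<phi> k]
  consider "AE w in \<mu>. \<phi> w = 0" | \<sigma> where "\<sigma> > 0" "distributed \<mu> lborel \<phi> (normal_density 0 \<sigma>)"
    using gaussian \<phi> unfolding gaussian_measure_def by blast
  then show ?thesis
  proof cases
    case 1
    then have "AE w in \<mu>. (\<phi> w)\<^sup>2 = 0" by eventually_elim simp
    then have "(\<integral>w. (\<phi> w)\<^sup>2 \<partial>\<mu>) = 0" by (simp add: integral_eq_zero_AE)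
    then have "norm k = 0" using m2 by simp
    moreover have "distr \<mu> borel \<phi> = distr \<mu> borel (\<lambda>_. 0)"
      by (rule distr_cong_AE) (use 1 in auto)
    moreover have "distr \<mu> borel (\<lambda>_. 0::real) = distr std_normal borel (\<lambda>_. 0)"
      using prob_space_std_normal prob_space_\<mu>
      by (intro measure_eqI) (auto simp: emeasure_distr prob_space.emeasure_space_1 vimage_def
          prob_space.emeasure_space_1[OF prob_space_std_normal, simplified] emeasure_space_1[simplified])
    ultimately show ?thesis by simp
  next
    case 2
    have "variance \<phi> = \<sigma>\<^sup>2" "expectation \<phi> = 0"
      using normal_distributed_variance[OF 2] normal_distributed_expectation[OF 2] by auto
    then have "\<sigma>\<^sup>2 = (norm k)\<^sup>2" using m2 by simp
    then have \<sigma>: "\<sigma> = norm k" using 2(1) by simp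
    have "distributed \<mu> lborel (\<lambda>x. (\<phi> x - 0) / \<sigma>) std_normal_density"
      using normal_standard_normal_convert[OF 2(1), of \<phi> 0] 2(2) by simp
    then have "distr \<mu> lborel (\<lambda>x. \<phi> x / \<sigma>) = std_normal"
      by (simp add: distributed_distr_eq_density)
    then have "distr std_normal borel (\<lambda>x. norm k * x) =
        distr (distr \<mu> lborel (\<lambda>x. \<phi> x / \<sigma>)) borel (\<lambda>x. norm k * x)"
      by simp
    also have "\<dots> = distr \<mu> borel ((\<lambda>x. norm k * x) \<circ> (\<lambda>x. \<phi> x / \<sigma>))"
      by (rule distr_distr) auto
    also have "(\<lambda>x. norm k * x) \<circ> (\<lambda>x. \<phi> x / \<sigma>) = \<phi>"
      using \<sigma> 2(1) by auto
    finally show ?thesis by simp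
  qed
qed

lemma dual_integral:
  fixes g :: "real \<Rightarrow> real"
  assumes \<phi>: "\<phi> \<in> continuous_dual" and k: "\<And>h. \<phi> (\<iota> h) = inner k h"
    and [measurable]: "g \<in> borel_measurable borel"
  shows "(\<integral>w. g (\<phi> w) \<partial>\<mu>) = (\<integral>x. g (norm k * x) \<partial>std_normal)"
    "integrable \<mu> (\<lambda>w. g (\<phi> w)) \<longleftrightarrow> integrable std_normal (\<lambda>x. g (norm k * x))"
proof -
  note [measurable] = measurable_dual[OF \<phi>]
  have "(\<integral>w. g (\<phi> w) \<partial>\<mu>) = (\<integral>x. g x \<partial>distr \<mu> borel \<phi>)"
    by (rule integral_distr[symmetric]) auto
  also have "\<dots> = (\<integral>x. g (norm k * x) \<partial>std_normal)"
    unfolding dual_distributed[OF \<phi> k] by (rule integral_distr) auto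
  finally show "(\<integral>w. g (\<phi> w) \<partial>\<mu>) = (\<integral>x. g (norm k * x) \<partial>std_normal)" .
  have "integrable \<mu> (\<lambda>w. g (\<phi> w)) \<longleftrightarrow> integrable (distr \<mu> borel \<phi>) g"
    by (rule integrable_distr_eq[symmetric]) auto
  also have "\<dots> \<longleftrightarrow> integrable std_normal (\<lambda>x. g (norm k * x))"
    unfolding dual_distributed[OF \<phi> k] by (rule integrable_distr_eq) auto
  finally show "integrable \<mu> (\<lambda>w. g (\<phi> w)) \<longleftrightarrow> integrable std_normal (\<lambda>x. g (norm k * x))" .
qed

lemma dual_cos:
  assumes "\<phi> \<in> continuous_dual" "\<And>h. \<phi> (\<iota> h) = inner k h"
  shows "(\<integral>w. cos (\<phi> w) \<partial>\<mu>) = exp (- (norm k)\<^sup>2 / 2)"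
  using dual_integral(1)[OF assms, of cos] by (simp add: std_normal_cos)

lemma dual_sin:
  assumes "\<phi> \<in> continuous_dual"
  shows "(\<integral>w. sin (\<phi> w) \<partial>\<mu>) = 0"
proof -
  obtain k where "\<And>h. \<phi> (\<iota> h) = inner k h" using dual_vector[OF assms] by blast
  then show ?thesis using dual_integral(1)[OF assms, of k sin] by (simp add: std_normal_sin)
qed

text \<open>The factor 3 is 4! / (2^2 * 2!). Applied to sums and differences of coordinates, the
  fourth moments will give mixed moments without a joint law.\<close>

lemma dual_moments:
  assumes \<phi>: "\<phi> \<in> continuous_dual" and k: "\<And>h. \<phi> (\<iota> h) = inner k h"
  shows "integrable \<mu> (\<lambda>w. (\<phi> w)\<^sup>2)" "(\<integral>w. (\<phi> w)\<^sup>2 \<partial>\<mu>) = (norm k)\<^sup>2"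
    "integrable \<mu> (\<lambda>w. (\<phi> w)^4)" "(\<integral>w. (\<phi> w)^4 \<partial>\<mu>) = 3 * (norm k)^4"
proof -
  show "(\<integral>w. (\<phi> w)\<^sup>2 \<partial>\<mu>) = (norm k)\<^sup>2" by (rule dual_second_moment[OF \<phi> k])
  have int: "integrable std_normal (\<lambda>x. x ^ (2 * n))"
    and val: "(\<integral>x. x ^ (2 * n) \<partial>std_normal) = fact (2 * n) / (2 ^ n * fact n)" for n
    using std_normal_moment_even[of n]
    by (auto simp: has_bochner_integral_iff integrable_density integral_density)
  have "integrable std_normal (\<lambda>x. (norm k * x) ^ (2 * n))" for n
    using integrable_mult_right[OF int[of n], of "norm k ^ (2 * n)"] by (simp only: power_mult_distrib)
  from this[of 1] this[of 2] show "integrable \<mu> (\<lambda>w. (\<phi> w)\<^sup>2)" "integrable \<mu> (\<lambda>w. (\<phi> w)^4)"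
    using dual_integral(2)[OF \<phi> k, of "\<lambda>x. x\<^sup>2"] dual_integral(2)[OF \<phi> k, of "\<lambda>x. x^4"] by simp_all
  show "(\<integral>w. (\<phi> w)^4 \<partial>\<mu>) = 3 * (norm k)^4"
    using dual_integral(1)[OF \<phi> k, of "\<lambda>x. x^4"] val[of 2]
    by (simp add: power_mult_distrib fact_numeral)
qed

text \<open>Evaluated at the new point, \<open>\<phi>\<close> becomes
  \<open>\<psi> w + c * x\<close>, where \<open>\<psi>\<close> is represented by the part of
  \<open>m\<close> orthogonal to \<open>k\<close>. The variances
  \<open>(norm m)\<^sup>2 - c\<^sup>2\<close> and \<open>c\<^sup>2\<close> add up to that of
  \<open>\<phi>\<close>. The gain is that the coordinate \<open>\<xi>\<close> of the new point is
  exactly \<open>x\<close>, an independent variable over which Fubini integrates separately.\<close>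

lemma resample_coordinate:
  assumes \<xi>: "\<xi> \<in> continuous_dual" "\<And>h. \<xi> (\<iota> h) = inner k h" and k: "norm k = 1"
  shows "distr (\<mu> \<Otimes>\<^sub>M std_normal) borel (\<lambda>(w, x). w + (x - \<xi> w) *\<^sub>R \<iota> k) = \<mu>"
proof -
  note [measurable] = measurable_dual[OF \<xi>(1)]
  interpret G: prob_space std_normal by (rule prob_space_std_normal)
  interpret PG: pair_prob_space \<mu> std_normal ..
  let ?T = "\<lambda>(w, x). w + (x - \<xi> w) *\<^sub>R \<iota> k"
  have T [measurable]: "?T \<in> \<mu> \<Otimes>\<^sub>M std_normal \<rightarrow>\<^sub>M borel" by measurable
  have key: "(\<integral>w. cos (\<phi> w) \<partial>distr (\<mu> \<Otimes>\<^sub>M std_normal) borel ?T) = (\<integral>w. cos (\<phi> w) \<partial>\<mu>)"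
    "(\<integral>w. sin (\<phi> w) \<partial>distr (\<mu> \<Otimes>\<^sub>M std_normal) borel ?T) = (\<integral>w. sin (\<phi> w) \<partial>\<mu>)"
    if \<phi>: "\<phi> \<in> continuous_dual" for \<phi>
  proof -
    obtain m where m: "\<And>h. \<phi> (\<iota> h) = inner m h" using dual_vector[OF \<phi>] by blast
    define c where "c = inner m k"
    define \<psi> where "\<psi> = (\<lambda>w. \<phi> w - c * \<xi> w)"
    have \<psi>: "\<psi> \<in> continuous_dual"
      unfolding \<psi>_def by (intro continuous_dual_diff continuous_dual_scale \<phi> \<xi>(1))
    have \<psi>m: "\<psi> (\<iota> h) = inner (m - c *\<^sub>R k) h" for h
      by (simp add: \<psi>_def m \<xi>(2) inner_diff_left)
    have n: "(norm (m - c *\<^sub>R k))\<^sup>2 = (norm m)\<^sup>2 - c\<^sup>2"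
      using k unfolding power2_norm_eq_inner norm_eq_1
      by (simp add: inner_diff_left inner_diff_right c_def inner_commute power2_eq_square)
    note [measurable] = measurable_dual[OF \<phi>] measurable_dual[OF \<psi>]
      continuous_dual_measurable[OF \<phi>]
    have \<phi>T: "\<phi> (w + (x - \<xi> w) *\<^sub>R \<iota> k) = \<psi> w + c * x" for w x
    proof -
      have "\<phi> (w + (x - \<xi> w) *\<^sub>R \<iota> k) = \<phi> w + (x - \<xi> w) * c"
        by (simp add: linear_add[OF continuous_dual_linear[OF \<phi>]]
            linear_scale[OF continuous_dual_linear[OF \<phi>]] m c_def)
      then show ?thesis by (simp add: \<psi>_def algebra_simps)
    qed
    have int_std: "integrable std_normal (\<lambda>x. cos (c * x))" "integrable std_normal (\<lambda>x. sin (c * x))"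
      by (auto intro!: G.integrable_const_bound[of _ 1])
    have "(\<integral>w. cos (\<phi> w) \<partial>distr (\<mu> \<Otimes>\<^sub>M std_normal) borel ?T) =
        (\<integral>p. cos (\<psi> (fst p) + c * snd p) \<partial>(\<mu> \<Otimes>\<^sub>M std_normal))"
      by (subst integral_distr) (auto simp: case_prod_beta \<phi>T)
    also have "\<dots> = (\<integral>w. \<integral>x. cos (\<psi> w + c * x) \<partial>std_normal \<partial>\<mu>)"
      by (subst PG.integral_fst'[symmetric]) (auto intro!: PG.P.integrable_const_bound[of _ 1])
    also have "\<dots> = (\<integral>w. cos (\<psi> w) * exp (- c\<^sup>2 / 2) \<partial>\<mu>)"
      using int_std by (intro Bochner_Integration.integral_cong)
        (simp_all add: cos_add std_normal_cos std_normal_sin)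
    also have "\<dots> = exp (- (norm (m - c *\<^sub>R k))\<^sup>2 / 2) * exp (- c\<^sup>2 / 2)"
      using dual_cos[OF \<psi> \<psi>m] by simp
    also have "\<dots> = (\<integral>w. cos (\<phi> w) \<partial>\<mu>)"
      unfolding dual_cos[OF \<phi> m] n exp_add[symmetric] by (simp add: field_simps)
    finally show "(\<integral>w. cos (\<phi> w) \<partial>distr (\<mu> \<Otimes>\<^sub>M std_normal) borel ?T) = (\<integral>w. cos (\<phi> w) \<partial>\<mu>)" .
    have "(\<integral>w. sin (\<phi> w) \<partial>distr (\<mu> \<Otimes>\<^sub>M std_normal) borel ?T) =
        (\<integral>p. sin (\<psi> (fst p) + c * snd p) \<partial>(\<mu> \<Otimes>\<^sub>M std_normal))"
      by (subst integral_distr) (auto simp: case_prod_beta \<phi>T)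
    also have "\<dots> = (\<integral>w. \<integral>x. sin (\<psi> w + c * x) \<partial>std_normal \<partial>\<mu>)"
      by (subst PG.integral_fst'[symmetric]) (auto intro!: PG.P.integrable_const_bound[of _ 1])
    also have "\<dots> = (\<integral>w. sin (\<psi> w) * exp (- c\<^sup>2 / 2) \<partial>\<mu>)"
      using int_std by (intro Bochner_Integration.integral_cong)
        (simp_all add: sin_add std_normal_cos std_normal_sin)
    also have "\<dots> = (\<integral>w. sin (\<phi> w) \<partial>\<mu>)"
      using dual_sin[OF \<psi>] dual_sin[OF \<phi>] by simp
    finally show "(\<integral>w. sin (\<phi> w) \<partial>distr (\<mu> \<Otimes>\<^sub>M std_normal) borel ?T) = (\<integral>w. sin (\<phi> w) \<partial>\<mu>)" .
  qed
  show ?thesis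
    by (rule prob_measure_eqI_charfun[OF PG.P.prob_space_distr[OF T] _ prob_space_\<mu> sets_\<mu> key]) simp
qed

text \<open>After resampling, the coordinate is the free variable \<open>x\<close>, and the dilation
  merely replaces \<open>x\<close> by \<open>(1 + a) * x\<close> in the added multiple of
  \<open>\<iota> k\<close>. For fixed \<open>w\<close> this is the one-dimensional
  substitution.\<close>

lemma coordinate_dilation:
  assumes \<xi>: "\<xi> \<in> continuous_dual" "\<And>h. \<xi> (\<iota> h) = inner k h" and k: "norm k = 1"
    and a: "1 + a \<noteq> 0" and h [measurable]: "h \<in> borel_measurable borel"
  shows "(\<integral>\<^sup>+w. h (w + (a * \<xi> w) *\<^sub>R \<iota> k) * ennreal (\<bar>1 + a\<bar> * exp (- ((1 + a)\<^sup>2 - 1) * (\<xi> w)\<^sup>2 / 2)) \<partial>\<mu>) =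
    (\<integral>\<^sup>+w. h w \<partial>\<mu>)"
proof -
  note [measurable] = measurable_dual[OF \<xi>(1)] continuous_dual_measurable[OF \<xi>(1)]
  interpret G: prob_space std_normal by (rule prob_space_std_normal)
  interpret PG: pair_prob_space \<mu> std_normal ..
  let ?T = "\<lambda>(w, x). w + (x - \<xi> w) *\<^sub>R \<iota> k"
  let ?b = "1 + a"
  let ?l = "\<lambda>x. ennreal (\<bar>?b\<bar> * exp (- (?b\<^sup>2 - 1) * x\<^sup>2 / 2))"
  note distr_T = resample_coordinate[OF \<xi> k]
  have \<xi>T: "\<xi> (w + (x - \<xi> w) *\<^sub>R \<iota> k) = x" for w x
    using k by (simp add: linear_add[OF continuous_dual_linear[OF \<xi>(1)]]
          linear_scale[OF continuous_dual_linear[OF \<xi>(1)]] \<xi>(2) norm_eq_1)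
  have shift: "w + (x - \<xi> w) *\<^sub>R \<iota> k + (a * x) *\<^sub>R \<iota> k = w + (?b * x - \<xi> w) *\<^sub>R \<iota> k" for w x
    by (simp add: algebra_simps)
  have "(\<integral>\<^sup>+w. h (w + (a * \<xi> w) *\<^sub>R \<iota> k) * ?l (\<xi> w) \<partial>\<mu>) =
      (\<integral>\<^sup>+w. h (w + (a * \<xi> w) *\<^sub>R \<iota> k) * ?l (\<xi> w) \<partial>distr (\<mu> \<Otimes>\<^sub>M std_normal) borel ?T)"
    by (simp only: distr_T)
  also have "\<dots> = (\<integral>\<^sup>+p. h (fst p + (?b * snd p - \<xi> (fst p)) *\<^sub>R \<iota> k) * ?l (snd p) \<partial>(\<mu> \<Otimes>\<^sub>M std_normal))"
    by (subst nn_integral_distr) (auto simp: case_prod_beta \<xi>T shift)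
  also have "\<dots> = (\<integral>\<^sup>+w. \<integral>\<^sup>+x. h (w + (?b * x - \<xi> w) *\<^sub>R \<iota> k) * ?l x \<partial>std_normal \<partial>\<mu>)"
    by (subst G.nn_integral_fst[symmetric]) simp_all
  also have "\<dots> = (\<integral>\<^sup>+w. \<integral>\<^sup>+x. h (w + (x - \<xi> w) *\<^sub>R \<iota> k) \<partial>std_normal \<partial>\<mu>)"
    by (intro nn_integral_cong nn_integral_std_normal_scale[OF _ a]) measurable
  also have "\<dots> = (\<integral>\<^sup>+p. h (fst p + (snd p - \<xi> (fst p)) *\<^sub>R \<iota> k) \<partial>(\<mu> \<Otimes>\<^sub>M std_normal))"
    by (subst G.nn_integral_fst[symmetric]) simp_all
  also have "\<dots> = (\<integral>\<^sup>+w. h w \<partial>distr (\<mu> \<Otimes>\<^sub>M std_normal) borel ?T)"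
    by (subst nn_integral_distr) (auto simp: case_prod_beta)
  also have "\<dots> = (\<integral>\<^sup>+w. h w \<partial>\<mu>)" by (simp only: distr_T)
  finally show ?thesis .
qed

end

section \<open>Diagonal shifts\<close>

text \<open>Series in \<open>ennreal\<close> are measurable in their terms, so this form makes
  domains of convergence measurable sets.\<close>

lemma summable_iff_suminf_ennreal:
  fixes f :: "nat \<Rightarrow> real"
  assumes "\<And>n. 0 \<le> f n"
  shows "summable f \<longleftrightarrow> (\<Sum>n. ennreal (f n)) < \<top>"
proof
  assume "summable f"
  then show "(\<Sum>n. ennreal (f n)) < \<top>" using assms by (simp add: suminf_ennreal2)
next
  assume "(\<Sum>n. ennreal (f n)) < \<top>"
  then show "summable f" using assms by (intro summable_suminf_not_top) auto
qed

locale wiener_basis = wiener \<mu> \<iota>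
  for \<mu> :: "'w::separable_frechet_space measure" and \<iota> :: "'h::{real_inner, complete_space} \<Rightarrow> 'w" +
  fixes e :: "nat \<Rightarrow> 'h"
  assumes basis: "complete_orthonormal_basis e"
    and basis_dual: "range e \<subseteq> dual_in_H \<iota>"
begin

abbreviation \<xi> :: "nat \<Rightarrow> 'w \<Rightarrow> real" where
  "\<xi> n \<equiv> div_const \<iota> (e n)"

lemma \<xi>_dual: "\<xi> n \<in> continuous_dual" and \<xi>_\<iota>: "\<xi> n (\<iota> h) = inner (e n) h"
proof -
  obtain \<phi> where \<phi>: "\<phi> \<in> continuous_dual" "\<forall>h. \<phi> (\<iota> h) = inner (e n) h"
    using basis_dual by (auto simp: dual_in_H_def)
  have "\<xi> n \<in> continuous_dual \<and> (\<forall>h. \<xi> n (\<iota> h) = inner (e n) h)"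
    unfolding div_const_def
  proof (rule theI[of _ \<phi>])
    show "\<psi> = \<phi>" if "\<psi> \<in> continuous_dual \<and> (\<forall>h. \<psi> (\<iota> h) = inner (e n) h)" for \<psi>
      using dual_unique[of \<psi> \<phi>] that \<phi> by auto
  qed (use \<phi> in auto)
  then show "\<xi> n \<in> continuous_dual" "\<xi> n (\<iota> h) = inner (e n) h" by auto
qed

lemma \<xi>_measurable [measurable]: "\<xi> n \<in> borel_measurable borel"
  using \<xi>_dual by (rule continuous_dual_measurable)

lemma \<xi>_linear: "linear (\<xi> n)"
  using \<xi>_dual by (rule continuous_dual_linear)

lemma inner_e: "inner (e m) (e n) = (if m = n then 1 else 0)"
  using basis by (simp add: complete_orthonormal_basis_def)

lemma norm_e: "norm (e n) = 1"
  by (simp add: norm_eq_1 inner_e)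

lemma \<xi>_e: "\<xi> m (\<iota> (e n)) = (if m = n then 1 else 0)"
  by (simp add: \<xi>_\<iota> inner_e)

subsection \<open>Orthonormal series\<close>

lemma norm_ortho_sum:
  assumes "finite F"
  shows "(norm (\<Sum>n\<in>F. c n *\<^sub>R e n))\<^sup>2 = (\<Sum>n\<in>F. (c n)\<^sup>2)"
proof -
  have "pairwise (\<lambda>i j. orthogonal (c i *\<^sub>R e i) (c j *\<^sub>R e j)) F"
    by (auto simp: pairwise_def orthogonal_def inner_e)
  from norm_sum_Pythagorean[OF assms this] show ?thesis by (simp add: norm_e)
qed

text \<open>Orthogonality controls the norm of every finite block beyond \<open>N\<close> by its sum
  of squares, whatever the shape of the block. This gives unconditional convergence, although the
  norms \<open>\<bar>c n\<bar>\<close> need not be summable.\<close>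

lemma ortho_has_sum:
  assumes c: "summable (\<lambda>n. (c n)\<^sup>2)"
  shows "\<exists>s. ((\<lambda>n. c n *\<^sub>R e n) has_sum s) UNIV"
proof -
  let ?X = "\<lambda>F. \<Sum>n\<in>F. c n *\<^sub>R e n"
  have tail: "\<exists>N. \<forall>F. finite F \<and> F \<subseteq> {N..} \<longrightarrow> norm (?X F) < \<epsilon>" if \<epsilon>: "0 < \<epsilon>" for \<epsilon>
  proof -
    obtain N where N: "\<And>m n. m \<ge> N \<Longrightarrow> norm (\<Sum>i=m..<n. (c i)\<^sup>2) < \<epsilon>\<^sup>2"
      using c \<epsilon> unfolding summable_Cauchy by (meson zero_less_power)
    have "norm (?X F) < \<epsilon>" if F: "finite F" "F \<subseteq> {N..}" for F
    proof -
      \<comment> \<open>Inserting 0 gives \<open>Max\<close> a value also for an empty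
        block.\<close>
      have "F \<subseteq> {N..<Suc (Max (insert 0 F))}"
        using F by (auto simp: less_Suc_eq_le)
      then have "(\<Sum>n\<in>F. (c n)\<^sup>2) \<le> (\<Sum>n=N..<Suc (Max (insert 0 F)). (c n)\<^sup>2)"
        by (intro sum_mono2) auto
      also have "\<dots> < \<epsilon>\<^sup>2" using N[of N "Suc (Max (insert 0 F))"] by simp
      finally have "(norm (?X F))\<^sup>2 < \<epsilon>\<^sup>2" using norm_ortho_sum[OF F(1)] by simp
      then show ?thesis using \<epsilon> by (simp add: power_less_imp_less_base)
    qed
    then show ?thesis by blast
  qed
  have "Cauchy (\<lambda>N. ?X {..<N})"
  proof (rule CauchyI')
    fix \<epsilon> :: real assume "0 < \<epsilon>"
    from tail[OF this] obtain N where N: "\<And>F. finite F \<Longrightarrow> F \<subseteq> {N..} \<Longrightarrow> norm (?X F) < \<epsilon>" by blast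
    have "norm (?X {..<m} - ?X {..<n}) < \<epsilon>" if "N \<le> m" "m < n" for m n
    proof -
      have "?X {..<n} = ?X {..<m} + ?X {m..<n}"
        using that by (subst sum.union_disjoint[symmetric]) (auto intro!: sum.cong)
      moreover have "{m..<n} \<subseteq> {N..}" using that by auto
      ultimately show ?thesis using N[of "{m..<n}"] by simp
    qed
    then show "\<exists>M. \<forall>m\<ge>M. \<forall>n>m. dist (?X {..<m}) (?X {..<n}) < \<epsilon>"
      unfolding dist_norm by blast
  qed
  then obtain s where s: "(\<lambda>N. ?X {..<N}) \<longlonglongrightarrow> s"
    using Cauchy_convergent convergent_def by blast
  have "(?X \<longlongrightarrow> s) (finite_subsets_at_top UNIV)"
  proof (rule tendstoI)
    fix \<epsilon> :: real assume "0 < \<epsilon>"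
    then have \<epsilon>: "0 < \<epsilon> / 2" by simp
    from tail[OF this] obtain N where N: "\<And>F. finite F \<Longrightarrow> F \<subseteq> {N..} \<Longrightarrow> norm (?X F) < \<epsilon> / 2" by blast
    obtain M where M: "\<And>n. n \<ge> M \<Longrightarrow> dist (?X {..<n}) s < \<epsilon> / 2"
      using tendstoD[OF s \<epsilon>] by (auto simp: eventually_sequentially)
    have "dist (?X F) s < \<epsilon>" if F: "finite F" "{..<max M N} \<subseteq> F" for F
    proof -
      have "?X F = ?X {..<max M N} + ?X (F - {..<max M N})"
        using F by (subst sum.union_disjoint[symmetric]) (auto intro!: sum.cong)
      moreover have "norm (?X (F - {..<max M N})) < \<epsilon> / 2" using F by (intro N) auto
      moreover have "dist (?X {..<max M N}) s < \<epsilon> / 2" by (intro M) simp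
      ultimately show ?thesis
        using norm_triangle_ineq[of "?X {..<max M N} - s" "?X (F - {..<max M N})"]
        by (simp add: dist_norm algebra_simps)
    qed
    then show "\<forall>\<^sub>F F in finite_subsets_at_top UNIV. dist (?X F) s < \<epsilon>"
      unfolding eventually_finite_subsets_at_top by (intro exI[of _ "{..<max M N}"]) auto
  qed
  then show ?thesis unfolding has_sum_def by blast
qed

definition ortho_series :: "(nat \<Rightarrow> real) \<Rightarrow> 'h" where
  "ortho_series c = (\<Sum>\<^sub>\<infinity>n. c n *\<^sub>R e n)"

lemma ortho_series_has_sum:
  assumes "summable (\<lambda>n. (c n)\<^sup>2)"
  shows "((\<lambda>n. c n *\<^sub>R e n) has_sum ortho_series c) UNIV"
  using ortho_has_sum[OF assms] infsumI unfolding ortho_series_def by metis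

lemma ortho_series_tendsto:
  assumes "summable (\<lambda>n. (c n)\<^sup>2)"
  shows "(\<lambda>N. \<Sum>n<N. c n *\<^sub>R e n) \<longlonglongrightarrow> ortho_series c"
  using has_sum_imp_sums[OF ortho_series_has_sum[OF assms]] by (simp add: sums_def)

lemma inner_ortho_series:
  assumes "summable (\<lambda>n. (c n)\<^sup>2)"
  shows "inner (e k) (ortho_series c) = c k"
proof (rule LIMSEQ_unique)
  show "(\<lambda>N. inner (e k) (\<Sum>n<N. c n *\<^sub>R e n)) \<longlonglongrightarrow> inner (e k) (ortho_series c)"
    by (intro tendsto_inner tendsto_const ortho_series_tendsto assms)
  have "inner (e k) (\<Sum>n<N. c n *\<^sub>R e n) = c k" if "N > k" for N
    using that by (simp add: inner_sum_right inner_e if_distrib[of "\<lambda>x. _ * x"] cong: if_cong)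
  then have "\<forall>\<^sub>F N in sequentially. inner (e k) (\<Sum>n<N. c n *\<^sub>R e n) = c k"
    by (rule eventually_mono[OF eventually_gt_at_top[of k]])
  then show "(\<lambda>N. inner (e k) (\<Sum>n<N. c n *\<^sub>R e n)) \<longlonglongrightarrow> c k"
    by (rule tendsto_eventually)
qed

lemma \<iota>_ortho_series_tendsto:
  assumes "summable (\<lambda>n. (c n)\<^sup>2)"
  shows "(\<lambda>N. \<Sum>n<N. c n *\<^sub>R \<iota> (e n)) \<longlonglongrightarrow> \<iota> (ortho_series c)"
proof -
  have "(\<lambda>N. \<iota> (\<Sum>n<N. c n *\<^sub>R e n)) \<longlonglongrightarrow> \<iota> (ortho_series c)"
    using continuous_\<iota> ortho_series_tendsto[OF assms]
    by (auto simp: continuous_on_def intro: isCont_tendsto_compose[unfolded isCont_def])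
  then show ?thesis by (simp add: linear_sum[OF linear_\<iota>] linear_scale[OF linear_\<iota>])
qed

subsection \<open>Shifts along a square summable series\<close>

definition shift_dom :: "(nat \<Rightarrow> real) \<Rightarrow> 'w set" where
  "shift_dom a = {w. summable (\<lambda>n. (a n)\<^sup>2 * (\<xi> n w)\<^sup>2)}"

text \<open>Off the domain the map is the identity, hence total and, the domain being Borel, a Borel
  map.\<close>

definition shift :: "(nat \<Rightarrow> real) \<Rightarrow> 'w \<Rightarrow> 'w" where
  "shift a w = (if w \<in> shift_dom a then w + \<iota> (ortho_series (\<lambda>n. a n * \<xi> n w)) else w)"

definition pshift :: "(nat \<Rightarrow> real) \<Rightarrow> nat \<Rightarrow> 'w \<Rightarrow> 'w" where
  "pshift a N w = w + (\<Sum>n<N. (a n * \<xi> n w) *\<^sub>R \<iota> (e n))"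

text \<open>The factors are one-dimensional density ratios. In this form they multiply along
  compositions and cancel against those of the inverse; \<open>pjac_eq\<close> gives the regularized
  form that has a limit.\<close>

definition pjac :: "(nat \<Rightarrow> real) \<Rightarrow> nat \<Rightarrow> 'w \<Rightarrow> real" where
  "pjac a N w = (\<Prod>n<N. \<bar>1 + a n\<bar> * exp (- ((1 + a n)\<^sup>2 - 1) * (\<xi> n w)\<^sup>2 / 2))"

lemma pshift_tendsto:
  assumes "w \<in> shift_dom a"
  shows "(\<lambda>N. pshift a N w) \<longlonglongrightarrow> shift a w"
  using assms unfolding pshift_def shift_def shift_dom_def
  by (auto intro!: tendsto_add \<iota>_ortho_series_tendsto simp: power_mult_distrib)

lemma \<xi>_shift:
  assumes "w \<in> shift_dom a"
  shows "\<xi> n (shift a w) = (1 + a n) * \<xi> n w"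
proof -
  have "summable (\<lambda>n. (a n * \<xi> n w)\<^sup>2)"
    using assms by (simp add: shift_dom_def power_mult_distrib)
  then show ?thesis
    using assms by (simp add: shift_def linear_add[OF \<xi>_linear] \<xi>_\<iota> inner_ortho_series algebra_simps)
qed

lemma shift_dom_measurable [measurable]:
  "Measurable.pred borel (\<lambda>w. w \<in> shift_dom a)"
  unfolding shift_dom_def by (simp add: summable_iff_suminf_ennreal) measurable

lemma pshift_measurable [measurable]: "pshift a N \<in> borel_measurable borel"
  unfolding pshift_def by measurable

lemma pjac_measurable [measurable]: "pjac a N \<in> borel_measurable borel"
  unfolding pjac_def by measurable

text \<open>The coefficients depend on a parameter, later \<open>z\<close>, so that the random shift
  becomes jointly measurable. On its domain the shift is a limit of partial shifts, which are finite
  sums of measurable terms.\<close>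

lemma shift_measurable_param:
  assumes b [measurable]: "\<And>n. (\<lambda>x. b x n) \<in> borel_measurable M"
    and g [measurable]: "g \<in> borel_measurable M"
  shows "Measurable.pred M (\<lambda>x. g x \<in> shift_dom (b x))"
    and "(\<lambda>x. shift (b x) (g x)) \<in> borel_measurable M"
proof -
  have \<xi>g [measurable]: "(\<lambda>x. \<xi> n (g x)) \<in> borel_measurable M" for n
    using measurable_compose[OF g \<xi>_measurable[of n]] .
  show P [measurable]: "Measurable.pred M (\<lambda>x. g x \<in> shift_dom (b x))"
    unfolding shift_dom_def by (simp add: summable_iff_suminf_ennreal) measurable
  show "(\<lambda>x. shift (b x) (g x)) \<in> borel_measurable M"
  proof (rule borel_measurable_LIMSEQ_metric)
    show "(\<lambda>x. if g x \<in> shift_dom (b x) then pshift (b x) N (g x) else g x) \<in> borel_measurable M" for N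
      unfolding pshift_def by measurable
    show "(\<lambda>N. if g x \<in> shift_dom (b x) then pshift (b x) N (g x) else g x) \<longlonglongrightarrow> shift (b x) (g x)" for x
      using pshift_tendsto[of "g x" "b x"] by (auto simp: shift_def)
  qed
qed

lemma shift_measurable [measurable]: "shift a \<in> borel_measurable borel"
  by (rule shift_measurable_param(2)) auto

text \<open>Dilating coordinate \<open>N\<close> first leaves the earlier coordinates untouched, so
  composition with \<open>pshift a N\<close> is \<open>pshift a (Suc N)\<close> and the weights
  multiply.\<close>

lemma pshift_change_of_variables:
  assumes a: "\<And>n. 1 + a n \<noteq> 0" and "h \<in> borel_measurable borel"
  shows "(\<integral>\<^sup>+w. h (pshift a N w) * ennreal (pjac a N w) \<partial>\<mu>) = (\<integral>\<^sup>+w. h w \<partial>\<mu>)"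
proof (induction N)
  case 0
  then show ?case by (simp add: pshift_def pjac_def)
next
  case (Suc N)
  note [measurable] = assms(2)
  define S where "S w = w + (a N * \<xi> N w) *\<^sub>R \<iota> (e N)" for w
  define l where "l w = \<bar>1 + a N\<bar> * exp (- ((1 + a N)\<^sup>2 - 1) * (\<xi> N w)\<^sup>2 / 2)" for w
  have \<xi>S: "\<xi> n (S w) = \<xi> n w" if "n \<noteq> N" for n w
    using that by (simp add: S_def linear_add[OF \<xi>_linear] linear_scale[OF \<xi>_linear] \<xi>_e)
  have "pshift a N (S w) = pshift a (Suc N) w" for w
    by (simp add: pshift_def \<xi>S) (simp add: S_def algebra_simps)
  moreover have "pjac a N (S w) * l w = pjac a (Suc N) w" for w
    by (simp add: pjac_def \<xi>S l_def)
  moreover have "0 \<le> pjac a N w" "0 \<le> l w" for w by (auto simp: pjac_def l_def intro!: prod_nonneg)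
  ultimately have "(\<integral>\<^sup>+w. h (pshift a (Suc N) w) * ennreal (pjac a (Suc N) w) \<partial>\<mu>) =
      (\<integral>\<^sup>+w. (\<lambda>w. h (pshift a N w) * ennreal (pjac a N w)) (S w) * ennreal (l w) \<partial>\<mu>)"
    by (simp add: ennreal_mult mult.assoc flip: \<open>\<And>w. pjac a N (S w) * l w = pjac a (Suc N) w\<close>)
  also have "\<dots> = (\<integral>\<^sup>+w. h (pshift a N w) * ennreal (pjac a N w) \<partial>\<mu>)"
    unfolding S_def l_def
    by (rule coordinate_dilation[OF \<xi>_dual \<xi>_\<iota> norm_e a]) measurable
  finally show ?case using Suc by simp
qed

text \<open>Fatou's lemma for indicators of open sets, then outer regularity of \<open>\<mu>\<close>.\<close>

lemma shift_density_le:
  assumes a: "\<And>n. 1 + a n \<noteq> 0" and dom: "AE w in \<mu>. w \<in> shift_dom a"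
    and r: "strict_mono (r :: nat \<Rightarrow> nat)" and \<rho> [measurable]: "\<rho> \<in> borel_measurable borel"
    and lim: "AE w in \<mu>. (\<lambda>j. pjac a (r j) w) \<longlonglongrightarrow> \<rho> w"
    and h [measurable]: "h \<in> borel_measurable borel"
  shows "(\<integral>\<^sup>+w. h (shift a w) * ennreal (\<rho> w) \<partial>\<mu>) \<le> (\<integral>\<^sup>+w. h w \<partial>\<mu>)"
proof -
  define \<nu> where "\<nu> = distr (density \<mu> (\<lambda>w. ennreal (\<rho> w))) borel (shift a)"
  have [measurable_cong]: "sets \<nu> = sets borel" by (simp add: \<nu>_def)
  have \<nu>: "(\<integral>\<^sup>+w. g w \<partial>\<nu>) = (\<integral>\<^sup>+w. g (shift a w) * ennreal (\<rho> w) \<partial>\<mu>)"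
    if [measurable]: "g \<in> borel_measurable borel" for g
    unfolding \<nu>_def by (simp add: nn_integral_distr nn_integral_density mult.commute)
  have open_le: "emeasure \<nu> G \<le> emeasure \<mu> G" if G: "open G" for G
  proof -
    have [measurable]: "G \<in> sets borel" using G by simp
    have "emeasure \<nu> G = (\<integral>\<^sup>+w. indicator G (shift a w) * ennreal (\<rho> w) \<partial>\<mu>)"
      using \<nu>[of "indicator G"] by (simp add: nn_integral_indicator)
    \<comment> \<open>Openness is what makes this work: if the limit lies in \<open>G\<close>, so do
      all but finitely many approximants, and if it does not, the left side vanishes.\<close>
    also have "\<dots> \<le> (\<integral>\<^sup>+w. liminf (\<lambda>j. indicator G (pshift a (r j) w) * ennreal (pjac a (r j) w)) \<partial>\<mu>)"
    proof (rule nn_integral_mono_AE)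
      show "AE w in \<mu>. indicator G (shift a w) * ennreal (\<rho> w) \<le>
          liminf (\<lambda>j. indicator G (pshift a (r j) w) * ennreal (pjac a (r j) w))"
        using dom lim
      proof eventually_elim
        case (elim w)
        show ?case
        proof (cases "shift a w \<in> G")
          case True
          have "(\<lambda>j. pshift a (r j) w) \<longlonglongrightarrow> shift a w"
            using LIMSEQ_subseq_LIMSEQ[OF pshift_tendsto[OF elim(1)] r] by (simp add: o_def)
          then have "\<forall>\<^sub>F j in sequentially. pshift a (r j) w \<in> G"
            using G True by (rule topological_tendstoD)
          then have "\<forall>\<^sub>F j in sequentially. indicator G (pshift a (r j) w) * ennreal (pjac a (r j) w) =
              ennreal (pjac a (r j) w)"
            by eventually_elim simp
          then have "(\<lambda>j. indicator G (pshift a (r j) w) * ennreal (pjac a (r j) w)) \<longlonglongrightarrow> ennreal (\<rho> w)"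
            using tendsto_ennrealI[OF elim(2)] by (simp add: tendsto_cong)
          then have "liminf (\<lambda>j. indicator G (pshift a (r j) w) * ennreal (pjac a (r j) w)) = ennreal (\<rho> w)"
            by (intro lim_imp_Liminf) auto
          then show ?thesis using True by simp
        qed simp
      qed
    qed
    also have "\<dots> \<le> liminf (\<lambda>j. \<integral>\<^sup>+w. indicator G (pshift a (r j) w) * ennreal (pjac a (r j) w) \<partial>\<mu>)"
      by (rule nn_integral_liminf) measurable
    also have "\<dots> = (\<integral>\<^sup>+w. indicator G w \<partial>\<mu>)"
      using pshift_change_of_variables[OF a, of "indicator G"] by (simp add: Liminf_const)
    also have "\<dots> = emeasure \<mu> G" by (simp add: nn_integral_indicator sets_\<mu>)
    finally show ?thesis .
  qed
  have "emeasure \<nu> B \<le> emeasure \<mu> B" for B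
  proof (cases "B \<in> sets borel")
    case True
    have "emeasure \<nu> B \<le> (INF U\<in>{U. B \<subseteq> U \<and> open U}. emeasure \<mu> U)"
    proof (rule INF_greatest)
      fix U assume U: "U \<in> {U. B \<subseteq> U \<and> open U}"
      then have "emeasure \<nu> B \<le> emeasure \<nu> U" by (intro emeasure_mono) (auto simp: \<nu>_def)
      also have "\<dots> \<le> emeasure \<mu> U" using U open_le by simp
      finally show "emeasure \<nu> B \<le> emeasure \<mu> U" .
    qed
    also have "\<dots> = emeasure \<mu> B"
      by (rule outer_regular[OF sets_\<mu> _ True, symmetric]) simp
    finally show ?thesis .
  next
    case False
    then show ?thesis by (simp add: \<nu>_def emeasure_notin_sets)
  qed
  then have le: "\<nu> \<le> \<mu>"
    by (simp add: le_measure_iff le_fun_def \<nu>_def sets_\<mu>)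
  have "(\<integral>\<^sup>+w. h (shift a w) * ennreal (\<rho> w) \<partial>\<mu>) = (\<integral>\<^sup>+w. h w \<partial>\<nu>)" by (simp add: \<nu>)
  also have "\<dots> \<le> (\<integral>\<^sup>+w. h w \<partial>\<mu>)"
    using le by (intro nn_integral_mono_measure) (auto simp: \<nu>_def sets_\<mu>)
  finally show ?thesis .
qed

end

section \<open>Regularized products\<close>

text \<open>Square summability leaves only finitely many terms of absolute value at least 1/2, whose
  factors are kept in \<open>k\<close>. For the others \<open>ln (1 + a n) - a n\<close> is bounded
  by \<open>2 * (a n)\<^sup>2\<close>, so the logarithms are absolutely summable and the order of
  the factors is immaterial. The exponential part never vanishes, so a zero can only come from a
  factor with index in \<open>B\<close>.\<close>

lemma regularized_product_converges:
  fixes a :: "nat \<Rightarrow> real"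
  assumes sq: "summable (\<lambda>n. (a n)\<^sup>2)"
  obtains D where "((\<lambda>F. \<Prod>n\<in>F. (1 + a n) * exp (- a n)) \<longlongrightarrow> D) (finite_subsets_at_top UNIV)"
    "D = 0 \<longleftrightarrow> (\<exists>n. a n = -1)"
proof -
  define B where "B = {n. 1/2 \<le> \<bar>a n\<bar>}"
  define k where "k n = (if n \<in> B then (1 + a n) * exp (- a n) else 1)" for n
  define l where "l n = (if n \<in> B then 0 else ln (1 + a n) - a n)" for n
  have "(\<lambda>n. (a n)\<^sup>2) \<longlonglongrightarrow> 0" using sq by (rule summable_LIMSEQ_zero)
  then have "\<forall>\<^sub>F n in sequentially. (a n)\<^sup>2 < (1/2)\<^sup>2" by (rule order_tendstoD) simp
  then obtain N where N: "\<And>n. n \<ge> N \<Longrightarrow> (a n)\<^sup>2 < (1/2)\<^sup>2" by (auto simp: eventually_sequentially)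
  have small: "\<bar>a n\<bar> < 1/2" if "n \<ge> N" for n
    by (rule power_less_imp_less_base[of _ 2]) (use N[OF that] in simp_all)
  have "B \<subseteq> {..<N}"
  proof
    fix n assume "n \<in> B"
    then show "n \<in> {..<N}" using small[of n] by (cases "n \<ge> N") (auto simp: B_def)
  qed
  then have finB: "finite B" by (rule finite_subset) simp
  have split: "(1 + a n) * exp (- a n) = k n * exp (l n)" for n
  proof (cases "n \<in> B")
    case False
    then have "0 < 1 + a n" by (auto simp: B_def)
    then show ?thesis using False by (simp add: k_def l_def exp_diff exp_minus divide_inverse)
  qed (simp add: k_def l_def)
  have "norm (l n) \<le> 2 * (a n)\<^sup>2" for n
  proof (cases "n \<in> B")
    case False
    then have "\<bar>a n\<bar> \<le> 1/2" by (simp add: B_def)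
    from abs_ln_one_plus_x_minus_x_bound[OF this] show ?thesis using False by (simp add: l_def)
  qed (simp add: l_def)
  then have "norm (norm (l n)) \<le> 2 * (a n)\<^sup>2" for n by simp
  then have "summable (\<lambda>n. norm (l n))"
    by (intro summable_comparison_test'[OF summable_mult[OF sq]])
  then have "l summable_on UNIV" by (rule norm_summable_imp_summable_on)
  then obtain L where "(l has_sum L) UNIV" by (auto simp: summable_on_def)
  then have "((\<lambda>F. exp (sum l F)) \<longlongrightarrow> exp L) (finite_subsets_at_top UNIV)"
    unfolding has_sum_def by (rule tendsto_exp)
  moreover have "((\<lambda>F. prod k F) \<longlongrightarrow> prod k B) (finite_subsets_at_top UNIV)"
  proof (rule tendsto_eventually)
    have "prod k F = prod k B" if "finite F" "B \<subseteq> F" for F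
      by (rule prod.mono_neutral_right) (use that in \<open>auto simp: k_def\<close>)
    then show "\<forall>\<^sub>F F in finite_subsets_at_top UNIV. prod k F = prod k B"
      unfolding eventually_finite_subsets_at_top using finB by blast
  qed
  ultimately have "((\<lambda>F. prod k F * exp (sum l F)) \<longlongrightarrow> prod k B * exp L) (finite_subsets_at_top UNIV)"
    by (intro tendsto_mult)
  moreover have "\<forall>\<^sub>F F in finite_subsets_at_top (UNIV :: nat set).
      prod k F * exp (sum l F) = (\<Prod>n\<in>F. (1 + a n) * exp (- a n))"
    by (rule eventually_finite_subsets_at_top_weakI) (simp add: split prod.distrib exp_sum)
  ultimately have "((\<lambda>F. \<Prod>n\<in>F. (1 + a n) * exp (- a n)) \<longlongrightarrow> prod k B * exp L) (finite_subsets_at_top UNIV)"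
    by (rule Lim_transform_eventually)
  moreover have "prod k B * exp L = 0 \<longleftrightarrow> (\<exists>n. a n = -1)"
  proof -
    have "k n = 0 \<longleftrightarrow> a n = -1" for n by (auto simp: k_def B_def)
    moreover have "n \<in> B" if "a n = -1" for n using that by (simp add: B_def)
    ultimately show ?thesis using finB by auto
  qed
  ultimately show thesis by (rule that)
qed

lemma tendsto_finite_subsets_lessThan:
  assumes "(f \<longlongrightarrow> D) (finite_subsets_at_top (UNIV :: nat set))"
  shows "(\<lambda>N. f {..<N}) \<longlonglongrightarrow> D"
  by (rule filterlim_compose[OF assms filterlim_lessThan_at_top])

section \<open>Coefficients of the inverse map\<close>

definition inv_coeff :: "(nat \<Rightarrow> real) \<Rightarrow> nat \<Rightarrow> real" where
  "inv_coeff a n = - a n / (1 + a n)"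

context
  fixes a :: "nat \<Rightarrow> real"
  assumes nz: "\<And>n. 1 + a n \<noteq> 0" and sq: "summable (\<lambda>n. (a n)\<^sup>2)"
begin

lemma inv_coeff_add: "1 + inv_coeff a n = 1 / (1 + a n)"
  using nz[of n] by (simp add: inv_coeff_def field_simps)

lemma inv_coeff_nz: "1 + inv_coeff a n \<noteq> 0"
  using nz[of n] by (simp add: inv_coeff_add)

lemma inv_coeff_inv_coeff: "inv_coeff (inv_coeff a) = a"
proof
  fix n
  have "inv_coeff (inv_coeff a) n = - inv_coeff a n / (1 / (1 + a n))"
    by (simp only: inv_coeff_def[of "inv_coeff a"] inv_coeff_add)
  also have "\<dots> = a n" using nz[of n] by (simp add: inv_coeff_def)
  finally show "inv_coeff (inv_coeff a) n = a n" .
qed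

lemma one_plus_tendsto_1: "(\<lambda>n. 1 + a n) \<longlonglongrightarrow> 1"
proof -
  have "(\<lambda>n. (a n)\<^sup>2) \<longlonglongrightarrow> 0" using sq by (rule summable_LIMSEQ_zero)
  then have "(\<lambda>n. sqrt ((a n)\<^sup>2)) \<longlonglongrightarrow> sqrt 0" by (rule tendsto_real_sqrt)
  then have "a \<longlonglongrightarrow> 0" by (simp add: tendsto_rabs_zero_iff)
  from tendsto_add[OF tendsto_const[of 1] this] show ?thesis by simp
qed

text \<open>\<open>a\<close> tends to 0 and no \<open>1 + a n\<close> vanishes. Multiplication by
  these factors or by their inverses therefore preserves summability, which is why a shift and its
  inverse share their domain.\<close>

lemma one_plus_bounds: "\<exists>C. \<forall>n. \<bar>1 + a n\<bar> \<le> C \<and> \<bar>1 / (1 + a n)\<bar> \<le> C"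
proof -
  have "(\<lambda>n. 1 / (1 + a n)) \<longlonglongrightarrow> 1 / 1"
    by (intro tendsto_divide tendsto_const one_plus_tendsto_1) simp
  then have "Bseq (\<lambda>n. 1 / (1 + a n))" by (rule convergent_imp_Bseq[OF convergentI])
  moreover have "Bseq (\<lambda>n. 1 + a n)" using one_plus_tendsto_1 by (rule convergent_imp_Bseq[OF convergentI])
  ultimately obtain C C' where "\<And>n. \<bar>1 + a n\<bar> \<le> C" "\<And>n. \<bar>1 / (1 + a n)\<bar> \<le> C'"
    unfolding Bseq_def real_norm_def by blast
  then show ?thesis by (intro exI[of _ "max C C'"]) (meson max.coboundedI1 max.coboundedI2)
qed

end

lemma summable_bounded_mult:
  fixes c f :: "nat \<Rightarrow> real"
  assumes "summable f" "\<And>n. 0 \<le> f n" "\<And>n. \<bar>c n\<bar> \<le> C"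
  shows "summable (\<lambda>n. c n * f n)"
proof (rule summable_comparison_test'[of "\<lambda>n. C * f n" 0])
  show "summable (\<lambda>n. C * f n)" using assms(1) by (rule summable_mult)
  show "norm (c n * f n) \<le> C * f n" for n
    using assms(2,3)[of n] by (simp add: abs_mult mult_right_mono)
qed

lemma inv_coeff_sq:
  assumes "\<And>n. 1 + a n \<noteq> 0" "summable (\<lambda>n. (a n)\<^sup>2)"
  shows "summable (\<lambda>n. (inv_coeff a n)\<^sup>2)"
proof -
  obtain C where C: "\<And>n. \<bar>1 / (1 + a n)\<bar> \<le> C" using one_plus_bounds[of a] assms by blast
  have "summable (\<lambda>n. (1 / (1 + a n))\<^sup>2 * (a n)\<^sup>2)"
  proof (rule summable_bounded_mult[OF assms(2)])
    show "\<bar>(1 / (1 + a n))\<^sup>2\<bar> \<le> C\<^sup>2" for n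
      using power_mono[OF C[of n], of 2] by (simp add: power_divide)
  qed simp
  then show ?thesis by (simp add: inv_coeff_def power_divide power2_eq_square)
qed

context wiener_basis
begin

subsection \<open>Inverting a shift\<close>

context
  fixes a :: "nat \<Rightarrow> real"
  assumes nz: "\<And>n. 1 + a n \<noteq> 0" and sq: "summable (\<lambda>n. (a n)\<^sup>2)"
begin

lemma shift_dom_shift:
  assumes "w \<in> shift_dom a"
  shows "shift a w \<in> shift_dom a"
proof -
  obtain C where C: "\<And>n. \<bar>1 + a n\<bar> \<le> C" using one_plus_bounds[of a] nz sq by blast
  have "summable (\<lambda>n. (1 + a n)\<^sup>2 * ((a n)\<^sup>2 * (\<xi> n w)\<^sup>2))"
  proof (rule summable_bounded_mult)
    show "summable (\<lambda>n. (a n)\<^sup>2 * (\<xi> n w)\<^sup>2)" using assms by (simp add: shift_dom_def)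
    show "\<bar>(1 + a n)\<^sup>2\<bar> \<le> C\<^sup>2" for n using power_mono[OF C[of n], of 2] by simp
  qed simp
  then show ?thesis
    by (simp add: shift_dom_def \<xi>_shift[OF assms] power_mult_distrib mult.left_commute)
qed

lemma shift_dom_inv_subset: "shift_dom a \<subseteq> shift_dom (inv_coeff a)"
proof
  fix w assume w: "w \<in> shift_dom a"
  obtain C where C: "\<And>n. \<bar>1 / (1 + a n)\<bar> \<le> C" using one_plus_bounds[of a] nz sq by blast
  have "summable (\<lambda>n. (1 / (1 + a n))\<^sup>2 * ((a n)\<^sup>2 * (\<xi> n w)\<^sup>2))"
  proof (rule summable_bounded_mult)
    show "summable (\<lambda>n. (a n)\<^sup>2 * (\<xi> n w)\<^sup>2)" using w by (simp add: shift_dom_def)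
    show "\<bar>(1 / (1 + a n))\<^sup>2\<bar> \<le> C\<^sup>2" for n
      using power_mono[OF C[of n], of 2] by (simp add: power_divide)
  qed simp
  then show "w \<in> shift_dom (inv_coeff a)"
    by (simp add: shift_dom_def inv_coeff_def power_divide)
qed

lemma shift_inv_shift:
  assumes w: "w \<in> shift_dom a"
  shows "shift (inv_coeff a) (shift a w) = w"
proof -
  have dom: "shift a w \<in> shift_dom (inv_coeff a)"
    using shift_dom_shift[OF w] shift_dom_inv_subset by auto
  \<comment> \<open>The coordinate to be shifted back is already scaled by \<open>1 + a n\<close>,
    which cancels the denominator of \<open>inv_coeff a n\<close>.\<close>
  have "inv_coeff a n * ((1 + a n) * \<xi> n w) = - (a n * \<xi> n w)" for n
    using nz[of n] by (simp add: inv_coeff_def)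
  then have "shift (inv_coeff a) (shift a w) = shift a w + \<iota> (ortho_series (\<lambda>n. - (a n * \<xi> n w)))"
    using dom by (simp add: shift_def[of "inv_coeff a"] \<xi>_shift[OF w])
  also have "ortho_series (\<lambda>n. - (a n * \<xi> n w)) = - ortho_series (\<lambda>n. a n * \<xi> n w)"
    by (simp add: ortho_series_def infsum_uminus)
  finally show ?thesis using w by (simp add: shift_def linear_neg[OF linear_\<iota>])
qed

end

text \<open>The hypotheses are fixed a second time so that the preceding facts can also be
  instantiated with \<open>inv_coeff a\<close>. As \<open>inv_coeff\<close> is an involution,
  inclusions become equalities and one-sided inverses two-sided.\<close>

context
  fixes a :: "nat \<Rightarrow> real"
  assumes nz: "\<And>n. 1 + a n \<noteq> 0" and sq: "summable (\<lambda>n. (a n)\<^sup>2)"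
begin

lemma shift_dom_inv: "shift_dom (inv_coeff a) = shift_dom a"
  using shift_dom_inv_subset[OF nz sq]
    shift_dom_inv_subset[OF inv_coeff_nz[OF nz] inv_coeff_sq[OF nz sq]]
  by (simp add: inv_coeff_inv_coeff nz sq)

lemma shift_shift_inv:
  assumes w: "w \<in> shift_dom a"
  shows "shift a (shift (inv_coeff a) w) = w" "shift (inv_coeff a) w \<in> shift_dom a"
  using shift_inv_shift[OF inv_coeff_nz[OF nz] inv_coeff_sq[OF nz sq], of w]
    shift_dom_shift[OF inv_coeff_nz[OF nz] inv_coeff_sq[OF nz sq], of w] w
  by (simp_all add: inv_coeff_inv_coeff nz sq shift_dom_inv)

lemma shift_fibre:
  "{y \<in> shift_dom a. shift a y = w} = (if w \<in> shift_dom a then {shift (inv_coeff a) w} else {})"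
  using shift_inv_shift[OF nz sq] shift_shift_inv shift_dom_shift[OF nz sq] by auto

text \<open>Factor by factor the exponents cancel, for every \<open>N\<close> and every point of the
  domain. The relation thus passes to limits along any common subsequence.\<close>

lemma pjac_inverse:
  assumes w: "w \<in> shift_dom a"
  shows "pjac a N (shift (inv_coeff a) w) * pjac (inv_coeff a) N w = 1"
proof -
  have w': "w \<in> shift_dom (inv_coeff a)" using w shift_dom_inv by simp
  have "\<bar>1 + a n\<bar> * exp (- ((1 + a n)\<^sup>2 - 1) * ((1 + inv_coeff a n) * \<xi> n w)\<^sup>2 / 2) *
      (\<bar>1 + inv_coeff a n\<bar> * exp (- ((1 + inv_coeff a n)\<^sup>2 - 1) * (\<xi> n w)\<^sup>2 / 2)) = 1" for n
  proof -
    define b where "b = 1 + a n"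
    have b: "b \<noteq> 0" and i: "1 + inv_coeff a n = 1 / b"
      using nz[of n] inv_coeff_add[of a, OF nz sq] by (simp_all add: b_def)
    have "- (b\<^sup>2 - 1) * (1 / b * \<xi> n w)\<^sup>2 / 2 + - ((1 / b)\<^sup>2 - 1) * (\<xi> n w)\<^sup>2 / 2 = 0"
      using b by (simp add: power_mult_distrib power_divide field_simps)
    then have "exp (- (b\<^sup>2 - 1) * (1 / b * \<xi> n w)\<^sup>2 / 2) * exp (- ((1 / b)\<^sup>2 - 1) * (\<xi> n w)\<^sup>2 / 2) = 1"
      by (simp only: exp_add[symmetric] exp_zero)
    moreover have "\<bar>b\<bar> * \<bar>1 / b\<bar> = 1" using b by (simp add: abs_mult[symmetric])
    moreover have "p * x * (q * y) = (p * q) * (x * y)" for p q x y :: real by simp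
    ultimately show ?thesis unfolding i b_def[symmetric] by (simp only: mult_1)
  qed
  then show ?thesis
    by (simp add: pjac_def \<xi>_shift[OF w'] flip: prod.distrib)
qed

end

text \<open>Expand \<open>(1 + a n)\<^sup>2 - 1\<close> as \<open>2 * a n + (a n)\<^sup>2\<close>
  and add and subtract \<open>a n\<close> in the exponent. Neither the product of the
  \<open>1 + a n\<close> nor the sum of the \<open>a n * (\<xi> n w)\<^sup>2\<close> need converge;
  the factor \<open>exp (- a n)\<close> compensates both at once.\<close>

lemma pjac_eq:
  "pjac a N w = \<bar>\<Prod>n<N. (1 + a n) * exp (- a n)\<bar> *
     exp (- (\<Sum>n<N. a n * ((\<xi> n w)\<^sup>2 - 1)) - (\<Sum>n<N. (a n)\<^sup>2 * (\<xi> n w)\<^sup>2) / 2)"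
proof (induction N)
  case (Suc N)
  have "exp (- ((1 + a N)\<^sup>2 - 1) * (\<xi> N w)\<^sup>2 / 2) =
      exp (- a N) * exp (- (a N * ((\<xi> N w)\<^sup>2 - 1)) - (a N)\<^sup>2 * (\<xi> N w)\<^sup>2 / 2)"
    unfolding exp_add[symmetric] by (rule arg_cong[of _ _ exp]) (simp add: power2_eq_square field_simps)
  moreover have "exp (- (\<Sum>n<Suc N. a n * ((\<xi> n w)\<^sup>2 - 1)) - (\<Sum>n<Suc N. (a n)\<^sup>2 * (\<xi> n w)\<^sup>2) / 2) =
      exp (- (\<Sum>n<N. a n * ((\<xi> n w)\<^sup>2 - 1)) - (\<Sum>n<N. (a n)\<^sup>2 * (\<xi> n w)\<^sup>2) / 2) *
      exp (- (a N * ((\<xi> N w)\<^sup>2 - 1)) - (a N)\<^sup>2 * (\<xi> N w)\<^sup>2 / 2)"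
    unfolding exp_add[symmetric] by (rule arg_cong[of _ _ exp]) (simp add: field_simps)
  moreover have "pjac a (Suc N) w = pjac a N w * (\<bar>1 + a N\<bar> * exp (- ((1 + a N)\<^sup>2 - 1) * (\<xi> N w)\<^sup>2 / 2))"
    by (simp add: pjac_def)
  ultimately show ?case using Suc by (simp add: abs_mult mult_ac)
qed (simp add: pjac_def)

lemma \<xi>_moments:
  shows "integrable \<mu> (\<lambda>w. (\<xi> n w)\<^sup>2)" "(\<integral>w. (\<xi> n w)\<^sup>2 \<partial>\<mu>) = 1"
    "integrable \<mu> (\<lambda>w. (\<xi> n w)^4)" "(\<integral>w. (\<xi> n w)^4 \<partial>\<mu>) = 3"
  using dual_moments[OF \<xi>_dual \<xi>_\<iota>, of n] by (simp_all add: norm_e)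

lemma AE_\<xi>_nonzero: "AE w in \<mu>. \<xi> n w \<noteq> 0"
proof -
  have "AE x in std_normal. x \<noteq> 0"
    using AE_lborel_singleton[of 0] by (subst AE_density) auto
  then have "AE x in distr std_normal borel (\<lambda>x. norm (e n) * x). x \<noteq> 0"
    by (subst AE_distr_iff) (auto simp: norm_e)
  then have "AE x in distr \<mu> borel (\<xi> n). x \<noteq> 0"
    by (simp only: dual_distributed[OF \<xi>_dual \<xi>_\<iota>])
  then show ?thesis
    by (subst (asm) AE_distr_iff) (auto simp: measurable_\<mu>)
qed

text \<open>Each coordinate has variance 1, so the expected value of the series is the finite sum of
  the \<open>(a n)\<^sup>2\<close>.\<close>

lemma AE_shift_dom:
  assumes "summable (\<lambda>n. (a n)\<^sup>2)"
  shows "AE w in \<mu>. w \<in> shift_dom a"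
proof -
  have [measurable]: "\<xi> n \<in> borel_measurable \<mu>" for n by (simp add: measurable_\<mu>)
  have int: "(\<integral>\<^sup>+w. ennreal ((a n)\<^sup>2 * (\<xi> n w)\<^sup>2) \<partial>\<mu>) = ennreal ((a n)\<^sup>2)" for n
    using \<xi>_moments(1,2)[of n] by (subst nn_integral_eq_integral) auto
  have "(\<integral>\<^sup>+w. (\<Sum>n. ennreal ((a n)\<^sup>2 * (\<xi> n w)\<^sup>2)) \<partial>\<mu>) = (\<Sum>n. \<integral>\<^sup>+w. ennreal ((a n)\<^sup>2 * (\<xi> n w)\<^sup>2) \<partial>\<mu>)"
    by (rule nn_integral_suminf) measurable
  also have "\<dots> < \<top>"
    unfolding int using assms summable_iff_suminf_ennreal[of "\<lambda>n. (a n)\<^sup>2"] by simp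
  finally have "AE w in \<mu>. (\<Sum>n. ennreal ((a n)\<^sup>2 * (\<xi> n w)\<^sup>2)) \<noteq> \<infinity>"
    by (intro nn_integral_PInf_AE) auto
  then show ?thesis
    by eventually_elim (simp add: shift_dom_def summable_iff_suminf_ennreal less_top)
qed

lemma shift_change_of_variables:
  assumes nz: "\<And>n. 1 + a n \<noteq> 0" and sq: "summable (\<lambda>n. (a n)\<^sup>2)"
    and r: "strict_mono (r :: nat \<Rightarrow> nat)" and \<delta> [measurable]: "\<delta> \<in> borel_measurable borel"
    and lim: "AE w in \<mu>. (\<lambda>j. \<Sum>n<r j. a n * ((\<xi> n w)\<^sup>2 - 1)) \<longlonglongrightarrow> \<delta> w"
    and D: "(\<lambda>N. \<Prod>n<N. (1 + a n) * exp (- a n)) \<longlonglongrightarrow> D"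
    and h [measurable]: "h \<in> borel_measurable borel"
  shows "(\<integral>\<^sup>+w. h (shift a w) * ennreal (\<bar>D\<bar> * exp (- \<delta> w - (\<Sum>n. (a n)\<^sup>2 * (\<xi> n w)\<^sup>2) / 2)) \<partial>\<mu>) =
    (\<integral>\<^sup>+w. h w \<partial>\<mu>)"
proof -
  let ?b = "inv_coeff a"
  define \<rho> where "\<rho> w = \<bar>D\<bar> * exp (- \<delta> w - (\<Sum>n. (a n)\<^sup>2 * (\<xi> n w)\<^sup>2) / 2)" for w
  \<comment> \<open>Since \<open>inv_coeff a n = - a n + (a n)\<^sup>2 / (1 + a n)\<close>, the
    chaos series of the inverse is minus that of \<open>a\<close> plus two convergent series; it
    converges along the same \<open>r\<close>.\<close>
  define \<delta>' where "\<delta>' w = - \<delta> w + (\<Sum>n. (1 / (1 + a n)) * ((a n)\<^sup>2 * (\<xi> n w)\<^sup>2) - 1 / (1 + a n) * (a n)\<^sup>2)" for w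
  note b_nz = inv_coeff_nz[of a, OF nz sq] and b_sq = inv_coeff_sq[OF nz sq]
  obtain D' where "((\<lambda>F. \<Prod>n\<in>F. (1 + ?b n) * exp (- ?b n)) \<longlongrightarrow> D') (finite_subsets_at_top UNIV)"
    and D'0: "D' = 0 \<longleftrightarrow> (\<exists>n. ?b n = -1)"
    using regularized_product_converges[OF b_sq] by blast
  then have D': "(\<lambda>N. \<Prod>n<N. (1 + ?b n) * exp (- ?b n)) \<longlonglongrightarrow> D'"
    by (intro tendsto_finite_subsets_lessThan)
  \<comment> \<open>This makes \<open>\<rho>'\<close> strictly positive, on which the null set
    argument below relies.\<close>
  have "D' \<noteq> 0" using D'0 b_nz by (metis add.right_inverse)
  define \<rho>' where "\<rho>' w = \<bar>D'\<bar> * exp (- \<delta>' w - (\<Sum>n. (?b n)\<^sup>2 * (\<xi> n w)\<^sup>2) / 2)" for w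
  have [measurable]: "\<rho> \<in> borel_measurable borel" "\<rho>' \<in> borel_measurable borel"
    unfolding \<rho>_def \<rho>'_def \<delta>'_def by measurable
  have \<rho>'_pos: "0 < \<rho>' w" for w using \<open>D' \<noteq> 0\<close> by (simp add: \<rho>'_def)
  have \<rho>_nonneg: "0 \<le> \<rho> w" for w by (simp add: \<rho>_def)
  obtain C where C: "\<And>n. \<bar>1 / (1 + a n)\<bar> \<le> C" using one_plus_bounds[of a] nz sq by blast
  have dom: "AE w in \<mu>. w \<in> shift_dom a" by (rule AE_shift_dom[OF sq])
  have r_lim: "filterlim r at_top sequentially" using r by (rule filterlim_subseq)
  have lim\<rho>: "AE w in \<mu>. (\<lambda>j. pjac a (r j) w) \<longlonglongrightarrow> \<rho> w"
    using dom lim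
  proof eventually_elim
    case (elim w)
    have "(\<lambda>N. \<Sum>n<N. (a n)\<^sup>2 * (\<xi> n w)\<^sup>2) \<longlonglongrightarrow> (\<Sum>n. (a n)\<^sup>2 * (\<xi> n w)\<^sup>2)"
      using elim(1) by (simp add: shift_dom_def summable_LIMSEQ)
    then show ?case
      unfolding pjac_eq \<rho>_def
      by (intro tendsto_intros elim(2) filterlim_compose[OF D r_lim] filterlim_compose[OF _ r_lim]) auto
  qed
  have lim\<rho>': "AE w in \<mu>. (\<lambda>j. pjac ?b (r j) w) \<longlonglongrightarrow> \<rho>' w"
    using dom lim
  proof eventually_elim
    case (elim w)
    have sa: "summable (\<lambda>n. (a n)\<^sup>2 * (\<xi> n w)\<^sup>2)" using elim(1) by (simp add: shift_dom_def)
    have "w \<in> shift_dom ?b" using elim(1) shift_dom_inv[OF nz sq] by simp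
    then have q: "(\<lambda>N. \<Sum>n<N. (?b n)\<^sup>2 * (\<xi> n w)\<^sup>2) \<longlonglongrightarrow> (\<Sum>n. (?b n)\<^sup>2 * (\<xi> n w)\<^sup>2)"
      by (simp add: shift_dom_def summable_LIMSEQ)
    let ?t = "\<lambda>n. (1 / (1 + a n)) * ((a n)\<^sup>2 * (\<xi> n w)\<^sup>2) - 1 / (1 + a n) * (a n)\<^sup>2"
    have "summable ?t"
      by (intro summable_diff summable_bounded_mult[OF sa _ C] summable_bounded_mult[OF sq _ C]) simp_all
    then have t: "(\<lambda>N. \<Sum>n<N. ?t n) \<longlonglongrightarrow> (\<Sum>n. ?t n)" by (rule summable_LIMSEQ)
    have b: "?b n * ((\<xi> n w)\<^sup>2 - 1) = - (a n * ((\<xi> n w)\<^sup>2 - 1)) + ?t n" for n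
    proof -
      have "?b n = - a n + 1 / (1 + a n) * (a n)\<^sup>2"
        using nz[of n] by (simp add: inv_coeff_def field_simps power2_eq_square)
      moreover obtain c where c: "1 / (1 + a n) = c" by simp
      ultimately have "?b n = - a n + c * (a n)\<^sup>2" by simp
      then show ?thesis unfolding c by (simp only:) (simp only: algebra_simps)
    qed
    have "(\<lambda>j. - (\<Sum>n<r j. a n * ((\<xi> n w)\<^sup>2 - 1)) + (\<Sum>n<r j. ?t n)) \<longlonglongrightarrow> \<delta>' w"
      unfolding \<delta>'_def by (intro tendsto_intros elim(2) filterlim_compose[OF t r_lim])
    then have "(\<lambda>j. \<Sum>n<r j. ?b n * ((\<xi> n w)\<^sup>2 - 1)) \<longlonglongrightarrow> \<delta>' w"
      unfolding b sum.distrib sum_negf .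
    then show ?case
      unfolding pjac_eq \<rho>'_def
      by (intro tendsto_intros filterlim_compose[OF D' r_lim] filterlim_compose[OF q r_lim]) auto
  qed
  have le: "(\<integral>\<^sup>+w. g (shift a w) * ennreal (\<rho> w) \<partial>\<mu>) \<le> (\<integral>\<^sup>+w. g w \<partial>\<mu>)"
    if "g \<in> borel_measurable borel" for g
    by (rule shift_density_le[OF nz dom r _ lim\<rho> that]) simp
  have "AE w in \<mu>. w \<in> shift_dom ?b" using dom by (simp add: shift_dom_inv[OF nz sq])
  then have le': "(\<integral>\<^sup>+w. g (shift ?b w) * ennreal (\<rho>' w) \<partial>\<mu>) \<le> (\<integral>\<^sup>+w. g w \<partial>\<mu>)"
    if "g \<in> borel_measurable borel" for g
    by (rule shift_density_le[OF b_nz _ r _ lim\<rho>' that]) simp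
  \<comment> \<open>\<open>\<rho>\<close> has to be evaluated at \<open>shift ?b w\<close>, but it
    is known as a limit of Jacobians only off \<open>N\<close>. The inequality \<open>le'\<close>
    for the indicator of \<open>N\<close>, together with \<open>\<rho>' > 0\<close>, shows that
    almost every \<open>w\<close> is mapped outside \<open>N\<close>.\<close>
  obtain N where N: "{w \<in> space \<mu>. \<not> (\<lambda>j. pjac a (r j) w) \<longlonglongrightarrow> \<rho> w} \<subseteq> N" "N \<in> sets \<mu>" "emeasure \<mu> N = 0"
    using lim\<rho> by (elim AE_E)
  have [measurable]: "N \<in> sets borel" using N(2) sets_\<mu> by simp
  have "(\<integral>\<^sup>+w. indicator N (shift ?b w) * ennreal (\<rho>' w) \<partial>\<mu>) = 0"
    using le'[of "indicator N"] N(2,3) by simp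
  then have "AE w in \<mu>. indicator N (shift ?b w) * ennreal (\<rho>' w) = 0"
    by (subst (asm) nn_integral_0_iff_AE) measurable
  then have "AE w in \<mu>. shift ?b w \<notin> N"
  proof eventually_elim
    case (elim w)
    then show ?case using \<rho>'_pos[of w] by (auto simp: indicator_def ennreal_eq_0_iff split: if_splits)
  qed
  then have inv: "AE w in \<mu>. \<rho> (shift ?b w) * \<rho>' w = 1 \<and> w \<in> shift_dom a"
    using dom lim\<rho>'
  proof eventually_elim
    case (elim w)
    have "(\<lambda>j. pjac a (r j) (shift ?b w)) \<longlonglongrightarrow> \<rho> (shift ?b w)" using N(1) elim(1) by auto
    then have "(\<lambda>j. pjac a (r j) (shift ?b w) * pjac ?b (r j) w) \<longlonglongrightarrow> \<rho> (shift ?b w) * \<rho>' w"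
      using elim(3) by (rule tendsto_mult)
    then show ?case using elim(2) by (simp add: pjac_inverse[OF nz sq] LIMSEQ_const_iff)
  qed
  \<comment> \<open>The inequality for the inverse map is used with the integrand
    \<open>h (shift a w) * \<rho> w\<close>: composed with the inverse, the two densities cancel and
    \<open>h\<close> remains.\<close>
  have "(\<integral>\<^sup>+w. h w \<partial>\<mu>) = (\<integral>\<^sup>+w. (\<lambda>w. h (shift a w) * ennreal (\<rho> w)) (shift ?b w) * ennreal (\<rho>' w) \<partial>\<mu>)"
  proof (rule nn_integral_cong_AE)
    show "AE w in \<mu>. h w = h (shift a (shift ?b w)) * ennreal (\<rho> (shift ?b w)) * ennreal (\<rho>' w)"
      using inv
    proof eventually_elim
      case (elim w)
      have "ennreal (\<rho> (shift ?b w)) * ennreal (\<rho>' w) = 1"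
        using elim \<rho>_nonneg \<rho>'_pos[of w] by (simp add: ennreal_mult[symmetric] less_imp_le)
      then show ?case using elim by (simp add: shift_shift_inv[OF nz sq] mult.assoc)
    qed
  qed
  also have "\<dots> \<le> (\<integral>\<^sup>+w. h (shift a w) * ennreal (\<rho> w) \<partial>\<mu>)"
    by (rule le') measurable
  finally show ?thesis using le[OF h] unfolding \<rho>_def by (intro antisym)
qed

subsection \<open>Second order chaos\<close>

text \<open>Polarization reduces the mixed moment to fourth powers of
  \<open>\<xi> m + \<xi> n\<close> and \<open>\<xi> m - \<xi> n\<close>. For
  \<open>m \<noteq> n\<close> these are Gaussian of variance 2, with fourth moment 3 * 4 = 12, and
  the mixed moment is (12 + 12 - 6 - 6) / 12 = 1; on the diagonal it is 3.\<close>

lemma \<xi>_square_covariance: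
  "integrable \<mu> (\<lambda>w. ((\<xi> m w)\<^sup>2 - 1) * ((\<xi> n w)\<^sup>2 - 1))"
  "(\<integral>w. ((\<xi> m w)\<^sup>2 - 1) * ((\<xi> n w)\<^sup>2 - 1) \<partial>\<mu>) = (if m = n then 2 else 0)"
proof -
  have expand: "((\<xi> m w)\<^sup>2 - 1) * ((\<xi> n w)\<^sup>2 - 1) = (\<xi> m w)\<^sup>2 * (\<xi> n w)\<^sup>2 - (\<xi> m w)\<^sup>2 - (\<xi> n w)\<^sup>2 + 1" for w
    by (simp add: algebra_simps)
  have prod: "integrable \<mu> (\<lambda>w. (\<xi> m w)\<^sup>2 * (\<xi> n w)\<^sup>2) \<and>
      (\<integral>w. (\<xi> m w)\<^sup>2 * (\<xi> n w)\<^sup>2 \<partial>\<mu>) = (if m = n then 3 else 1)"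
  proof (cases "m = n")
    case True
    have "x\<^sup>2 * x\<^sup>2 = x^4" for x :: real by (simp flip: power_add)
    then show ?thesis using \<xi>_moments(3,4)[of n] True by simp
  next
    case False
    let ?p = "\<lambda>w. \<xi> m w + \<xi> n w" and ?q = "\<lambda>w. \<xi> m w - \<xi> n w"
    have n2: "(norm (e m + e n))\<^sup>2 = 2" "(norm (e m - e n))\<^sup>2 = 2"
      using False by (simp_all add: power2_norm_eq_inner inner_add_left inner_add_right
          inner_diff_left inner_diff_right inner_e)
    have n4: "norm (e m + e n) ^ 4 = 4" "norm (e m - e n) ^ 4 = 4"
      using n2 power_mult[of "norm (e m + e n)" 2 2] power_mult[of "norm (e m - e n)" 2 2] by simp_all
    note p = dual_moments(3,4)[OF continuous_dual_add[OF \<xi>_dual \<xi>_dual], of m n "e m + e n"]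
    note q = dual_moments(3,4)[OF continuous_dual_diff[OF \<xi>_dual \<xi>_dual], of m n "e m - e n"]
    have p': "integrable \<mu> (\<lambda>w. (?p w)^4)" "(\<integral>w. (?p w)^4 \<partial>\<mu>) = 12"
      and q': "integrable \<mu> (\<lambda>w. (?q w)^4)" "(\<integral>w. (?q w)^4 \<partial>\<mu>) = 12"
      using p q by (simp_all add: \<xi>_\<iota> inner_add_left inner_diff_left n4)
    have eq: "(\<xi> m w)\<^sup>2 * (\<xi> n w)\<^sup>2 = ((?p w)^4 + (?q w)^4 - 2 * (\<xi> m w)^4 - 2 * (\<xi> n w)^4) / 12" for w
      by (simp add: power4_eq_xxxx power2_eq_square algebra_simps)
    show ?thesis
      unfolding eq using p' q' \<xi>_moments(3,4)[of m] \<xi>_moments(3,4)[of n] False by simp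
  qed
  show "integrable \<mu> (\<lambda>w. ((\<xi> m w)\<^sup>2 - 1) * ((\<xi> n w)\<^sup>2 - 1))"
    unfolding expand using prod \<xi>_moments(1)[of m] \<xi>_moments(1)[of n] by simp
  show "(\<integral>w. ((\<xi> m w)\<^sup>2 - 1) * ((\<xi> n w)\<^sup>2 - 1) \<partial>\<mu>) = (if m = n then 2 else 0)"
    unfolding expand using prod \<xi>_moments(1,2)[of m] \<xi>_moments(1,2)[of n]
    by (simp add: prob_space[simplified])
qed

lemma chaos_second_moment:
  assumes "finite F"
  shows "integrable \<mu> (\<lambda>w. (\<Sum>n\<in>F. a n * ((\<xi> n w)\<^sup>2 - 1))\<^sup>2)"
    "(\<integral>w. (\<Sum>n\<in>F. a n * ((\<xi> n w)\<^sup>2 - 1))\<^sup>2 \<partial>\<mu>) = 2 * (\<Sum>n\<in>F. (a n)\<^sup>2)"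
proof -
  have expand: "(\<Sum>n\<in>F. a n * ((\<xi> n w)\<^sup>2 - 1))\<^sup>2 =
      (\<Sum>m\<in>F. \<Sum>n\<in>F. (a m * a n) * (((\<xi> m w)\<^sup>2 - 1) * ((\<xi> n w)\<^sup>2 - 1)))" for w
    unfolding power2_eq_square[of "sum _ _"] sum_product by (simp add: mult_ac)
  show "integrable \<mu> (\<lambda>w. (\<Sum>n\<in>F. a n * ((\<xi> n w)\<^sup>2 - 1))\<^sup>2)"
    unfolding expand
    by (intro Bochner_Integration.integrable_sum integrable_mult_right \<xi>_square_covariance(1))
  have "(\<integral>w. (\<Sum>n\<in>F. a n * ((\<xi> n w)\<^sup>2 - 1))\<^sup>2 \<partial>\<mu>) =
      (\<Sum>m\<in>F. \<Sum>n\<in>F. (a m * a n) * (if m = n then 2 else 0))"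
    unfolding expand
    by (simp add: Bochner_Integration.integral_sum integrable_mult_right \<xi>_square_covariance del: integral_mult_right_zero)
  also have "\<dots> = 2 * (\<Sum>n\<in>F. (a n)\<^sup>2)"
    using assms by (simp add: if_distrib[of "\<lambda>x. _ * x"] sum_distrib_left power2_eq_square mult_ac cong: if_cong)
  finally show "(\<integral>w. (\<Sum>n\<in>F. a n * ((\<xi> n w)\<^sup>2 - 1))\<^sup>2 \<partial>\<mu>) = 2 * (\<Sum>n\<in>F. (a n)\<^sup>2)" .
qed

text \<open>\<open>\<delta>\<close> enters only through its mean square distance to partial sums
  with index at least \<open>M\<close>, which is at most 1. Two such partial sums then differ by at
  most 4 in mean square, and this difference equals
  \<open>2 * (\<Sum>n=M..<N. (a n)\<^sup>2)\<close>. Convergence of the squared errors in L^1 yields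
  the almost sure subsequence.\<close>

lemma chaos_L2_limit:
  assumes \<delta>: "\<delta> \<in> borel_measurable \<mu>"
    and lim: "(\<lambda>N. \<integral>\<^sup>+w. ennreal (((\<Sum>n<N. a n * ((\<xi> n w)\<^sup>2 - 1)) - \<delta> w)\<^sup>2) \<partial>\<mu>) \<longlonglongrightarrow> 0"
  shows "summable (\<lambda>n. (a n)\<^sup>2)"
    and "\<exists>r :: nat \<Rightarrow> nat. strict_mono r \<and> (AE w in \<mu>. (\<lambda>j. \<Sum>n<r j. a n * ((\<xi> n w)\<^sup>2 - 1)) \<longlonglongrightarrow> \<delta> w)"
proof -
  have [measurable]: "\<xi> n \<in> borel_measurable \<mu>" for n by (simp add: measurable_\<mu>)
  note [measurable] = \<delta>
  let ?S = "\<lambda>N w. \<Sum>n<N. a n * ((\<xi> n w)\<^sup>2 - 1)"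
  have "\<forall>\<^sub>F N in sequentially. (\<integral>\<^sup>+w. ennreal ((?S N w - \<delta> w)\<^sup>2) \<partial>\<mu>) < 1"
    using lim by (rule order_tendstoD) simp
  then obtain M where M: "\<And>N. N \<ge> M \<Longrightarrow> (\<integral>\<^sup>+w. ennreal ((?S N w - \<delta> w)\<^sup>2) \<partial>\<mu>) < 1"
    by (auto simp: eventually_sequentially)
  have int: "integrable \<mu> (\<lambda>w. (?S N w - \<delta> w)\<^sup>2)" if "N \<ge> M" for N
  proof (rule integrableI_nonneg)
    show "(\<integral>\<^sup>+w. ennreal ((?S N w - \<delta> w)\<^sup>2) \<partial>\<mu>) < \<infinity>"
      using less_trans[OF M[OF that], of "\<infinity>"] by simp
  qed auto
  have val: "ennreal (\<integral>w. (?S N w - \<delta> w)\<^sup>2 \<partial>\<mu>) = (\<integral>\<^sup>+w. ennreal ((?S N w - \<delta> w)\<^sup>2) \<partial>\<mu>)"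
    if "N \<ge> M" for N
    using int[OF that] by (intro nn_integral_eq_integral[symmetric]) auto
  have val_le: "(\<integral>w. (?S N w - \<delta> w)\<^sup>2 \<partial>\<mu>) \<le> 1" if "N \<ge> M" for N
    using M[OF that] unfolding val[OF that, symmetric] by (simp add: ennreal_less_one_iff)
  have tail: "(\<Sum>n=M..<N. (a n)\<^sup>2) \<le> 2" if "N \<ge> M" for N
  proof -
    have diff: "?S N w - ?S M w = (\<Sum>n=M..<N. a n * ((\<xi> n w)\<^sup>2 - 1))" for w
      using sum.atLeastLessThan_concat[of 0 M N "\<lambda>n. a n * ((\<xi> n w)\<^sup>2 - 1)"] that
      unfolding atLeast0LessThan by linarith
    have "2 * (\<Sum>n=M..<N. (a n)\<^sup>2) = (\<integral>w. (?S N w - ?S M w)\<^sup>2 \<partial>\<mu>)"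
      unfolding diff by (rule chaos_second_moment(2)[symmetric]) simp
    also have "\<dots> \<le> (\<integral>w. 2 * (?S N w - \<delta> w)\<^sup>2 + 2 * (?S M w - \<delta> w)\<^sup>2 \<partial>\<mu>)"
    proof (rule integral_mono)
      show "integrable \<mu> (\<lambda>w. (?S N w - ?S M w)\<^sup>2)"
        unfolding diff by (rule chaos_second_moment(1)) simp
      show "integrable \<mu> (\<lambda>w. 2 * (?S N w - \<delta> w)\<^sup>2 + 2 * (?S M w - \<delta> w)\<^sup>2)"
        using int that by simp
      have "(x - y)\<^sup>2 \<le> 2 * (x - z)\<^sup>2 + 2 * (y - z)\<^sup>2" for x y z :: real
      proof -
        have "2 * (x - z)\<^sup>2 + 2 * (y - z)\<^sup>2 - (x - y)\<^sup>2 = (x + y - 2 * z)\<^sup>2"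
          by (simp add: power2_eq_square algebra_simps)
        then show ?thesis using zero_le_power2[of "x + y - 2 * z"] by linarith
      qed
      then show "(?S N w - ?S M w)\<^sup>2 \<le> 2 * (?S N w - \<delta> w)\<^sup>2 + 2 * (?S M w - \<delta> w)\<^sup>2" for w .
    qed
    also have "\<dots> \<le> 4"
      using int that val_le[of N] val_le[of M] by simp
    finally show ?thesis by simp
  qed
  show "summable (\<lambda>n. (a n)\<^sup>2)"
  proof (rule summableI_nonneg_bounded)
    show "(\<Sum>n<N. (a n)\<^sup>2) \<le> (\<Sum>n<M. (a n)\<^sup>2) + 2" for N
    proof (cases "N \<ge> M")
      case True
      have "(\<Sum>n<N. (a n)\<^sup>2) = (\<Sum>n<M. (a n)\<^sup>2) + (\<Sum>n=M..<N. (a n)\<^sup>2)"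
        using True by (subst sum.union_disjoint[symmetric]) (auto intro!: sum.cong)
      then show ?thesis using tail[OF True] by simp
    next
      case False
      then have "(\<Sum>n<N. (a n)\<^sup>2) \<le> (\<Sum>n<M. (a n)\<^sup>2)" by (intro sum_mono2) auto
      then show ?thesis by simp
    qed
  qed simp
  \<comment> \<open>The squared errors are known to be integrable only from \<open>M\<close> on,
    hence the shifted index.\<close>
  have "\<exists>r :: nat \<Rightarrow> nat. strict_mono r \<and> (AE w in \<mu>. (\<lambda>j. (?S (r j + M) w - \<delta> w)\<^sup>2) \<longlonglongrightarrow> 0)"
  proof (rule tendsto_L1_AE_subseq)
    show "integrable \<mu> (\<lambda>w. (?S (j + M) w - \<delta> w)\<^sup>2)" for j by (rule int) simp
    have "(\<lambda>j. \<integral>\<^sup>+w. ennreal ((?S (j + M) w - \<delta> w)\<^sup>2) \<partial>\<mu>) \<longlonglongrightarrow> 0"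
      using LIMSEQ_ignore_initial_segment[OF lim, of M] .
    then have "(\<lambda>j. ennreal (\<integral>w. (?S (j + M) w - \<delta> w)\<^sup>2 \<partial>\<mu>)) \<longlonglongrightarrow> ennreal 0"
      unfolding val[OF le_add2] by simp
    then have "(\<lambda>j. \<integral>w. (?S (j + M) w - \<delta> w)\<^sup>2 \<partial>\<mu>) \<longlonglongrightarrow> 0"
      by (rule tendsto_ennrealD) auto
    then show "(\<lambda>j. \<integral>w. norm ((?S (j + M) w - \<delta> w)\<^sup>2) \<partial>\<mu>) \<longlonglongrightarrow> 0"
      by simp
  qed
  then obtain r :: "nat \<Rightarrow> nat" where r: "strict_mono r"
    "AE w in \<mu>. (\<lambda>j. (?S (r j + M) w - \<delta> w)\<^sup>2) \<longlonglongrightarrow> 0" by blast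
  have "strict_mono (\<lambda>j. r j + M)" using r(1) by (simp add: strict_mono_def)
  moreover have "AE w in \<mu>. (\<lambda>j. ?S (r j + M) w) \<longlonglongrightarrow> \<delta> w"
    using r(2)
  proof eventually_elim
    case (elim w)
    then have "(\<lambda>j. sqrt ((?S (r j + M) w - \<delta> w)\<^sup>2)) \<longlonglongrightarrow> sqrt 0" by (rule tendsto_real_sqrt)
    then have "(\<lambda>j. ?S (r j + M) w - \<delta> w) \<longlonglongrightarrow> 0" by (simp add: tendsto_rabs_zero_iff)
    then show ?case by (simp add: LIM_zero_iff)
  qed
  ultimately show "\<exists>r :: nat \<Rightarrow> nat. strict_mono r \<and> (AE w in \<mu>. (\<lambda>j. ?S (r j) w) \<longlonglongrightarrow> \<delta> w)"
    by (intro exI[of _ "\<lambda>j. r j + M"]) simp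
qed

end

section \<open>Measurability of the jumps\<close>

text \<open>The argument is the first point after \<open>s\<close> of the grid with mesh
  \<open>1 / Suc k\<close>. The added 1 puts it strictly to the right even if \<open>s\<close> lies
  on the grid, as convergence along \<open>at_right\<close> demands. Only countably many times
  occur.\<close>

lemma cadlag_tendsto_right:
  assumes "cadlag x" "0 \<le> s"
  shows "(\<lambda>k. x (real (nat \<lfloor>s * real (Suc k)\<rfloor> + 1) / real (Suc k))) \<longlonglongrightarrow> x s"
proof -
  let ?r = "\<lambda>k. real (nat \<lfloor>s * real (Suc k)\<rfloor> + 1) / real (Suc k)"
  have gt: "s < ?r k" and le: "?r k \<le> s + 1 / real (Suc k)" for k
  proof -
    have f: "real (nat \<lfloor>s * real (Suc k)\<rfloor>) = of_int \<lfloor>s * real (Suc k)\<rfloor>" using assms(2) by simp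
    have "s * real (Suc k) < real (nat \<lfloor>s * real (Suc k)\<rfloor> + 1)" unfolding of_nat_add f by linarith
    then show "s < ?r k" by (simp add: pos_less_divide_eq del: of_nat_Suc)
    have "real (nat \<lfloor>s * real (Suc k)\<rfloor> + 1) \<le> s * real (Suc k) + 1" unfolding of_nat_add f by linarith
    then have "?r k \<le> (s * real (Suc k) + 1) / real (Suc k)" by (intro divide_right_mono) auto
    also have "\<dots> = s + 1 / real (Suc k)" by (simp add: add_divide_distrib del: of_nat_Suc)
    finally show "?r k \<le> s + 1 / real (Suc k)" .
  qed
  have "(\<lambda>k. s + 1 / real (Suc k)) \<longlonglongrightarrow> s + 0"
    by (intro tendsto_add tendsto_const LIMSEQ_Suc[OF lim_1_over_n])
  then have "?r \<longlonglongrightarrow> s"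
    by (intro tendsto_sandwich[of "\<lambda>_. s" ?r sequentially "\<lambda>k. s + 1 / real (Suc k)"])
       (use le less_imp_le[OF gt] in \<open>simp_all del: of_nat_Suc\<close>)
  then have "filterlim ?r (at_right s) sequentially"
    using gt by (simp add: filterlim_at less_imp_neq[symmetric] del: of_nat_Suc)
  moreover have "(x \<longlongrightarrow> x s) (at_right s)" using assms by (simp add: cadlag_def)
  ultimately show ?thesis by (rule filterlim_compose[rotated])
qed

text \<open>In the mirror image the ceiling minus 1 gives a grid point strictly to the left of
  \<open>s\<close>; for \<open>s > 0\<close> it is still nonnegative, so the process is measurable
  there.\<close>

lemma cadlag_tendsto_left:
  assumes "cadlag x" "0 < s"
  shows "(\<lambda>k. x (real (nat \<lceil>s * real (Suc k)\<rceil> - 1) / real (Suc k))) \<longlonglongrightarrow> Lim (at_left s) x"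
proof -
  let ?r = "\<lambda>k. real (nat \<lceil>s * real (Suc k)\<rceil> - 1) / real (Suc k)"
  have lt: "?r k < s" and ge: "s - 1 / real (Suc k) \<le> ?r k" for k
  proof -
    have p: "0 < s * real (Suc k)" using assms(2) by simp
    then have one: "1 \<le> \<lceil>s * real (Suc k)\<rceil>" by linarith
    have "real (nat i - 1) = of_int i - 1" if "1 \<le> i" for i :: int
      using that by (simp add: of_nat_diff le_nat_iff)
    from this[OF one] have f: "real (nat \<lceil>s * real (Suc k)\<rceil> - 1) = of_int \<lceil>s * real (Suc k)\<rceil> - 1" .
    have "real (nat \<lceil>s * real (Suc k)\<rceil> - 1) < s * real (Suc k)" unfolding f by linarith
    then show "?r k < s" by (simp add: pos_divide_less_eq del: of_nat_Suc)
    have "s - 1 / real (Suc k) = (s * real (Suc k) - 1) / real (Suc k)"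
      by (simp add: diff_divide_distrib del: of_nat_Suc)
    also have "\<dots> \<le> ?r k" unfolding f by (intro divide_right_mono) linarith+
    finally show "s - 1 / real (Suc k) \<le> ?r k" .
  qed
  have "(\<lambda>k. s - 1 / real (Suc k)) \<longlonglongrightarrow> s - 0"
    by (intro tendsto_diff tendsto_const LIMSEQ_Suc[OF lim_1_over_n])
  then have "?r \<longlonglongrightarrow> s"
    by (intro tendsto_sandwich[of "\<lambda>k. s - 1 / real (Suc k)" ?r sequentially "\<lambda>_. s"])
       (use ge less_imp_le[OF lt] in \<open>simp_all del: of_nat_Suc\<close>)
  then have r: "filterlim ?r (at_left s) sequentially"
    using lt by (simp add: filterlim_at less_imp_neq del: of_nat_Suc)
  obtain l where l: "(x \<longlongrightarrow> l) (at_left s)" using assms by (auto simp: cadlag_def)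
  then have "Lim (at_left s) x = l" by (intro tendsto_Lim) auto
  then show ?thesis using filterlim_compose[OF l r] by simp
qed

text \<open>Evaluation at a random time is measurable when the time takes countably many values. The
  grid times on both sides of \<open>S z\<close> are of this kind, and cadlag paths turn the
  differences into the jump in the limit.\<close>

lemma measurable_jump_at_random_time:
  assumes Z: "\<And>s. 0 \<le> s \<Longrightarrow> Z s \<in> borel_measurable P"
    and cadlag: "\<And>z. z \<in> space P \<Longrightarrow> cadlag (\<lambda>s. Z s z)"
    and S [measurable]: "S \<in> borel_measurable P" and S_nonneg: "\<And>z. 0 \<le> S z"
  shows "(\<lambda>z. jump (\<lambda>s. Z s z) (S z)) \<in> borel_measurable P"
proof (rule borel_measurable_LIMSEQ_real)
  have Zc: "(\<lambda>z. Z (real (g z) / real (Suc k)) z) \<in> borel_measurable P"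
    if "g \<in> P \<rightarrow>\<^sub>M count_space UNIV" for g :: "_ \<Rightarrow> nat" and k
    by (rule measurable_compose_countable[where f="\<lambda>i z. Z (real i / real (Suc k)) z", OF Z that]) simp
  have [measurable]: "(\<lambda>z. nat \<lfloor>S z * real (Suc k)\<rfloor> + 1) \<in> P \<rightarrow>\<^sub>M count_space UNIV"
    "(\<lambda>z. nat \<lceil>S z * real (Suc k)\<rceil> - 1) \<in> P \<rightarrow>\<^sub>M count_space UNIV" for k
    by measurable
  note [measurable] = Zc[of "\<lambda>z. nat \<lfloor>S z * real (Suc k)\<rfloor> + 1" k for k]
    Zc[of "\<lambda>z. nat \<lceil>S z * real (Suc k)\<rceil> - 1" k for k]
  show "(\<lambda>z. if S z \<le> 0 then 0 else Z (real (nat \<lfloor>S z * real (Suc k)\<rfloor> + 1) / real (Suc k)) z -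
      Z (real (nat \<lceil>S z * real (Suc k)\<rceil> - 1) / real (Suc k)) z) \<in> borel_measurable P" for k
    by (intro measurable_If borel_measurable_diff Zc) measurable
  fix z assume z: "z \<in> space P"
  show "(\<lambda>k. if S z \<le> 0 then 0 else Z (real (nat \<lfloor>S z * real (Suc k)\<rfloor> + 1) / real (Suc k)) z -
      Z (real (nat \<lceil>S z * real (Suc k)\<rceil> - 1) / real (Suc k)) z) \<longlonglongrightarrow> jump (\<lambda>s. Z s z) (S z)"
  proof (cases "S z \<le> 0")
    case False
    then show ?thesis
      using cadlag_tendsto_right[OF cadlag[OF z] S_nonneg[of z]] cadlag_tendsto_left[OF cadlag[OF z], of "S z"]
      by (auto simp: jump_def intro!: tendsto_diff simp del: of_nat_Suc of_nat_add)
  qed (simp add: jump_def)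
qed

section \<open>Unordered products\<close>

text \<open>If a finite set \<open>X\<close> controls the products over subsets of \<open>S\<close>,
  then \<open>X \<inter> T\<close> controls those over subsets of \<open>T\<close>: a finite
  \<open>Y\<close> between \<open>X \<inter> T\<close> and \<open>T\<close> has the same product as
  \<open>(Y \<inter> S) \<union> X\<close>.\<close>

lemma tendsto_prod_cong_neutral:
  fixes f g :: "'a \<Rightarrow> real"
  assumes T: "\<And>x. x \<in> T - S \<Longrightarrow> g x = 1" and S: "\<And>x. x \<in> S - T \<Longrightarrow> f x = 1"
    and eq: "\<And>x. x \<in> S \<inter> T \<Longrightarrow> f x = g x"
    and lim: "(prod f \<longlongrightarrow> D) (finite_subsets_at_top S)"
  shows "(prod g \<longlongrightarrow> D) (finite_subsets_at_top T)"
proof (rule topological_tendstoI)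
  fix G :: "real set" assume "open G" "D \<in> G"
  then have "\<forall>\<^sub>F X in finite_subsets_at_top S. prod f X \<in> G" by (rule topological_tendstoD[OF lim])
  then obtain X where X': "finite X \<and> X \<subseteq> S \<and> (\<forall>Y. finite Y \<and> X \<subseteq> Y \<and> Y \<subseteq> S \<longrightarrow> prod f Y \<in> G)"
    unfolding eventually_finite_subsets_at_top by (rule exE)
  then have X: "finite X" "X \<subseteq> S" by simp_all
  have XG: "prod f Y \<in> G" if "finite Y" "X \<subseteq> Y" "Y \<subseteq> S" for Y
    using X' that by simp
  have "prod g Y \<in> G" if Y: "finite Y" "X \<inter> T \<subseteq> Y" "Y \<subseteq> T" for Y
  proof -
    have "prod g Y = prod f ((Y \<inter> S) \<union> X)"
    proof (rule prod.mono_neutral_cong)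
      show "finite Y" "finite ((Y \<inter> S) \<union> X)" using Y(1) X(1) by simp_all
      show "f i = 1" if "i \<in> Y \<inter> S \<union> X - Y" for i
        by (rule S) (use that X(2) Y(2) in blast)
      show "g i = 1" if "i \<in> Y - (Y \<inter> S \<union> X)" for i
        by (rule T) (use that Y(3) in blast)
      show "g x = f x" if "x \<in> Y \<inter> (Y \<inter> S \<union> X)" for x
        by (rule eq[symmetric]) (use that Y(3) X(2) in blast)
    qed
    also have "\<dots> \<in> G" by (rule XG) (use X Y(1) in auto)
    finally show ?thesis .
  qed
  then have "finite (X \<inter> T) \<and> X \<inter> T \<subseteq> T \<and>
      (\<forall>Y. finite Y \<and> X \<inter> T \<subseteq> Y \<and> Y \<subseteq> T \<longrightarrow> prod g Y \<in> G)"
    using X(1) by simp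
  then show "\<forall>\<^sub>F Y in finite_subsets_at_top T. prod g Y \<in> G"
    unfolding eventually_finite_subsets_at_top by (rule exI)
qed

lemma tendsto_prod_reindex:
  fixes f :: "'a \<Rightarrow> real"
  assumes "inj_on \<tau> I" "(prod (\<lambda>n. f (\<tau> n)) \<longlongrightarrow> D) (finite_subsets_at_top I)"
  shows "(prod f \<longlongrightarrow> D) (finite_subsets_at_top (\<tau> ` I))"
proof -
  have "((\<lambda>X. prod f (\<tau> ` X)) \<longlongrightarrow> D) (finite_subsets_at_top I)"
  proof (rule Lim_transform_eventually[OF assms(2)])
    show "\<forall>\<^sub>F X in finite_subsets_at_top I. (\<Prod>n\<in>X. f (\<tau> n)) = prod f (\<tau> ` X)"
      by (rule eventually_finite_subsets_at_top_weakI)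
         (simp add: prod.reindex[OF inj_on_subset[OF assms(1)]] o_def)
  qed
  then show ?thesis
    unfolding filtermap_image_finite_subsets_at_top[OF assms(1), symmetric]
    by (simp add: filterlim_filtermap)
qed

lemma infprod_eqI: "(prod f \<longlongrightarrow> D) (finite_subsets_at_top A) \<Longrightarrow> infprod f A = D"
  unfolding infprod_def by (rule tendsto_Lim) simp_all

section \<open>The random shift\<close>

locale jump_shift = wiener_basis \<mu> \<iota> e
  for \<mu> :: "'w::separable_frechet_space measure" and \<iota> :: "'h::{real_inner, complete_space} \<Rightarrow> 'w"
    and e :: "nat \<Rightarrow> 'h" +
  fixes P :: "'o measure"
    and F :: "real \<Rightarrow> 'o measure"
    and Z :: "real \<Rightarrow> 'o \<Rightarrow> real"
    and T :: "nat \<Rightarrow> 'o \<Rightarrow> ennreal"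
    and t :: real
    and \<delta>u :: "'o \<Rightarrow> 'w \<Rightarrow> real"
  assumes filt: "usual_filtered_prob_space P F"
    and semi: "semimartingale P F Z"
    and exhaust: "exhausts_jumps P F Z T"
    and t_nonneg: "0 \<le> t"
    and version: "divergence_version \<iota> e Z T t \<mu> P \<delta>u"
begin

lemma prob_space_P: "prob_space P"
  using filt by (simp add: usual_filtered_prob_space_def)

sublocale PP: prob_space P by (rule prob_space_P)

sublocale WP: pair_prob_space \<mu> P ..

lemma measurable_F: "0 \<le> s \<Longrightarrow> f \<in> F s \<rightarrow>\<^sub>M N \<Longrightarrow> f \<in> P \<rightarrow>\<^sub>M N"
  using filt by (auto simp: usual_filtered_prob_space_def intro: measurable_from_subalg)

lemma measurable_T [measurable]: "T n \<in> borel_measurable P"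
proof (rule borel_measurableI_le)
  fix y :: ennreal
  show "{z \<in> space P. T n z \<le> y} \<in> sets P"
  proof (cases y)
    case (real s)
    have "Measurable.pred (F s) (\<lambda>z. T n z \<le> ennreal s)"
      using exhaust real by (simp add: exhausts_jumps_def stop_time_def)
    then have "Measurable.pred P (\<lambda>z. T n z \<le> ennreal s)" using real by (intro measurable_F)
    then show ?thesis using real by simp
  qed simp
qed

definition coef :: "'o \<Rightarrow> nat \<Rightarrow> real" where
  "coef z n = (if n \<in> jump_idx T t z then jump_at Z T z n else 0)"

lemma measurable_coef [measurable]: "(\<lambda>z. coef z n) \<in> borel_measurable P"
proof -
  have [measurable]: "(\<lambda>z. jump_at Z T z n) \<in> borel_measurable P"
    unfolding jump_at_def
  proof (rule measurable_jump_at_random_time)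
    show "Z s \<in> borel_measurable P" if "0 \<le> s" for s
      using semi that by (auto simp: semimartingale_def adapted_def intro: measurable_F)
    show "cadlag (\<lambda>s. Z s z)" if "z \<in> space P" for z
      using semi that by (simp add: semimartingale_def)
  qed (auto intro: measurable_compose[OF measurable_T])
  show ?thesis unfolding coef_def jump_idx_def by simp measurable
qed

text \<open>Everything at a fixed \<open>z\<close> is derived from these conditions, which hold
  almost surely; square summability of the coefficients follows from the last one by
  \<open>chaos_L2_limit\<close>.\<close>

definition good :: "'o \<Rightarrow> bool" where
  "good z \<longleftrightarrow> z \<in> space P \<and> \<delta>u z \<in> borel_measurable borel \<and>
     (\<lambda>N. \<integral>\<^sup>+w. ennreal (((\<Sum>n<N. coef z n * ((\<xi> n w)\<^sup>2 - 1)) - \<delta>u z w)\<^sup>2) \<partial>\<mu>) \<longlonglongrightarrow> 0"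

lemma measurable_\<delta>u [measurable]: "(\<lambda>p. \<delta>u (snd p) (fst p)) \<in> borel_measurable (\<mu> \<Otimes>\<^sub>M P)"
  using version by (simp add: divergence_version_def case_prod_unfold)

lemma AE_good: "AE z in P. good z"
proof -
  have "AE z in P. (\<lambda>N. \<integral>\<^sup>+w. ennreal (((\<Sum>n\<in>jump_idx T t z \<inter> {..<N}.
          jump_at Z T z n * ((\<xi> n w)\<^sup>2 - 1)) - \<delta>u z w)\<^sup>2) \<partial>\<mu>) \<longlonglongrightarrow> 0"
    using version by (simp add: divergence_version_def)
  then show ?thesis
    using AE_space
  proof eventually_elim
    case (elim z)
    have "(\<Sum>n\<in>jump_idx T t z \<inter> {..<N}. jump_at Z T z n * ((\<xi> n w)\<^sup>2 - 1)) =
        (\<Sum>n<N. coef z n * ((\<xi> n w)\<^sup>2 - 1))" for N w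
      by (rule sum.mono_neutral_cong_left) (auto simp: coef_def)
    moreover have "\<delta>u z \<in> borel_measurable borel"
    proof -
      have "(\<lambda>w. (w, z)) \<in> \<mu> \<rightarrow>\<^sub>M \<mu> \<Otimes>\<^sub>M P" using elim(2) by simp
      from measurable_compose[OF this measurable_\<delta>u] show ?thesis by (simp add: measurable_\<mu>)
    qed
    ultimately show ?case using elim by (simp add: good_def)
  qed
qed

lemma W_dom_eq: "W_dom \<iota> e Z T t z = shift_dom (coef z)"
proof -
  have "(\<lambda>n. (jump_at Z T z n)\<^sup>2 * (\<xi> n w)\<^sup>2) summable_on jump_idx T t z \<longleftrightarrow>
      (\<lambda>n. (coef z n)\<^sup>2 * (\<xi> n w)\<^sup>2) summable_on UNIV" for w
    by (rule summable_on_cong_neutral) (auto simp: coef_def)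
  then show ?thesis
    unfolding W_dom_def shift_dom_def by (simp add: summable_on_UNIV_nonneg_real_iff)
qed

lemma u_field_eq: "u_field \<iota> e Z T t z w = ortho_series (\<lambda>n. coef z n * \<xi> n w)"
  unfolding u_field_def ortho_series_def
  by (rule infsum_cong_neutral) (auto simp: coef_def)

lemma U_map_eq: "w \<in> shift_dom (coef z) \<Longrightarrow> U_map \<iota> e Z T t z w = shift (coef z) w"
  by (simp add: U_map_def shift_def u_field_eq)

lemma U_fibre_eq: "U_fibre \<iota> e Z T t z w = {y \<in> shift_dom (coef z). shift (coef z) y = w}"
  unfolding U_fibre_def W_dom_eq using U_map_eq by auto

lemma infsum_eq_suminf_coef:
  assumes "w \<in> shift_dom (coef z)"
  shows "(\<Sum>\<^sub>\<infinity>n\<in>jump_idx T t z. (jump_at Z T z n)\<^sup>2 * (\<xi> n w)\<^sup>2) = (\<Sum>n. (coef z n)\<^sup>2 * (\<xi> n w)\<^sup>2)"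
proof -
  have "(\<Sum>\<^sub>\<infinity>n\<in>jump_idx T t z. (jump_at Z T z n)\<^sup>2 * (\<xi> n w)\<^sup>2) = (\<Sum>\<^sub>\<infinity>n. (coef z n)\<^sup>2 * (\<xi> n w)\<^sup>2)"
    by (rule infsum_cong_neutral) (auto simp: coef_def)
  also have "\<dots> = (\<Sum>n. (coef z n)\<^sup>2 * (\<xi> n w)\<^sup>2)"
  proof -
    have "(\<lambda>n. (coef z n)\<^sup>2 * (\<xi> n w)\<^sup>2) summable_on UNIV"
      using assms by (simp add: shift_dom_def summable_on_UNIV_nonneg_real_iff)
    from has_sum_imp_sums[OF has_sum_infsum[OF this]] show ?thesis by (rule sums_unique)
  qed
  finally show ?thesis .
qed

text \<open>A jointly measurable stand-in for \<open>Lambda\<close>: sequential limits and series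
  over all \<open>n\<close> replace unordered products and sums over the random index set. The two
  agree for good \<open>z\<close> on the domain of the shift.\<close>

definition dens :: "'o \<Rightarrow> 'w \<Rightarrow> real" where
  "dens z w = lim (\<lambda>N. \<Prod>n<N. (1 + coef z n) * exp (- coef z n)) *
     exp (- \<delta>u z w - (\<Sum>n. (coef z n)\<^sup>2 * (\<xi> n w)\<^sup>2) / 2)"

lemma measurable_dens [measurable]: "(\<lambda>p. dens (snd p) (fst p)) \<in> borel_measurable (\<mu> \<Otimes>\<^sub>M P)"
  unfolding dens_def by measurable

lemma measurable_shift_coef [measurable]:
  "Measurable.pred (\<mu> \<Otimes>\<^sub>M P) (\<lambda>p. fst p \<in> shift_dom (coef (snd p)))"
  "(\<lambda>p. shift (coef (snd p)) (fst p)) \<in> borel_measurable (\<mu> \<Otimes>\<^sub>M P)"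
  "(\<lambda>p. shift (inv_coeff (coef (snd p))) (fst p)) \<in> borel_measurable (\<mu> \<Otimes>\<^sub>M P)"
proof -
  have [measurable]: "(\<lambda>p. fst p) \<in> \<mu> \<Otimes>\<^sub>M P \<rightarrow>\<^sub>M borel" by measurable
  show "Measurable.pred (\<mu> \<Otimes>\<^sub>M P) (\<lambda>p. fst p \<in> shift_dom (coef (snd p)))"
    "(\<lambda>p. shift (coef (snd p)) (fst p)) \<in> borel_measurable (\<mu> \<Otimes>\<^sub>M P)"
    "(\<lambda>p. shift (inv_coeff (coef (snd p))) (fst p)) \<in> borel_measurable (\<mu> \<Otimes>\<^sub>M P)"
    by (intro shift_measurable_param; simp add: inv_coeff_def; measurable)+
qed

lemma nondegeneracy_set_iff:
  "z \<in> space P \<Longrightarrow> z \<in> nondegeneracy_set P Z T t \<longleftrightarrow> (\<forall>n. 1 + coef z n \<noteq> 0)"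
  unfolding nondegeneracy_set_def coef_def by (auto simp: add_eq_0_iff)

section \<open>A fixed good \<open>z\<close>\<close>

context
  fixes z
  assumes good: "good z"
begin

lemma z_space: "z \<in> space P" and \<delta>u_measurable [measurable]: "\<delta>u z \<in> borel_measurable borel"
  using good by (simp_all add: good_def)

lemma sq_coef: "summable (\<lambda>n. (coef z n)\<^sup>2)"
  using chaos_L2_limit(1)[of "\<delta>u z" "coef z"] good by (simp add: good_def measurable_\<mu>)

lemma dom_AE: "AE w in \<mu>. w \<in> shift_dom (coef z)"
  by (rule AE_shift_dom[OF sq_coef])

text \<open>Three index sets carry the same product. Indices outside \<open>jump_idx T t z\<close>
  contribute factors 1, disjointness of the graphs makes the times distinct on it, and a time that
  is not hit carries no jump because the jumps are exhausted.\<close>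

lemma D_prod_limits:
  shows "(\<lambda>N. \<Prod>n<N. (1 + coef z n) * exp (- coef z n)) \<longlonglongrightarrow> D_prod Z t z"
    and "infprod (\<lambda>n. (1 + jump_at Z T z n) * exp (- jump_at Z T z n)) (jump_idx T t z) = D_prod Z t z"
    and "D_prod Z t z = 0 \<longleftrightarrow> \<not> (\<forall>n. 1 + coef z n \<noteq> 0)"
proof -
  let ?I = "jump_idx T t z" and ?\<tau> = "\<lambda>n. enn2real (T n z)"
  let ?f = "\<lambda>s. (1 + jump (\<lambda>r. Z r z) s) * exp (- jump (\<lambda>r. Z r z) s)"
  obtain D where D: "((\<lambda>F. \<Prod>n\<in>F. (1 + coef z n) * exp (- coef z n)) \<longlongrightarrow> D) (finite_subsets_at_top UNIV)"
    "D = 0 \<longleftrightarrow> (\<exists>n. coef z n = -1)"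
    using regularized_product_converges[OF sq_coef] by blast
  have I: "(prod (\<lambda>n. ?f (?\<tau> n)) \<longlongrightarrow> D) (finite_subsets_at_top ?I)"
    by (rule tendsto_prod_cong_neutral[OF _ _ _ D(1)]) (auto simp: coef_def jump_at_def)
  have T_eq: "T n z = ennreal (?\<tau> n)" if "n \<in> ?I" for n
    using that by (simp add: jump_idx_def less_top le_less_trans[OF _ ennreal_less_top])
  have inj: "inj_on ?\<tau> ?I"
  proof (rule inj_onI, rule ccontr)
    fix m n assume mn: "m \<in> ?I" "n \<in> ?I" "?\<tau> m = ?\<tau> n" "m \<noteq> n"
    have "T m z = ennreal (?\<tau> m) \<and> T n z = ennreal (?\<tau> m)"
      using T_eq[OF mn(1)] T_eq[OF mn(2)] mn(3) by simp
    moreover have "0 \<le> ?\<tau> m" by simp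
    ultimately show False
      using exhaust mn(4) z_space unfolding exhausts_jumps_def by blast
  qed
  have "(prod ?f \<longlongrightarrow> D) (finite_subsets_at_top {0..t})"
  proof (rule tendsto_prod_cong_neutral[OF _ _ _ tendsto_prod_reindex[OF inj I]])
    fix s assume s: "s \<in> {0..t} - ?\<tau> ` ?I"
    have "jump (\<lambda>r. Z r z) s = 0"
    proof (rule ccontr)
      assume "jump (\<lambda>r. Z r z) s \<noteq> 0"
      moreover have "0 \<le> s" using s by simp
      ultimately obtain n where n: "T n z = ennreal s"
        using exhaust z_space unfolding exhausts_jumps_def by blast
      then have "n \<in> ?I" using s by (simp add: jump_idx_def ennreal_leI)
      moreover have "?\<tau> n = s" using n s by simp
      ultimately show False using s by blast
    qed
    then show "?f s = 1" by simp
  next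
    fix s assume s: "s \<in> ?\<tau> ` ?I - {0..t}"
    then obtain n where n: "n \<in> ?I" "s = ?\<tau> n" by auto
    then have "ennreal s \<le> ennreal t" using T_eq[OF n(1)] by (simp add: jump_idx_def)
    then have "s \<le> t" using t_nonneg by simp
    then show "?f s = 1" using s n by simp
  qed simp
  then have DD: "D_prod Z t z = D" unfolding D_prod_def by (rule infprod_eqI)
  show "(\<lambda>N. \<Prod>n<N. (1 + coef z n) * exp (- coef z n)) \<longlonglongrightarrow> D_prod Z t z"
    unfolding DD by (rule tendsto_finite_subsets_lessThan[OF D(1)])
  show "infprod (\<lambda>n. (1 + jump_at Z T z n) * exp (- jump_at Z T z n)) ?I = D_prod Z t z"
    unfolding DD using I unfolding jump_at_def by (rule infprod_eqI)
  show "D_prod Z t z = 0 \<longleftrightarrow> \<not> (\<forall>n. 1 + coef z n \<noteq> 0)"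
    unfolding DD D(2) by (auto simp: add_eq_0_iff2 add_eq_0_iff)
qed

abbreviation (input) Lam :: "'w \<Rightarrow> real" where
  "Lam \<equiv> Lambda \<iota> e Z T t \<delta>u z"

lemma Lambda_eq: "Lam w = D_prod Z t z *
    exp (- \<delta>u z w - (1/2) * (\<Sum>\<^sub>\<infinity>n\<in>jump_idx T t z. (jump_at Z T z n)\<^sup>2 * (\<xi> n w)\<^sup>2))"
  unfolding Lambda_def D_prod_limits(2) ..

lemma dens_eq: "dens z w = D_prod Z t z * exp (- \<delta>u z w - (\<Sum>n. (coef z n)\<^sup>2 * (\<xi> n w)\<^sup>2) / 2)"
  unfolding dens_def limI[OF D_prod_limits(1)] ..

lemma Lambda_eq_dens: "w \<in> shift_dom (coef z) \<Longrightarrow> Lam w = dens z w"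
  unfolding Lambda_eq dens_eq by (simp add: infsum_eq_suminf_coef)

lemma sgn_Lambda: "sgn (Lam w) = sgn (D_prod Z t z)"
  unfolding Lambda_eq by (simp add: sgn_mult)

lemma Lambda_measurable: "Lam \<in> borel_measurable \<mu>"
proof -
  \<comment> \<open>Off the domain the unordered sum takes its default value 0, so it is a
    measurable series cut off outside a Borel set.\<close>
  have "(\<Sum>\<^sub>\<infinity>n\<in>jump_idx T t z. (jump_at Z T z n)\<^sup>2 * (\<xi> n w)\<^sup>2) =
      (if w \<in> shift_dom (coef z) then \<Sum>n. (coef z n)\<^sup>2 * (\<xi> n w)\<^sup>2 else 0)" for w
  proof (cases "w \<in> shift_dom (coef z)")
    case False
    then have "\<not> (\<lambda>n. (jump_at Z T z n)\<^sup>2 * (\<xi> n w)\<^sup>2) summable_on jump_idx T t z"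
      unfolding W_dom_eq[symmetric] W_dom_def by simp
    then show ?thesis using False by (simp add: infsum_not_exists)
  qed (simp add: infsum_eq_suminf_coef)
  then have "Lam = (\<lambda>w. D_prod Z t z * exp (- \<delta>u z w - (1/2) *
      (if w \<in> shift_dom (coef z) then \<Sum>n. (coef z n)\<^sup>2 * (\<xi> n w)\<^sup>2 else 0)))"
    by (simp add: fun_eq_iff Lambda_eq)
  then show ?thesis by (simp add: measurable_\<mu>)
qed

lemma dens_change_of_variables:
  assumes nz: "\<forall>n. 1 + coef z n \<noteq> 0" and h: "h \<in> borel_measurable borel"
  shows "(\<integral>\<^sup>+w. h (shift (coef z) w) * ennreal \<bar>dens z w\<bar> \<partial>\<mu>) = (\<integral>\<^sup>+w. h w \<partial>\<mu>)"
proof -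
  obtain r :: "nat \<Rightarrow> nat" where r: "strict_mono r"
    "AE w in \<mu>. (\<lambda>j. \<Sum>n<r j. coef z n * ((\<xi> n w)\<^sup>2 - 1)) \<longlonglongrightarrow> \<delta>u z w"
    using chaos_L2_limit(2)[of "\<delta>u z" "coef z"] good by (auto simp: good_def measurable_\<mu>)
  show ?thesis
    using shift_change_of_variables[OF spec[OF nz] sq_coef r(1) _ r(2) D_prod_limits(1) h]
    by (simp add: dens_eq abs_mult)
qed

lemma Lambda_change_of_variables:
  assumes nz: "\<forall>n. 1 + coef z n \<noteq> 0" and h: "h \<in> borel_measurable borel"
  shows "(\<integral>\<^sup>+w. h (U_map \<iota> e Z T t z w) * ennreal \<bar>Lam w\<bar> \<partial>\<mu>) = (\<integral>\<^sup>+w. h w \<partial>\<mu>)"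
proof -
  have "(\<integral>\<^sup>+w. h (U_map \<iota> e Z T t z w) * ennreal \<bar>Lam w\<bar> \<partial>\<mu>) =
      (\<integral>\<^sup>+w. h (shift (coef z) w) * ennreal \<bar>dens z w\<bar> \<partial>\<mu>)"
    by (rule nn_integral_cong_AE) (use dom_AE in eventually_elim, simp add: U_map_eq Lambda_eq_dens)
  then show ?thesis using dens_change_of_variables[OF assms] by simp
qed

lemma Lambda_degenerate: "\<not> (\<forall>n. 1 + coef z n \<noteq> 0) \<Longrightarrow> Lam w = 0"
  unfolding Lambda_eq using D_prod_limits(3) by simp

lemma Lambda_abs_integral:
  assumes nz: "\<forall>n. 1 + coef z n \<noteq> 0"
  shows "(\<integral>\<^sup>+w. ennreal \<bar>Lam w\<bar> \<partial>\<mu>) = 1"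
  using Lambda_change_of_variables[OF nz, of "\<lambda>_. 1"] by (simp add: emeasure_space_1[simplified])

text \<open>The sign of \<open>Lambda\<close> is that of \<open>D_prod Z t z\<close> at every
  \<open>w\<close>, and its absolute value has integral 1 unless it vanishes identically.\<close>

lemma Lambda_integrable: "integrable \<mu> Lam"
  and Lambda_integral: "(\<integral>w. Lam w \<partial>\<mu>) = sgn (D_prod Z t z)"
proof -
  have "integrable \<mu> Lam \<and> (\<integral>w. Lam w \<partial>\<mu>) = sgn (D_prod Z t z)"
  proof (cases "\<forall>n. 1 + coef z n \<noteq> 0")
    case True
    have int: "integrable \<mu> Lam"
      using Lambda_measurable Lambda_abs_integral[OF True] by (intro integrableI_bounded) auto
    have "(\<integral>w. \<bar>Lam w\<bar> \<partial>\<mu>) = 1"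
      using Lambda_abs_integral[OF True] nn_integral_eq_integral[OF integrable_abs[OF int]]
      by (simp add: ennreal_eq_1)
    moreover have "Lam w = sgn (D_prod Z t z) * \<bar>Lam w\<bar>" for w
      unfolding sgn_Lambda[of w, symmetric] by (simp add: sgn_mult_abs)
    then have "(\<integral>w. Lam w \<partial>\<mu>) = (\<integral>w. sgn (D_prod Z t z) * \<bar>Lam w\<bar> \<partial>\<mu>)" by simp
    ultimately show ?thesis using int by simp
  next
    case False
    then have "Lam = (\<lambda>_. 0)" "D_prod Z t z = 0" using Lambda_degenerate D_prod_limits(3) by auto
    then show ?thesis by simp
  qed
  then show "integrable \<mu> Lam" "(\<integral>w. Lam w \<partial>\<mu>) = sgn (D_prod Z t z)" by auto
qed

text \<open>As the sign is constant in \<open>w\<close>, one of the two parts vanishes and a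
  difference of infinities never occurs. For \<open>D_prod Z t z = 0\<close> both sides are 0, the
  right one also when \<open>f\<close> has infinite integral.\<close>

lemma Lambda_weighted_integral:
  fixes f :: "'w \<Rightarrow> ennreal"
  assumes f: "f \<in> borel_measurable \<mu>"
  shows "weighted_integral_exists \<mu> (\<lambda>w. f (U_map \<iota> e Z T t z w)) Lam \<and>
    weighted_integral \<mu> (\<lambda>w. f (U_map \<iota> e Z T t z w)) Lam =
      enn2ereal (\<integral>\<^sup>+w. f w \<partial>\<mu>) * ereal (\<integral>w. Lam w \<partial>\<mu>)"
proof -
  let ?D = "D_prod Z t z"
  let ?f = "\<lambda>w. f (U_map \<iota> e Z T t z w)"
  have f': "f \<in> borel_measurable borel" using f by (simp add: measurable_\<mu>)
  have cov: "(\<integral>\<^sup>+w. ?f w * ennreal \<bar>Lam w\<bar> \<partial>\<mu>) = (\<integral>\<^sup>+w. f w \<partial>\<mu>)" if "?D \<noteq> 0"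
    using Lambda_change_of_variables[OF _ f'] that D_prod_limits(3) by blast
  have sgn: "sgn (Lam w) = sgn ?D" for w by (rule sgn_Lambda)
  consider "?D = 0" | "?D > 0" | "?D < 0" by linarith
  then show ?thesis
  proof cases
    case 1
    then have "Lam w = 0" for w using sgn[of w] by (simp add: sgn_zero_iff)
    then show ?thesis by (simp add: weighted_integral_exists_def weighted_integral_def)
  next
    case 2
    then have pos: "Lam w > 0" for w using sgn[of w] by (metis sgn_1_pos sgn_pos)
    have "(\<integral>\<^sup>+w. ?f w * ennreal (Lam w) \<partial>\<mu>) = (\<integral>\<^sup>+w. f w \<partial>\<mu>)"
      using cov 2 pos by (simp add: less_imp_le)
    moreover have "(\<integral>\<^sup>+w. ?f w * ennreal (- Lam w) \<partial>\<mu>) = 0"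
      using pos by (simp add: ennreal_neg less_imp_le)
    ultimately show ?thesis
      using 2 by (simp add: weighted_integral_exists_def weighted_integral_def Lambda_integral zero_ennreal.rep_eq flip: one_ereal_def)
  next
    case 3
    then have neg: "Lam w < 0" for w using sgn[of w] by (metis sgn_1_neg sgn_neg)
    have "(\<integral>\<^sup>+w. ?f w * ennreal (- Lam w) \<partial>\<mu>) = (\<integral>\<^sup>+w. f w \<partial>\<mu>)"
      using cov 3 neg by (simp add: less_imp_le)
    moreover have "(\<integral>\<^sup>+w. ?f w * ennreal (Lam w) \<partial>\<mu>) = 0"
      using neg by (simp add: ennreal_neg less_imp_le)
    moreover have "ereal (-1) = - 1" by (simp add: one_ereal_def)
    ultimately show ?thesis
      using 3 by (simp add: weighted_integral_exists_def weighted_integral_def Lambda_integral zero_ennreal.rep_eq)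
  qed
qed

lemma fibre_singleton:
  assumes nz: "\<forall>n. 1 + coef z n \<noteq> 0" and w: "w \<in> shift_dom (coef z)"
  shows "U_fibre \<iota> e Z T t z w = {shift (inv_coeff (coef z)) w}"
  unfolding U_fibre_eq shift_fibre[OF spec[OF nz] sq_coef] using w by simp

lemma fibre_empty:
  assumes deg: "\<not> (\<forall>n. 1 + coef z n \<noteq> 0)" and w: "\<forall>n. \<xi> n w \<noteq> 0"
  shows "U_fibre \<iota> e Z T t z w = {}"
proof -
  obtain n where n: "1 + coef z n = 0" using deg by blast
  have "shift (coef z) y \<noteq> w" if "y \<in> shift_dom (coef z)" for y
    using \<xi>_shift[OF that, of n] n w by auto
  then show ?thesis unfolding U_fibre_eq by auto
qed

lemma fibre_sign_sum:
  assumes w: "w \<in> shift_dom (coef z)"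
  shows "ereal (\<integral>w'. Lam w' \<partial>\<mu>) = (\<Sum>\<^sub>\<infinity>y\<in>U_fibre \<iota> e Z T t z w. ereal (sgn (Lam y)))"
    "(\<Sum>\<^sub>\<infinity>y\<in>U_fibre \<iota> e Z T t z w. ereal (sgn (Lam y))) =
      ext_card (U_fibre \<iota> e Z T t z w) * ereal (sgn (D_prod Z t z))"
proof -
  have "ereal (\<integral>w'. Lam w' \<partial>\<mu>) = (\<Sum>\<^sub>\<infinity>y\<in>U_fibre \<iota> e Z T t z w. ereal (sgn (Lam y))) \<and>
    (\<Sum>\<^sub>\<infinity>y\<in>U_fibre \<iota> e Z T t z w. ereal (sgn (Lam y))) =
      ext_card (U_fibre \<iota> e Z T t z w) * ereal (sgn (D_prod Z t z))"
  proof (cases "\<forall>n. 1 + coef z n \<noteq> 0")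
    case True
    then show ?thesis
      by (simp add: fibre_singleton[OF True w] Lambda_integral sgn_Lambda ext_card_def one_ennreal.rep_eq)
  next
    case False
    \<comment> \<open>Every sign is 0 here, and the identities hold for a fibre of any size, since
      \<open>\<infinity> * 0\<close> is 0.\<close>
    then have "D_prod Z t z = 0" using D_prod_limits(3) by blast
    then show ?thesis by (simp add: Lambda_integral sgn_Lambda flip: zero_ereal_def)
  qed
  then show "ereal (\<integral>w'. Lam w' \<partial>\<mu>) = (\<Sum>\<^sub>\<infinity>y\<in>U_fibre \<iota> e Z T t z w. ereal (sgn (Lam y)))"
    "(\<Sum>\<^sub>\<infinity>y\<in>U_fibre \<iota> e Z T t z w. ereal (sgn (Lam y))) =
      ext_card (U_fibre \<iota> e Z T t z w) * ereal (sgn (D_prod Z t z))"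
    by auto
qed

end

end

section \<open>Integration over the product space, and the classical case\<close>

context jump_shift
begin

text \<open>A coefficient -1 puts the image inside the kernel of some \<open>\<xi> n\<close>, which
  is a null set. Only this inclusion is known of the image, hence the completion.\<close>

lemma image_degenerate_null:
  assumes z: "good z" and deg: "z \<notin> nondegeneracy_set P Z T t"
  shows "U_map \<iota> e Z T t z ` W_dom \<iota> e Z T t z \<in> null_sets (completion \<mu>)"
proof -
  obtain n where n: "1 + coef z n = 0"
    using deg nondegeneracy_set_iff[OF z_space[OF z]] by blast
  have "\<xi> n (U_map \<iota> e Z T t z w) = 0" if "w \<in> W_dom \<iota> e Z T t z" for w
    using \<xi>_shift[of w "coef z" n] n that by (simp add: W_dom_eq U_map_eq)
  then have sub: "U_map \<iota> e Z T t z ` W_dom \<iota> e Z T t z \<subseteq> {w. \<xi> n w = 0}" by auto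
  have "{w. \<xi> n w = 0} \<in> null_sets \<mu>"
    using AE_\<xi>_nonzero[of n] by (subst (asm) AE_iff_null) (auto simp: sets_\<mu>)
  then show ?thesis
    using sub by (intro null_sets_completion_subset[OF sub]) (auto intro: null_sets_completionI)
qed

text \<open>Measurability of \<open>good\<close> is not established, so its failure is covered by a
  measurable null set, whose complement lifts to the product.\<close>

lemma AE_prod_good: "AE p in \<mu> \<Otimes>\<^sub>M P. good (snd p)"
proof -
  obtain N where N: "{z \<in> space P. \<not> good z} \<subseteq> N" "N \<in> sets P" "emeasure P N = 0"
    using AE_good by (elim AE_E)
  have "AE z in P. z \<notin> N" using N(2,3) by (intro AE_not_in) (simp add: null_sets_def)
  then have "AE p in \<mu> \<Otimes>\<^sub>M P. snd p \<notin> N"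
    using N(2) by (intro WP.AE_pair_measure) (auto simp: AE_const)
  then show ?thesis
    using AE_space by eventually_elim (use N(1) in \<open>auto simp: space_pair_measure\<close>)
qed

text \<open>For good \<open>z\<close> this is an almost sure property of \<open>w\<close>; joint
  measurability allows the exchange of the two quantifiers.\<close>

lemma AE_prod_regular:
  "AE p in \<mu> \<Otimes>\<^sub>M P. fst p \<in> shift_dom (coef (snd p)) \<and> (\<forall>n. \<xi> n (fst p) \<noteq> 0)"
proof -
  have meas: "Measurable.pred (\<mu> \<Otimes>\<^sub>M P) (\<lambda>p. fst p \<in> shift_dom (coef (snd p)) \<and> (\<forall>n. \<xi> n (fst p) \<noteq> 0))"
    by measurable
  have "AE z in P. AE w in \<mu>. w \<in> shift_dom (coef z) \<and> (\<forall>n. \<xi> n w \<noteq> 0)"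
    using AE_good
  proof eventually_elim
    case (elim z)
    have "AE w in \<mu>. \<forall>n. \<xi> n w \<noteq> 0" by (simp add: AE_all_countable AE_\<xi>_nonzero)
    then show ?case using dom_AE[OF elim] by eventually_elim simp
  qed
  then have "AE w in \<mu>. AE z in P. w \<in> shift_dom (coef z) \<and> (\<forall>n. \<xi> n w \<noteq> 0)"
    using WP.AE_commute[of "\<lambda>w z. w \<in> shift_dom (coef z) \<and> (\<forall>n. \<xi> n w \<noteq> 0)"] meas
    by (simp add: pred_def)
  then show ?thesis
    using meas by (intro WP.AE_pair_measure) (simp_all add: pred_def)
qed

text \<open>The two integrands are replaced almost everywhere by the jointly measurable
  \<open>?L\<close> and \<open>?R\<close> before Fubini is applied. For fixed nondegenerate
  \<open>z\<close> the point \<open>w\<close> in \<open>g\<close> is written as the inverse image of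
  its own shift, so that apart from the density the integrand becomes a function of the image
  point.\<close>

lemma product_change_of_variables:
  fixes f g :: "'w \<times> 'o \<Rightarrow> ennreal"
  assumes f: "f \<in> borel_measurable (\<mu> \<Otimes>\<^sub>M P)" and g: "g \<in> borel_measurable (\<mu> \<Otimes>\<^sub>M P)"
  shows "(\<integral>\<^sup>+(w, z). f (U_map \<iota> e Z T t z w, z) * ennreal \<bar>Lambda \<iota> e Z T t \<delta>u z w\<bar> * g (w, z)
           \<partial>(\<mu> \<Otimes>\<^sub>M P)) =
        (\<integral>\<^sup>+(w, z). f (w, z) * (\<Sum>\<^sub>\<infinity>y\<in>U_fibre \<iota> e Z T t z w. g (y, z)) \<partial>(\<mu> \<Otimes>\<^sub>M P))"
proof -
  note [measurable] = f g
  let ?L = "\<lambda>p. f (shift (coef (snd p)) (fst p), snd p) * ennreal \<bar>dens (snd p) (fst p)\<bar> * g p"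
  let ?R = "\<lambda>p. f p * (if \<forall>n. 1 + coef (snd p) n \<noteq> 0
      then g (shift (inv_coeff (coef (snd p))) (fst p), snd p) else 0)"
  have [measurable]: "(\<lambda>p. (shift (coef (snd p)) (fst p), snd p)) \<in> \<mu> \<Otimes>\<^sub>M P \<rightarrow>\<^sub>M \<mu> \<Otimes>\<^sub>M P"
    "(\<lambda>p. (shift (inv_coeff (coef (snd p))) (fst p), snd p)) \<in> \<mu> \<Otimes>\<^sub>M P \<rightarrow>\<^sub>M \<mu> \<Otimes>\<^sub>M P"
    by (auto intro!: measurable_Pair simp: measurable_cong_sets[OF refl sets_\<mu>])
  have L [measurable]: "?L \<in> borel_measurable (\<mu> \<Otimes>\<^sub>M P)" by measurable
  have R [measurable]: "?R \<in> borel_measurable (\<mu> \<Otimes>\<^sub>M P)" by measurable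
  have "(\<integral>\<^sup>+(w, z). f (U_map \<iota> e Z T t z w, z) * ennreal \<bar>Lambda \<iota> e Z T t \<delta>u z w\<bar> * g (w, z)
      \<partial>(\<mu> \<Otimes>\<^sub>M P)) = (\<integral>\<^sup>+p. ?L p \<partial>(\<mu> \<Otimes>\<^sub>M P))"
  proof (rule nn_integral_cong_AE)
    show "AE p in \<mu> \<Otimes>\<^sub>M P. (case p of (w, z) \<Rightarrow>
        f (U_map \<iota> e Z T t z w, z) * ennreal \<bar>Lambda \<iota> e Z T t \<delta>u z w\<bar> * g (w, z)) = ?L p"
      using AE_prod_good AE_prod_regular
      by eventually_elim (auto simp: case_prod_beta U_map_eq Lambda_eq_dens)
  qed
  also have "\<dots> = (\<integral>\<^sup>+z. \<integral>\<^sup>+w. ?L (w, z) \<partial>\<mu> \<partial>P)"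
    by (rule WP.nn_integral_snd[OF L, symmetric])
  also have "\<dots> = (\<integral>\<^sup>+z. \<integral>\<^sup>+w. ?R (w, z) \<partial>\<mu> \<partial>P)"
  proof (rule nn_integral_cong_AE)
    show "AE z in P. (\<integral>\<^sup>+w. ?L (w, z) \<partial>\<mu>) = (\<integral>\<^sup>+w. ?R (w, z) \<partial>\<mu>)"
      using AE_good
    proof eventually_elim
      case (elim z)
      have [measurable]: "(\<lambda>w. (w, z)) \<in> borel \<rightarrow>\<^sub>M \<mu> \<Otimes>\<^sub>M P"
        using z_space[OF elim] by (intro measurable_Pair) (auto simp: measurable_cong_sets[OF refl sets_\<mu>])
      have [measurable]: "(\<lambda>w. (shift b w, z)) \<in> borel \<rightarrow>\<^sub>M \<mu> \<Otimes>\<^sub>M P" for b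
        using measurable_compose[OF shift_measurable \<open>(\<lambda>w. (w, z)) \<in> borel \<rightarrow>\<^sub>M \<mu> \<Otimes>\<^sub>M P\<close>] .
      show ?case
      proof (cases "\<forall>n. 1 + coef z n \<noteq> 0")
        case True
        let ?h = "\<lambda>w. f (w, z) * g (shift (inv_coeff (coef z)) w, z)"
        have "(\<integral>\<^sup>+w. ?L (w, z) \<partial>\<mu>) = (\<integral>\<^sup>+w. ?h (shift (coef z) w) * ennreal \<bar>dens z w\<bar> \<partial>\<mu>)"
          by (rule nn_integral_cong_AE)
             (use dom_AE[OF elim] in eventually_elim, simp add: shift_inv_shift[OF spec[OF True] sq_coef[OF elim]] mult_ac)
        also have "\<dots> = (\<integral>\<^sup>+w. ?h w \<partial>\<mu>)"
          by (rule dens_change_of_variables[OF elim True]) measurable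
        finally show ?thesis using True by simp
      next
        case False
        then have "D_prod Z t z = 0" using D_prod_limits(3)[OF elim] by blast
        then have "?L (w, z) = 0" for w by (simp add: dens_eq[OF elim])
        moreover have "?R (w, z) = 0" for w using False by auto
        ultimately show ?thesis by (simp only:)
      qed
    qed
  qed
  also have "\<dots> = (\<integral>\<^sup>+p. ?R p \<partial>(\<mu> \<Otimes>\<^sub>M P))"
    by (rule WP.nn_integral_snd[OF R])
  also have "\<dots> = (\<integral>\<^sup>+(w, z). f (w, z) * (\<Sum>\<^sub>\<infinity>y\<in>U_fibre \<iota> e Z T t z w. g (y, z)) \<partial>(\<mu> \<Otimes>\<^sub>M P))"
  proof (rule nn_integral_cong_AE)
    show "AE p in \<mu> \<Otimes>\<^sub>M P. ?R p = (case p of (w, z) \<Rightarrow> f (w, z) * (\<Sum>\<^sub>\<infinity>y\<in>U_fibre \<iota> e Z T t z w. g (y, z)))"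
      using AE_prod_good AE_prod_regular
    proof eventually_elim
      case (elim p)
      show ?case
      proof (cases "\<forall>n. 1 + coef (snd p) n \<noteq> 0")
        case True
        then show ?thesis
          using elim fibre_singleton[OF elim(1) True, of "fst p"] by (simp add: case_prod_beta)
      next
        case False
        \<comment> \<open>No coordinate of \<open>fst p\<close> vanishes, while in the degenerate
          case every image point has a vanishing coordinate.\<close>
        then have "U_fibre \<iota> e Z T t (snd p) (fst p) = {}"
          using elim by (intro fibre_empty) auto
        then show ?thesis
          by (simp only: if_not_P[OF False] mult_zero_right case_prod_beta infsum_empty)
      qed
    qed
  qed
  finally show ?thesis .
qed

text \<open>The exceptional set is covered by a measurable null set of
  \<open>\<mu> \<Otimes>\<^sub>M P\<close>, which the swap of coordinates carries to the order of
  factors used here.\<close>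

lemma AE_fibre_sign_sum:
  "AE (z, w) in P \<Otimes>\<^sub>M \<mu>.
        ereal (\<integral>w'. Lambda \<iota> e Z T t \<delta>u z w' \<partial>\<mu>) =
          (\<Sum>\<^sub>\<infinity>y\<in>U_fibre \<iota> e Z T t z w. ereal (sgn (Lambda \<iota> e Z T t \<delta>u z y))) \<and>
        (\<Sum>\<^sub>\<infinity>y\<in>U_fibre \<iota> e Z T t z w. ereal (sgn (Lambda \<iota> e Z T t \<delta>u z y))) =
          ext_card (U_fibre \<iota> e Z T t z w) * ereal (sgn (D_prod Z t z))"
proof -
  have "AE p in \<mu> \<Otimes>\<^sub>M P. good (snd p) \<and> fst p \<in> shift_dom (coef (snd p))"
    using AE_prod_good AE_prod_regular by eventually_elim simp
  then obtain N where N: "{p \<in> space (\<mu> \<Otimes>\<^sub>M P). \<not> (good (snd p) \<and> fst p \<in> shift_dom (coef (snd p)))} \<subseteq> N"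
    "N \<in> null_sets (\<mu> \<Otimes>\<^sub>M P)"
    by (elim AE_E) (auto simp: null_sets_def)
  have "AE p in \<mu> \<Otimes>\<^sub>M P. p \<notin> N" by (rule AE_not_in[OF N(2)])
  then have "AE p in distr (P \<Otimes>\<^sub>M \<mu>) (\<mu> \<Otimes>\<^sub>M P) (\<lambda>(z, w). (w, z)). p \<notin> N"
    by (subst WP.distr_pair_swap[symmetric])
  then have "AE p in P \<Otimes>\<^sub>M \<mu>. (case p of (z, w) \<Rightarrow> (w, z)) \<notin> N"
    by (rule AE_distrD[rotated]) measurable
  then show ?thesis
    using AE_space
  proof eventually_elim
    case (elim p)
    obtain z w where p: "p = (z, w)" by (cases p)
    have "(w, z) \<in> space (\<mu> \<Otimes>\<^sub>M P)" "(w, z) \<notin> N"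
      using elim by (simp_all add: p space_pair_measure)
    then have "good (snd (w, z)) \<and> fst (w, z) \<in> shift_dom (coef (snd (w, z)))" using N(1) by blast
    then have "good z \<and> w \<in> shift_dom (coef z)" by simp
    then show ?case using fibre_sign_sum[of z w] by (simp add: p)
  qed
qed

text \<open>The chosen density enters only through its integrals, which return the path of the
  displacement. The equation thus says that \<open>U_map\<close> at \<open>v\<close> and
  \<open>w\<close> have the same path, and a vector is determined by its path.\<close>

lemma shift_equation_iff:
  assumes c: "classical_wiener_space c \<mu> \<iota>" and v: "v \<in> shift_dom (coef z)"
  shows "(\<forall>\<tau>\<in>{0..1}. c v \<tau> = c w \<tau> - (LINT s:{0..\<tau>}|lborel. path_density c (\<iota> (u_field \<iota> e Z T t z v)) s)) \<longleftrightarrow>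
    U_map \<iota> e Z T t z v = w"
proof -
  let ?y = "\<iota> (u_field \<iota> e Z T t z v)"
  have C0: "is_C0_unit_interval c" using c by (simp add: classical_wiener_space_def)
  have "\<forall>h. \<exists>g. is_path_density c (\<iota> h) g \<and> (norm h)\<^sup>2 = (LINT s:{0..1}|lborel. (g s)\<^sup>2)"
    using c unfolding classical_wiener_space_def by (elim conjE)
  then have "\<exists>g. is_path_density c ?y g" by (meson spec)
  then have "is_path_density c ?y (path_density c ?y)" unfolding path_density_def by (rule someI_ex)
  then have int: "(LINT s:{0..\<tau>}|lborel. path_density c ?y s) = c ?y \<tau>" if "\<tau> \<in> {0..1}" for \<tau>
    using that by (simp add: is_path_density_def)
  have lin: "linear (\<lambda>w. c w \<tau>)" if "\<tau> \<in> {0..1}" for \<tau>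
    using C0 that by (simp add: is_C0_unit_interval_def)
  have add: "c (U_map \<iota> e Z T t z v) \<tau> = c v \<tau> + c ?y \<tau>" if "\<tau> \<in> {0..1}" for \<tau>
    using linear_add[OF lin[OF that]] by (simp add: U_map_def)
  have uniq: "v1 = v2" if "\<forall>\<tau>\<in>{0..1}. c v1 \<tau> = c v2 \<tau>" for v1 v2
  proof -
    have "continuous_on {0..1} (c v2) \<and> c v2 0 = 0" using C0 by (simp add: is_C0_unit_interval_def)
    moreover have "\<forall>x. continuous_on {0..1} x \<and> x 0 = 0 \<longrightarrow> (\<exists>!w. \<forall>\<tau>\<in>{0..1}. c w \<tau> = x \<tau>)"
      using C0 unfolding is_C0_unit_interval_def by (elim conjE)
    ultimately have "\<exists>!w. \<forall>\<tau>\<in>{0..1}. c w \<tau> = c v2 \<tau>" by (elim allE[of _ "c v2"] mp)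
    then show ?thesis by (rule ex1E) (use that in metis)
  qed
  have "(\<forall>\<tau>\<in>{0..1}. c v \<tau> = c w \<tau> - (LINT s:{0..\<tau>}|lborel. path_density c ?y s)) \<longleftrightarrow>
      (\<forall>\<tau>\<in>{0..1}. c (U_map \<iota> e Z T t z v) \<tau> = c w \<tau>)"
    by (rule ball_cong[OF refl]) (auto simp: int add)
  also have "\<dots> \<longleftrightarrow> U_map \<iota> e Z T t z v = w" using uniq by auto
  finally show ?thesis .
qed

text \<open>Integral 1 excludes the degenerate case, where \<open>Lambda\<close> is 0. A strong
  solution is then the same as a measurable almost sure right inverse of \<open>U\<close> with
  values in \<open>D\<close>, and injectivity of \<open>U\<close> on \<open>D\<close> gives
  uniqueness.\<close>

lemma classical_inverse:
  assumes z: "good z" and c: "classical_wiener_space c \<mu> \<iota>"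
    and one: "(\<integral>\<^sup>+w. ennreal \<bar>Lambda \<iota> e Z T t \<delta>u z w\<bar> \<partial>\<mu>) = 1"
  defines "D \<equiv> W_dom \<iota> e Z T t z" and "U \<equiv> U_map \<iota> e Z T t z"
    and "udot \<equiv> \<lambda>w. path_density c (\<iota> (u_field \<iota> e Z T t z w))"
  shows "(\<exists>V. ae_inverse \<mu> D U V) \<and>
    (\<forall>V. ae_inverse \<mu> D U V \<longrightarrow>
      strong_solution \<mu> c D udot V \<and>
      (\<forall>V'. strong_solution \<mu> c D udot V' \<longrightarrow> (AE w in \<mu>. V' w = V w)))"
proof -
  have nz: "\<forall>n. 1 + coef z n \<noteq> 0"
  proof (rule ccontr)
    assume "\<not> (\<forall>n. 1 + coef z n \<noteq> 0)"
    then show False using one Lambda_degenerate[OF z] by simp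
  qed
  note nzs = spec[OF nz] sq_coef[OF z]
  have D: "D = shift_dom (coef z)" by (simp add: D_def W_dom_eq)
  have U: "U w = shift (coef z) w" if "w \<in> D" for w using that by (simp add: U_def D U_map_eq)
  have inv_U: "shift (inv_coeff (coef z)) (U v) = v" if "v \<in> D" for v
    using shift_inv_shift[OF nzs, of v] that U[OF that] by (simp add: D)
  have sol_iff: "strong_solution \<mu> c D udot V \<longleftrightarrow>
      V \<in> measurable \<mu> \<mu> \<and> (AE w in \<mu>. V w \<in> D \<and> U (V w) = w)" for V
  proof -
    have "V w \<in> D \<and> (\<forall>\<tau>\<in>{0..1}. c (V w) \<tau> = c w \<tau> - (LINT s:{0..\<tau>}|lborel. udot (V w) s)) \<longleftrightarrow>
        V w \<in> D \<and> U (V w) = w" for w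
      unfolding udot_def U_def D using shift_equation_iff[OF c, of "V w" z w] by auto
    then show ?thesis unfolding strong_solution_def by (simp only:)
  qed
  have "ae_inverse \<mu> D U (shift (inv_coeff (coef z)))"
    unfolding ae_inverse_def
  proof (intro conjI)
    show "shift (inv_coeff (coef z)) \<in> measurable \<mu> \<mu>"
      unfolding measurable_cong_sets[OF sets_\<mu> sets_\<mu>] by (rule shift_measurable)
    show "AE w in \<mu>. shift (inv_coeff (coef z)) w \<in> D \<and> U (shift (inv_coeff (coef z)) w) = w"
      using dom_AE[OF z] by eventually_elim (simp add: D U shift_shift_inv[OF nzs])
    show "AE w in \<mu>. w \<in> D \<and> shift (inv_coeff (coef z)) (U w) = w"
      using dom_AE[OF z] by eventually_elim (simp add: D U shift_inv_shift[OF nzs])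
  qed
  moreover have "strong_solution \<mu> c D udot V \<and>
      (\<forall>V'. strong_solution \<mu> c D udot V' \<longrightarrow> (AE w in \<mu>. V' w = V w))"
    if V: "ae_inverse \<mu> D U V" for V
  proof (intro conjI allI impI)
    have V_inv: "AE w in \<mu>. V w \<in> D \<and> U (V w) = w" using V by (simp add: ae_inverse_def)
    then show "strong_solution \<mu> c D udot V" using V by (simp add: sol_iff ae_inverse_def)
    fix V' assume "strong_solution \<mu> c D udot V'"
    then have "AE w in \<mu>. V' w \<in> D \<and> U (V' w) = w" by (simp add: sol_iff)
    then show "AE w in \<mu>. V' w = V w"
      using V_inv
    proof eventually_elim
      case (elim w)
      then show ?case using inv_U[of "V w"] inv_U[of "V' w"] by simp
    qed
  qed
  ultimately show ?thesis by blast
qed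

end

theorem theorem2:
  fixes P :: "'o measure"
    and F :: "real \<Rightarrow> 'o measure"
    and Z :: "real \<Rightarrow> 'o \<Rightarrow> real"
    and T :: "nat \<Rightarrow> 'o \<Rightarrow> ennreal"
    and \<mu> :: "'w::separable_frechet_space measure"
    and \<iota> :: "'h::{real_inner, complete_space} \<Rightarrow> 'w"
    and e :: "nat \<Rightarrow> 'h"
    and t :: real
    and \<delta>u :: "'o \<Rightarrow> 'w \<Rightarrow> real"
  assumes filt: "usual_filtered_prob_space P F"
    and semi: "semimartingale P F Z"
    and exhaust: "exhausts_jumps P F Z T"
    and aws: "abstract_wiener_space \<mu> \<iota>"
    and basis: "complete_orthonormal_basis e"
    and basis_dual: "range e \<subseteq> dual_in_H \<iota>"
    and t_nonneg: "0 \<le> t"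
    and version: "divergence_version \<iota> e Z T t \<mu> P \<delta>u"
  shows "
    (AE z in P. z \<notin> nondegeneracy_set P Z T t \<longrightarrow>
        U_map \<iota> e Z T t z ` W_dom \<iota> e Z T t z \<in> null_sets (completion \<mu>)) \<and>

    (\<forall>f g :: 'w \<times> 'o \<Rightarrow> ennreal.
        f \<in> borel_measurable (\<mu> \<Otimes>\<^sub>M P) \<longrightarrow> g \<in> borel_measurable (\<mu> \<Otimes>\<^sub>M P) \<longrightarrow>
        (\<integral>\<^sup>+(w, z). f (U_map \<iota> e Z T t z w, z) * ennreal \<bar>Lambda \<iota> e Z T t \<delta>u z w\<bar> * g (w, z)
           \<partial>(\<mu> \<Otimes>\<^sub>M P)) =
        (\<integral>\<^sup>+(w, z). f (w, z) * (\<Sum>\<^sub>\<infinity>y\<in>U_fibre \<iota> e Z T t z w. g (y, z)) \<partial>(\<mu> \<Otimes>\<^sub>M P))) \<and>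

    (AE z in P. integrable \<mu> (Lambda \<iota> e Z T t \<delta>u z) \<and>
        (\<forall>f :: 'w \<Rightarrow> ennreal. f \<in> borel_measurable \<mu> \<longrightarrow>
          weighted_integral_exists \<mu> (\<lambda>w. f (U_map \<iota> e Z T t z w)) (Lambda \<iota> e Z T t \<delta>u z) \<and>
          weighted_integral \<mu> (\<lambda>w. f (U_map \<iota> e Z T t z w)) (Lambda \<iota> e Z T t \<delta>u z) =
            enn2ereal (\<integral>\<^sup>+w. f w \<partial>\<mu>) * ereal (\<integral>w. Lambda \<iota> e Z T t \<delta>u z w \<partial>\<mu>))) \<and>

    (AE (z, w) in P \<Otimes>\<^sub>M \<mu>.
        ereal (\<integral>w'. Lambda \<iota> e Z T t \<delta>u z w' \<partial>\<mu>) =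
          (\<Sum>\<^sub>\<infinity>y\<in>U_fibre \<iota> e Z T t z w. ereal (sgn (Lambda \<iota> e Z T t \<delta>u z y))) \<and>
        (\<Sum>\<^sub>\<infinity>y\<in>U_fibre \<iota> e Z T t z w. ereal (sgn (Lambda \<iota> e Z T t \<delta>u z y))) =
          ext_card (U_fibre \<iota> e Z T t z w) * ereal (sgn (D_prod Z t z))) \<and>

    (\<forall>c. classical_wiener_space c \<mu> \<iota> \<longrightarrow>
        (AE z in P. (\<integral>\<^sup>+w. ennreal \<bar>Lambda \<iota> e Z T t \<delta>u z w\<bar> \<partial>\<mu>) = 1 \<longrightarrow>
          (\<exists>V. ae_inverse \<mu> (W_dom \<iota> e Z T t z) (U_map \<iota> e Z T t z) V) \<and>
          (\<forall>V. ae_inverse \<mu> (W_dom \<iota> e Z T t z) (U_map \<iota> e Z T t z) V \<longrightarrow>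
            strong_solution \<mu> c (W_dom \<iota> e Z T t z)
              (\<lambda>w. path_density c (\<iota> (u_field \<iota> e Z T t z w))) V \<and>
            (\<forall>V'. strong_solution \<mu> c (W_dom \<iota> e Z T t z)
                (\<lambda>w. path_density c (\<iota> (u_field \<iota> e Z T t z w))) V' \<longrightarrow>
              (AE w in \<mu>. V' w = V w)))))"
proof -
  interpret jump_shift \<mu> \<iota> e P F Z T t \<delta>u
    by unfold_locales fact+
  have degenerate: "AE z in P. z \<notin> nondegeneracy_set P Z T t \<longrightarrow>
      U_map \<iota> e Z T t z ` W_dom \<iota> e Z T t z \<in> null_sets (completion \<mu>)"
    using AE_good by eventually_elim (auto intro: image_degenerate_null)
  have weighted: "AE z in P. integrable \<mu> (Lambda \<iota> e Z T t \<delta>u z) \<and>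
        (\<forall>f :: 'w \<Rightarrow> ennreal. f \<in> borel_measurable \<mu> \<longrightarrow>
          weighted_integral_exists \<mu> (\<lambda>w. f (U_map \<iota> e Z T t z w)) (Lambda \<iota> e Z T t \<delta>u z) \<and>
          weighted_integral \<mu> (\<lambda>w. f (U_map \<iota> e Z T t z w)) (Lambda \<iota> e Z T t \<delta>u z) =
            enn2ereal (\<integral>\<^sup>+w. f w \<partial>\<mu>) * ereal (\<integral>w. Lambda \<iota> e Z T t \<delta>u z w \<partial>\<mu>))"
    using AE_good by eventually_elim (intro conjI allI impI Lambda_integrable Lambda_weighted_integral)
  have classical: "AE z in P. (\<integral>\<^sup>+w. ennreal \<bar>Lambda \<iota> e Z T t \<delta>u z w\<bar> \<partial>\<mu>) = 1 \<longrightarrow>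
          (\<exists>V. ae_inverse \<mu> (W_dom \<iota> e Z T t z) (U_map \<iota> e Z T t z) V) \<and>
          (\<forall>V. ae_inverse \<mu> (W_dom \<iota> e Z T t z) (U_map \<iota> e Z T t z) V \<longrightarrow>
            strong_solution \<mu> c (W_dom \<iota> e Z T t z)
              (\<lambda>w. path_density c (\<iota> (u_field \<iota> e Z T t z w))) V \<and>
            (\<forall>V'. strong_solution \<mu> c (W_dom \<iota> e Z T t z)
                (\<lambda>w. path_density c (\<iota> (u_field \<iota> e Z T t z w))) V' \<longrightarrow>
              (AE w in \<mu>. V' w = V w)))"
    if c: "classical_wiener_space c \<mu> \<iota>" for c
    using AE_good
  proof eventually_elim
    case (elim z)
    show ?case by (rule impI) (rule classical_inverse[OF elim c])
  qed
  show ?thesis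
    by (intro conjI allI impI degenerate product_change_of_variables weighted AE_fibre_sign_sum classical)
qed

end
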